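(* Let $Y$ be a reflexive asymptotic-$c_0$ Banach space. If $X$ is a Banach space that coarsely embeds into $Y$, then $X$ is also reflexive and asymptotic-$c_0$.
   Context: Banach spaces are real. $S_Z$ denotes the unit sphere of a Banach space $Z$, and $\mathrm{cof}(X)$ denotes the set of closed finite-codimensional subspaces of $X$. Equivalence: for $C\ge 1$, two linearly independent finite sequences $(x_i)_{i=1}^k$, $(y_i)_{i=1}^k$ in Banach spaces are $C$-equivalent, written $(x_i)\sim_C(y_i)$, if there are $A,B>0$ with $C=A\cdot B$ such that for all scalars $a_1,\dots,a_k$, $\frac1A\|\sum_{i=1}^k a_ix_i\|\le\|\sum_{i=1}^k a_iy_i\|\le B\|\sum_{i=1}^k a_ix_i\|$. Asymptotic structure: $\mathcal{E}_k$ is the set of all norms on $\mathbb{R}^k$ for which the unit vector basis $(e_j)_{j=1}^k$ is a normalized monotone basis. For a Banach space $X$ and $k\in\mathbb{N}$, the $k$-th asymptotic structure $\{X\}_k$ is the set of all $E=(\mathbb{R}^k,\|\cdot\|)\in\mathcal{E}_k$ such that $$\forall \varepsilon>0\ \forall X_1\in\mathrm{cof}(X)\ \exists x_1\in S_{X_1}\ \forall X_2\in\mathrm{cof}(X)\ \exists x_2\in S_{X_2}\cdots\forall X_k\in\mathrm{cof}(X)\ \exists x_k\in S_{X_k}:\ (x_j)_{j=1}^k\sim_{1+\varepsilon}(e_j)_{j=1}^k.$$ For $C\ge 1$, $X$ is $C$-asymptotic-$c_0$ (also called $C$-asymptotically $c_0$) if for all $k\in\mathbb{N}$ and all $E\in\{X\}_k$,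 the basis $(e_j)_{j=1}^k$ of $E$ is $C$-equivalent to the unit vector basis of $\ell_\infty^k$. $X$ is asymptotic-$c_0$ if it is $C$-asymptotic-$c_0$ for some $C\ge1$. Coarse embedding: for a map $f:(X,d_X)\to(Y,d_Y)$ between metric spaces let $\rho_f(t)=\inf\{d_Y(f(x),f(y)):d_X(x,y)\ge t\}$ and $\omega_f(t)=\sup\{d_Y(f(x),f(y)):d_X(x,y)\le t\}$, with the conventions $\inf\emptyset=+\infty$, $\sup\emptyset=0$. The map $f$ is a coarse embedding if $\lim_{t\to\infty}\rho_f(t)=\infty$ and $\omega_f(t)<\infty$ for all $t>0$. $X$ coarsely embeds into $Y$ if there is a coarse embedding $f:X\to Y$ (Banach spaces carry the norm metric). *)

theory Defs
  imports "HOL-Analysis.Analysis" "HOL-Analysis.Finite_Function_Topology"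
begin

section \<open>Reflexivity\<close>

text \<open>The canonical embedding into the bidual is onto.\<close>

definition reflexive_space :: "'a::real_normed_vector itself \<Rightarrow> bool" where
  "reflexive_space _ \<longleftrightarrow>
     (\<forall>\<phi> :: ('a \<Rightarrow>\<^sub>L real) \<Rightarrow>\<^sub>L real. \<exists>x::'a. \<forall>f. blinfun_apply \<phi> f = blinfun_apply f x)"

section \<open>Equivalence of finite sequences\<close>

text \<open>
  Spaces enter through a type of vectors and an explicit norm function, because the second
  space below is \<open>\<real>\<^sup>k\<close> with a varying norm. Sequences of length \<open>k\<close> are indexed from \<open>0\<close>.
\<close>

definition lin_indep_seq :: "nat \<Rightarrow> (nat \<Rightarrow> 'v::real_vector) \<Rightarrow> bool" where
  "lin_indep_seq k x \<longleftrightarrow> inj_on x {..<k} \<and> independent (x ` {..<k})"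

definition equivalent_seqs ::
  "real \<Rightarrow> nat \<Rightarrow> ('v::real_vector \<Rightarrow> real) \<Rightarrow> (nat \<Rightarrow> 'v)
     \<Rightarrow> ('w::real_vector \<Rightarrow> real) \<Rightarrow> (nat \<Rightarrow> 'w) \<Rightarrow> bool" where
  "equivalent_seqs C k N x M y \<longleftrightarrow>
     lin_indep_seq k x \<and> lin_indep_seq k y \<and>
     (\<exists>A B. 0 < A \<and> 0 < B \<and> C = A * B \<and>
        (\<forall>a :: nat \<Rightarrow> real.
           1 / A * N (\<Sum>i<k. a i *\<^sub>R x i) \<le> M (\<Sum>i<k. a i *\<^sub>R y i) \<and>
           M (\<Sum>i<k. a i *\<^sub>R y i) \<le> B * N (\<Sum>i<k. a i *\<^sub>R x i)))"

section \<open>Norms on \<open>\<real>\<^sup>k\<close>\<close>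

text \<open>
  \<open>\<real>\<^sup>k\<close>, for varying \<open>k\<close>, is the subspace of those finitely supported functions
  \<open>nat \<Rightarrow>\<^sub>0 real\<close> whose support lies in \<open>{..<k}\<close>. The values of a norm on \<open>\<real>\<^sup>k\<close> outside this
  subspace are irrelevant. The norm that the library puts on \<open>nat \<Rightarrow>\<^sub>0 real\<close> is not used.
\<close>

definition Rn :: "nat \<Rightarrow> (nat \<Rightarrow>\<^sub>0 real) set" where
  "Rn k = {v. Poly_Mapping.keys v \<subseteq> {..<k}}"

definition unit_vec :: "nat \<Rightarrow> nat \<Rightarrow>\<^sub>0 real" where
  "unit_vec j = Poly_Mapping.single j 1"

definition norm_on :: "'v::real_vector set \<Rightarrow> ('v \<Rightarrow> real) \<Rightarrow> bool" where
  "norm_on V N \<longleftrightarrow>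
     (\<forall>v\<in>V. 0 \<le> N v \<and> (N v = 0 \<longleftrightarrow> v = 0)) \<and>
     (\<forall>c. \<forall>v\<in>V. N (c *\<^sub>R v) = \<bar>c\<bar> * N v) \<and>
     (\<forall>u\<in>V. \<forall>v\<in>V. N (u + v) \<le> N u + N v)"

text \<open>\<open>\<E>\<^sub>k\<close>: the unit vector basis is normalized and monotone (initial projections have norm at
  most 1).\<close>

definition normalized_monotone_norms :: "nat \<Rightarrow> ((nat \<Rightarrow>\<^sub>0 real) \<Rightarrow> real) set" where
  "normalized_monotone_norms k =
     {N. norm_on (Rn k) N \<and> (\<forall>j<k. N (unit_vec j) = 1) \<and>
         (\<forall>a :: nat \<Rightarrow> real. \<forall>m\<le>k.
            N (\<Sum>i<m. a i *\<^sub>R unit_vec i) \<le> N (\<Sum>i<k. a i *\<^sub>R unit_vec i))}"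

text \<open>The norm of \<open>\<ell>\<^sub>\<infinity>\<^sup>k\<close>, meaningful for \<open>k \<ge> 1\<close>.\<close>

definition linf_norm :: "nat \<Rightarrow> (nat \<Rightarrow>\<^sub>0 real) \<Rightarrow> real" where
  "linf_norm k v = Max ((\<lambda>i. \<bar>Poly_Mapping.lookup v i\<bar>) ` {..<k})"

section \<open>Asymptotic structure\<close>

definition cof :: "'a::real_normed_vector set set" where
  "cof = {V. subspace V \<and> closed V \<and> (\<exists>F. finite F \<and> span (V \<union> F) = UNIV)}"

text \<open>
  \<open>cof_game n P xs\<close> is the formula with \<open>n\<close> quantifier pairs
  \<open>\<forall>X\<^sub>1 \<exists>x\<^sub>1 \<dots> \<forall>X\<^sub>n \<exists>x\<^sub>n. P (xs @ [x\<^sub>1, \<dots>, x\<^sub>n])\<close>, where \<open>X\<^sub>i\<close> ranges over \<open>cof\<close> and \<open>x\<^sub>i\<close> over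
  the unit sphere of \<open>X\<^sub>i\<close>.
\<close>

primrec cof_game :: "nat \<Rightarrow> ('a::real_normed_vector list \<Rightarrow> bool) \<Rightarrow> 'a list \<Rightarrow> bool" where
  "cof_game 0 P xs \<longleftrightarrow> P xs"
| "cof_game (Suc n) P xs \<longleftrightarrow>
     (\<forall>V\<in>cof. \<exists>x\<in>V. norm x = 1 \<and> cof_game n P (xs @ [x]))"

definition asymptotic_structure ::
  "'a::real_normed_vector itself \<Rightarrow> nat \<Rightarrow> ((nat \<Rightarrow>\<^sub>0 real) \<Rightarrow> real) set" where
  "asymptotic_structure _ k =
     {N \<in> normalized_monotone_norms k.
        \<forall>\<epsilon>>0. cof_game k
          (\<lambda>xs :: 'a list. equivalent_seqs (1 + \<epsilon>) k norm (\<lambda>i. xs ! i) N unit_vec) []}"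

definition C_asymptotically_c0 :: "real \<Rightarrow> 'a::real_normed_vector itself \<Rightarrow> bool" where
  "C_asymptotically_c0 C T \<longleftrightarrow>
     (\<forall>k\<ge>1. \<forall>N \<in> asymptotic_structure T k.
        equivalent_seqs C k N unit_vec (linf_norm k) unit_vec)"

definition asymptotically_c0 :: "'a::real_normed_vector itself \<Rightarrow> bool" where
  "asymptotically_c0 T \<longleftrightarrow> (\<exists>C\<ge>1. C_asymptotically_c0 C T)"

section \<open>Coarse embeddings\<close>

text \<open>Values in \<open>ennreal\<close>, where \<open>Inf {} = \<infinity>\<close> and \<open>Sup {} = 0\<close>.\<close>

definition compression_modulus :: "('a::metric_space \<Rightarrow> 'b::metric_space) \<Rightarrow> real \<Rightarrow> ennreal" where
  "compression_modulus f t = Inf {ennreal (dist (f x) (f y)) | x y. dist x y \<ge> t}"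

definition expansion_modulus :: "('a::metric_space \<Rightarrow> 'b::metric_space) \<Rightarrow> real \<Rightarrow> ennreal" where
  "expansion_modulus f t = Sup {ennreal (dist (f x) (f y)) | x y. dist x y \<le> t}"

definition coarse_embedding :: "('a::metric_space \<Rightarrow> 'b::metric_space) \<Rightarrow> bool" where
  "coarse_embedding f \<longleftrightarrow>
     (compression_modulus f \<longlongrightarrow> \<infinity>) at_top \<and> (\<forall>t>0. expansion_modulus f t < \<infinity>)"

definition coarsely_embeds ::
  "'a::metric_space itself \<Rightarrow> 'b::metric_space itself \<Rightarrow> bool" where
  "coarsely_embeds _ _ \<longleftrightarrow> (\<exists>f :: 'a \<Rightarrow> 'b. coarse_embedding f)"

end

theory Submission
  imports Defs
begin

text \<open>
  The bridge between the two spaces is a concentration property. Consider functions \<open>g\<close> of \<open>m\<close>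
  variables with values in a Banach space that move by at most \<open>L\<close> when one variable changes, that
  is, functions that are Lipschitz for the Hamming metric. The space has the concentration property
  if, for the iterated limit along any ultrafilter, almost all values of \<open>g\<close> lie within a distance
  \<open>D\<close> of each other, where \<open>D\<close> depends on \<open>L\<close> but not on \<open>m\<close>.

  A reflexive asymptotic-\<open>c\<^sub>0\<close> space \<open>Y\<close> has it (\<open>hamming_concentration_reflexive_c0\<close>). Taking weak
  limits of \<open>g\<close> in one variable after the other, which exist by reflexivity, writes \<open>g\<close> minus a
  constant as the sum of the increments along a branch of a weakly null tree. The increments have
  norm at most \<open>L\<close>, and in an asymptotic-\<open>c\<^sub>0\<close> space such a sum is bounded independently of the
  length of the branch: iterated limits of norms along a normalized tree of vectors that lie deeper
  and deeper in \<open>Y\<close> belong to the asymptotic structure (\<open>limit_norm_in_asymptotic_structure\<close>).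

  The property passes to every \<open>X\<close> that embeds coarsely into \<open>Y\<close>, because the expansion modulus
  turns the Lipschitz condition in \<open>X\<close> into one in \<open>Y\<close>, and the compression modulus turns bounded
  distances in \<open>Y\<close> into bounded distances in \<open>X\<close> (\<open>hamming_concentration_coarse\<close>). Reflexivity and
  the asymptotic-\<open>c\<^sub>0\<close> property of \<open>X\<close> are then both consequences of concentration.

  Reflexivity (\<open>reflexive_of_hamming_concentration\<close>): if an element \<open>\<phi>\<close> of the bidual has positive
  distance \<open>d\<close> from \<open>X\<close>, then a bounded net in \<open>X\<close> converges weak* to \<open>\<phi>\<close>. The sum of \<open>m\<close> terms of
  the net is a Hamming-Lipschitz function. Given one such sum \<open>z\<close>, some functional of norm at most
  \<open>1\<close> tells \<open>m \<phi>\<close> from \<open>z\<close> by \<open>m d\<close>, and then tells most other sums from \<open>z\<close> by \<open>m d / 2\<close>. This is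
  unbounded in \<open>m\<close>.

  The asymptotic-\<open>c\<^sub>0\<close> property (\<open>winning_bounded_by_concentration\<close>): concentration first gives a
  bound \<open>D\<close> for the sums of arrays, where the rows do not depend on the vectors chosen before. The
  vectors of the asymptotic game form a tree instead, and the sum along a branch is not a
  Hamming-Lipschitz function of the branch: changing the first vector changes all later ones. So all
  nodes of a tree of height \<open>k\<close> are built, indexed by the finite sets of natural numbers. The nodes
  that are created at time \<open>n\<close> on the same level form an array and have a sum of norm at most \<open>D\<close>.
  Call it \<open>y\<^sub>i(n)\<close>, where \<open>i\<close> is the level. Then \<open>\<Sum>\<^sub>i a\<^sub>i y\<^sub>i(n\<^sub>i)\<close> is Hamming-Lipschitz in
  \<open>(n\<^sub>1, \<dots>, n\<^sub>k)\<close>, and contains the sum along the branch \<open>{n\<^sub>1, \<dots>, n\<^sub>k}\<close> together with unwanted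
  nodes. A functional that norms the branch does not see the unwanted nodes: every node carries a
  functional that is a weak* limit of those of its children (\<open>winning_of_cof_game\<close>), and the nodes
  are chosen one after the other in the kernels of the functionals that exist already and with
  functionals close to those of their parents (\<open>ex_biorthogonal_tree\<close>). Hence the branch sums are
  bounded independently of \<open>k\<close>.
\<close>

section \<open>The Hahn--Banach theorem\<close>

definition sublinear :: "('a::real_vector \<Rightarrow> real) \<Rightarrow> bool" where
  "sublinear q \<longleftrightarrow> (\<forall>x y. q (x + y) \<le> q x + q y) \<and> (\<forall>c\<ge>0. \<forall>x. q (c *\<^sub>R x) = c * q x)"

lemma sublinear_zero: "sublinear q \<Longrightarrow> q 0 = 0"
  unfolding sublinear_def by (metis mult_zero_left order_refl scaleR_zero_left)

lemma sublinear_ge_neg: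
  assumes "sublinear q"
  shows "- q (- x) \<le> q x"
proof -
  have "q (x + - x) \<le> q x + q (- x)" using assms unfolding sublinear_def by blast
  then show ?thesis using sublinear_zero[OF assms] by simp
qed

text \<open>
  The largest sublinear minorant of \<open>q\<close> that is at most \<open>- q w\<close> at \<open>- w\<close>. It forces a dominated
  linear functional to agree with \<open>q\<close> at \<open>w\<close>.
\<close>

definition sublinear_shift :: "('a::real_vector \<Rightarrow> real) \<Rightarrow> 'a \<Rightarrow> 'a \<Rightarrow> real" where
  "sublinear_shift q w x = (INF t\<in>{0::real..}. q (x + t *\<^sub>R w) - t * q w)"

lemma sublinear_shift_le:
  assumes q: "sublinear q" and t: "t \<ge> 0"
  shows "sublinear_shift q w x \<le> q (x + t *\<^sub>R w) - t * q w"
proof -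
  have "- q (- x) \<le> q (x + t *\<^sub>R w) - t * q w" if "t \<ge> 0" for t
  proof -
    have "q (t *\<^sub>R w) = t * q w" using q that unfolding sublinear_def by blast
    moreover have "q ((x + t *\<^sub>R w) + (- x)) \<le> q (x + t *\<^sub>R w) + q (- x)"
      using q unfolding sublinear_def by blast
    ultimately show ?thesis by simp
  qed
  then have "bdd_below ((\<lambda>t. q (x + t *\<^sub>R w) - t * q w) ` {0..})"
    by (intro bdd_belowI[of _ "- q (- x)"]) auto
  then show ?thesis unfolding sublinear_shift_def
    using t by (intro cINF_lower) auto
qed

lemma sublinear_shift_greatest:
  assumes "\<And>t. t \<ge> 0 \<Longrightarrow> c \<le> q (x + t *\<^sub>R w) - t * q w"
  shows "c \<le> sublinear_shift q w x"
  unfolding sublinear_shift_def using assms by (intro cINF_greatest) auto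

lemma sublinear_shift:
  assumes q: "sublinear q"
  shows "sublinear (sublinear_shift q w)"
proof -
  let ?r = "sublinear_shift q w"
  have sub: "?r (x + y) \<le> ?r x + ?r y" for x y
  proof -
    have "?r (x + y) - (q (x + s *\<^sub>R w) - s * q w) \<le> q (y + t *\<^sub>R w) - t * q w"
      if "s \<ge> 0" "t \<ge> 0" for s t
    proof -
      have "?r (x + y) \<le> q ((x + y) + (s + t) *\<^sub>R w) - (s + t) * q w"
        using that by (intro sublinear_shift_le q) auto
      moreover have "(x + y) + (s + t) *\<^sub>R w = (x + s *\<^sub>R w) + (y + t *\<^sub>R w)"
        by (simp add: algebra_simps)
      moreover have "q ((x + s *\<^sub>R w) + (y + t *\<^sub>R w)) \<le> q (x + s *\<^sub>R w) + q (y + t *\<^sub>R w)"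
        using q unfolding sublinear_def by blast
      ultimately show ?thesis by (simp add: algebra_simps)
    qed
    then have "?r (x + y) - (q (x + s *\<^sub>R w) - s * q w) \<le> ?r y" if "s \<ge> 0" for s
      using that by (intro sublinear_shift_greatest)
    then have "?r (x + y) - ?r y \<le> q (x + s *\<^sub>R w) - s * q w" if "s \<ge> 0" for s
      using that by (smt (verit))
    then have "?r (x + y) - ?r y \<le> ?r x"
      by (rule sublinear_shift_greatest)
    then show ?thesis by simp
  qed
  have le: "?r (c *\<^sub>R x) \<le> c * ?r x" if "c > 0" for c x
  proof -
    have "?r (c *\<^sub>R x) / c \<le> q (x + t *\<^sub>R w) - t * q w" if "t \<ge> 0" for t
    proof -
      have "?r (c *\<^sub>R x) \<le> q (c *\<^sub>R x + (c * t) *\<^sub>R w) - (c * t) * q w"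
        using \<open>c > 0\<close> that by (intro sublinear_shift_le q) auto
      also have "c *\<^sub>R x + (c * t) *\<^sub>R w = c *\<^sub>R (x + t *\<^sub>R w)"
        by (simp add: algebra_simps)
      also have "q (c *\<^sub>R (x + t *\<^sub>R w)) = c * q (x + t *\<^sub>R w)"
        using q \<open>c > 0\<close> unfolding sublinear_def by (meson less_imp_le)
      finally have "?r (c *\<^sub>R x) \<le> c * (q (x + t *\<^sub>R w) - t * q w)" by (simp add: algebra_simps)
      then show ?thesis using \<open>c > 0\<close> by (simp add: field_simps)
    qed
    then have "?r (c *\<^sub>R x) / c \<le> ?r x" by (rule sublinear_shift_greatest)
    then show ?thesis using that by (simp add: field_simps)
  qed
  have zero: "?r 0 = 0"
  proof -
    have "q (0 + t *\<^sub>R w) - t * q w = 0" if "t \<ge> 0" for t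
      using q that unfolding sublinear_def by simp
    then show ?thesis unfolding sublinear_shift_def by simp
  qed
  have "?r (c *\<^sub>R x) = c * ?r x" if "c \<ge> 0" for c x
  proof (cases "c = 0")
    case True then show ?thesis using zero by simp
  next
    case False
    then have c: "c > 0" using that by simp
    have "?r ((1 / c) *\<^sub>R (c *\<^sub>R x)) \<le> (1 / c) * ?r (c *\<^sub>R x)"
      using c by (intro le) auto
    then have "c * ?r x \<le> ?r (c *\<^sub>R x)" using c by (simp add: field_simps)
    then show ?thesis using le[OF c, of x] by simp
  qed
  then show ?thesis using sub unfolding sublinear_def by blast
qed

lemma sublinear_shift_le_self: "sublinear q \<Longrightarrow> sublinear_shift q w x \<le> q x"
  using sublinear_shift_le[of q 0 w x] by simp

lemma sublinear_INF_chain: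
  assumes ne: "C \<noteq> {}"
    and C: "\<And>q. q \<in> C \<Longrightarrow> sublinear q \<and> q \<le> p"
    and chain: "\<And>q r. q \<in> C \<Longrightarrow> r \<in> C \<Longrightarrow> q \<le> r \<or> r \<le> q"
  shows "sublinear (\<lambda>x. INF q\<in>C. q x) \<and> (\<forall>q\<in>C. (\<lambda>x. INF q\<in>C. q x) \<le> q)"
proof -
  let ?u = "\<lambda>x. INF q\<in>C. q x"
  have bdd: "bdd_below ((\<lambda>q. q x) ` C)" for x
  proof (intro bdd_belowI[of _ "- p (- x)"])
    fix y assume "y \<in> (\<lambda>q. q x) ` C"
    then obtain q where q: "q \<in> C" "y = q x" by auto
    then have "- q (- x) \<le> q x" "q (- x) \<le> p (- x)"
      using C[of q] sublinear_ge_neg[of q x] by (auto simp: le_fun_def)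
    then show "- p (- x) \<le> y" using q by simp
  qed
  have low: "?u x \<le> q x" if "q \<in> C" for q x
    using that bdd by (intro cINF_lower) auto
  have great: "c \<le> ?u x" if "\<And>q. q \<in> C \<Longrightarrow> c \<le> q x" for c x
    using that ne by (intro cINF_greatest) auto
  have sub: "?u (x + y) \<le> ?u x + ?u y" for x y
  proof -
    have "?u (x + y) \<le> q x + r y" if "q \<in> C" "r \<in> C" for q r
    proof -
      have "\<exists>s\<in>C. s x \<le> q x \<and> s y \<le> r y"
        using chain[OF that] that unfolding le_fun_def by (metis order_refl)
      then obtain s where s: "s \<in> C" "s x \<le> q x" "s y \<le> r y" by blast
      have "?u (x + y) \<le> s (x + y)" using s by (intro low)
      also have "\<dots> \<le> s x + s y" using C[OF s(1)] unfolding sublinear_def by blast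
      finally show ?thesis using s by simp
    qed
    then have "?u (x + y) - q x \<le> ?u y" if "q \<in> C" for q
      using that by (intro great) (smt (verit))
    then have "?u (x + y) - ?u y \<le> ?u x" by (intro great) (smt (verit))
    then show ?thesis by simp
  qed
  have le: "?u (c *\<^sub>R x) \<le> c * ?u x" if "c > 0" for c x
  proof -
    have "?u (c *\<^sub>R x) / c \<le> q x" if "q \<in> C" for q
    proof -
      have "?u (c *\<^sub>R x) \<le> q (c *\<^sub>R x)" using that by (rule low)
      also have "\<dots> = c * q x" using C[OF that] \<open>c > 0\<close> unfolding sublinear_def by (meson less_imp_le)
      finally show ?thesis using \<open>c > 0\<close> by (simp add: field_simps)
    qed
    then have "?u (c *\<^sub>R x) / c \<le> ?u x" by (rule great)
    then show ?thesis using that by (simp add: field_simps)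
  qed
  have "?u (c *\<^sub>R x) = c * ?u x" if "c \<ge> 0" for c x
  proof (cases "c = 0")
    case True
    have "q 0 = 0" if "q \<in> C" for q using C[OF that] sublinear_zero by blast
    then have "(\<lambda>q. q 0) ` C = {0}" using ne by (auto simp: image_iff)
    then have "?u 0 = 0" by simp
    then show ?thesis using True by simp
  next
    case False
    then have c: "c > 0" using that by simp
    have "?u ((1 / c) *\<^sub>R (c *\<^sub>R x)) \<le> (1 / c) * ?u (c *\<^sub>R x)"
      using c by (intro le) auto
    then have "c * ?u x \<le> ?u (c *\<^sub>R x)" using c by (simp add: field_simps)
    then show ?thesis using le[OF c, of x] by simp
  qed
  then have "sublinear ?u" using sub unfolding sublinear_def by blast
  then show ?thesis using low by (auto simp: le_fun_def)
qed

text \<open>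
  A minimal sublinear function \<open>m\<close> is linear: \<open>sublinear_shift m y\<close> is sublinear and below \<open>m\<close>, so
  it equals \<open>m\<close>, and this says that \<open>m\<close> is superadditive. Minimal functions below \<open>p\<close> exist by
  Zorn's lemma, since chains have pointwise infima.
\<close>

lemma sublinear_dominates_linear:
  fixes p :: "'a::real_vector \<Rightarrow> real"
  assumes p: "sublinear p"
  shows "\<exists>f. linear f \<and> f \<le> p"
proof -
  let ?A = "{q. sublinear q \<and> q \<le> p}"
  have "\<exists>m\<in>?A. \<forall>a\<in>?A. a \<le> m \<longrightarrow> a = m"
  proof (rule predicate_Zorn)
    show "partial_order_on ?A (relation_of (\<lambda>q r. r \<le> q) ?A)"
      by (rule partial_order_on_relation_ofI) auto
  next
    fix C assume C: "C \<in> Chains (relation_of (\<lambda>q r. r \<le> q) ?A)"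
    show "\<exists>u\<in>?A. \<forall>a\<in>C. u \<le> a"
    proof (cases "C = {}")
      case True then show ?thesis using p by auto
    next
      case False
      have A: "sublinear q \<and> q \<le> p" if "q \<in> C" for q
        using C that unfolding Chains_def relation_of_def by blast
      have ch: "q \<le> r \<or> r \<le> q" if "q \<in> C" "r \<in> C" for q r
        using C that unfolding Chains_def relation_of_def by blast
      note u = sublinear_INF_chain[of C p, OF False A ch]
      moreover obtain q where "q \<in> C" using False by blast
      ultimately have "(\<lambda>x. INF q\<in>C. q x) \<le> p" using A order_trans by blast
      then show ?thesis using u by blast
    qed
  qed
  then obtain m where m: "sublinear m" "m \<le> p"
    and min: "\<And>a. sublinear a \<Longrightarrow> a \<le> p \<Longrightarrow> a \<le> m \<Longrightarrow> a = m" by blast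
  have add: "m (x + y) = m x + m y" for x y
  proof -
    have le: "sublinear_shift m y \<le> m" using sublinear_shift_le_self[OF m(1)] by (auto simp: le_fun_def)
    then have "sublinear_shift m y = m"
      using sublinear_shift[OF m(1)] m(2) by (intro min) auto
    then have "m x \<le> m (x + 1 *\<^sub>R y) - 1 * m y"
      using sublinear_shift_le[OF m(1), of 1 y x] by simp
    moreover have "m (x + y) \<le> m x + m y" using m(1) unfolding sublinear_def by blast
    ultimately show ?thesis by simp
  qed
  have neg: "m (- x) = - m x" for x
    using add[of x "- x"] sublinear_zero[OF m(1)] by simp
  have "m (c *\<^sub>R x) = c * m x" for c x
  proof (cases "c \<ge> 0")
    case True then show ?thesis using m(1) unfolding sublinear_def by blast
  next
    case False
    then have "m ((- c) *\<^sub>R x) = (- c) * m x" using m(1) unfolding sublinear_def by (meson le_cases neg_0_le_iff_le)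
    then show ?thesis using neg[of "(- c) *\<^sub>R x"] by simp
  qed
  then have "linear m" by (intro linearI) (auto simp: add)
  then show ?thesis using m(2) by blast
qed

lemma hahn_banach:
  fixes p :: "'a::real_vector \<Rightarrow> real"
  assumes p: "sublinear p"
  shows "\<exists>f. linear f \<and> f \<le> p \<and> f w = p w"
proof -
  obtain f where f: "linear f" "f \<le> sublinear_shift p w"
    using sublinear_dominates_linear[OF sublinear_shift[OF p]] by blast
  have fp: "f \<le> p" using le_funD[OF f(2)] sublinear_shift_le_self[OF p] by (intro le_funI) (rule order_trans)
  have "f (- w) \<le> p (- w + 1 *\<^sub>R w) - 1 * p w"
    using le_funD[OF f(2), of "- w"] sublinear_shift_le[OF p, of 1 w "- w"] by simp
  then have "p w \<le> f w" using f(1) sublinear_zero[OF p] by (simp add: linear_neg)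
  then show ?thesis using f(1) fp le_funD[OF fp, of w] by (intro exI[of _ f]) simp
qed

lemma blinfun_of_dominated:
  fixes f :: "'a::real_normed_vector \<Rightarrow> real"
  assumes f: "linear f" and le: "\<And>x. f x \<le> c * norm x" and c: "c \<ge> 0"
  shows "\<exists>g :: 'a \<Rightarrow>\<^sub>L real. norm g \<le> c \<and> (\<forall>x. blinfun_apply g x = f x)"
proof -
  have abs: "norm (f x) \<le> c * norm x" for x
    using le[of x] le[of "- x"] f by (auto simp: linear_neg abs_le_iff)
  then have bl: "bounded_linear f"
    using f by (intro bounded_linear_intro[of f c]) (auto simp: linear_add linear_scale mult.commute)
  show ?thesis
    using abs c by (intro exI[of _ "Blinfun f"])
      (auto simp: bounded_linear_Blinfun_apply[OF bl] intro: norm_blinfun_bound)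
qed

lemma norming_functional:
  fixes w :: "'a::real_normed_vector"
  shows "\<exists>f :: 'a \<Rightarrow>\<^sub>L real. norm f \<le> 1 \<and> blinfun_apply f w = norm w"
proof -
  have "sublinear (norm :: 'a \<Rightarrow> real)"
    unfolding sublinear_def by (auto intro: norm_triangle_ineq)
  then obtain f :: "'a \<Rightarrow> real" where "linear f" "f \<le> norm" "f w = norm w"
    using hahn_banach[of norm w] by blast
  moreover have "f x \<le> 1 * norm x" for x using \<open>f \<le> norm\<close> by (simp add: le_fun_def)
  ultimately obtain g :: "'a \<Rightarrow>\<^sub>L real" where "norm g \<le> 1" "\<And>x. blinfun_apply g x = f x"
    using blinfun_of_dominated[of f 1] by auto
  then show ?thesis using \<open>f w = norm w\<close> by auto
qed

text \<open>
  The distance from a closed subspace is sublinear and vanishes exactly on the subspace.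
\<close>

lemma functional_separating_closed_subspace:
  fixes V :: "'a::real_normed_vector set"
  assumes V: "subspace V" "closed V" and e: "e \<notin> V"
  shows "\<exists>f :: 'a \<Rightarrow>\<^sub>L real. blinfun_apply f e = 1 \<and> (\<forall>v\<in>V. blinfun_apply f v = 0)"
proof -
  let ?p = "\<lambda>x. infdist x V"
  have ne: "V \<noteq> {}" using V(1) subspace_0 by auto
  have approx: "\<exists>v\<in>V. dist x v < infdist x V + \<epsilon>" if "\<epsilon> > 0" for x \<epsilon>
    using that ne cInf_lessD[of "dist x ` V" "infdist x V + \<epsilon>"]
    by (auto simp: infdist_notempty)
  have sub: "?p (x + y) \<le> ?p x + ?p y" for x y
  proof (rule field_le_epsilon)
    fix \<epsilon> :: real assume "\<epsilon> > 0"
    then obtain u v where u: "u \<in> V" "dist x u < ?p x + \<epsilon> / 2" and v: "v \<in> V" "dist y v < ?p y + \<epsilon> / 2"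
      using approx[of "\<epsilon> / 2"] by (meson half_gt_zero)
    have "?p (x + y) \<le> dist (x + y) (u + v)" using u v V(1) by (intro infdist_le) (auto simp: subspace_add)
    also have "\<dots> \<le> dist x u + dist y v" by (rule dist_triangle_add)
    finally show "?p (x + y) \<le> ?p x + ?p y + \<epsilon>" using u v by simp
  qed
  have le: "?p (c *\<^sub>R x) \<le> c * ?p x" if "c > 0" for c x
  proof (rule field_le_epsilon)
    fix \<epsilon> :: real assume "\<epsilon> > 0"
    then have "\<epsilon> / c > 0" using that by simp
    then obtain u where u: "u \<in> V" "dist x u < ?p x + \<epsilon> / c"
      using approx[of "\<epsilon> / c" x] by blast
    have "?p (c *\<^sub>R x) \<le> dist (c *\<^sub>R x) (c *\<^sub>R u)" using u V(1) by (intro infdist_le) (auto simp: subspace_scale)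
    also have "\<dots> = c * dist x u" using that by (simp add: dist_norm flip: scaleR_right_diff_distrib)
    also have "\<dots> \<le> c * (?p x + \<epsilon> / c)" using u that by (intro mult_left_mono) auto
    finally show "?p (c *\<^sub>R x) \<le> c * ?p x + \<epsilon>" using that by (simp add: distrib_left)
  qed
  have zero: "?p 0 = 0" using V(1) by (simp add: subspace_0)
  have "?p (c *\<^sub>R x) = c * ?p x" if "c \<ge> 0" for c x
  proof (cases "c = 0")
    case True then show ?thesis using zero by simp
  next
    case False
    then have c: "c > 0" using that by simp
    have "?p ((1 / c) *\<^sub>R (c *\<^sub>R x)) \<le> (1 / c) * ?p (c *\<^sub>R x)"
      using c by (intro le) auto
    then have "c * ?p x \<le> ?p (c *\<^sub>R x)" using c by (simp add: field_simps)
    then show ?thesis using le[OF c, of x] by simp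
  qed
  then have "sublinear ?p" using sub unfolding sublinear_def by blast
  then obtain f where f: "linear f" "f \<le> ?p" "f e = ?p e" using hahn_banach[of ?p e] by blast
  have "f x \<le> 1 * norm x" for x
  proof -
    have "f x \<le> ?p x" using f(2) by (simp add: le_fun_def)
    also have "\<dots> \<le> dist x 0" using V(1) by (intro infdist_le subspace_0)
    finally show ?thesis by simp
  qed
  then obtain g :: "'a \<Rightarrow>\<^sub>L real" where g: "\<And>x. blinfun_apply g x = f x"
    using blinfun_of_dominated[OF f(1), of 1] by auto
  have d: "?p e > 0" using V(2) ne e by (rule infdist_pos_not_in_closed)
  have "f v = 0" if "v \<in> V" for v
  proof -
    have "f v \<le> 0" "f (- v) \<le> 0"
      using f(2) that V(1) subspace_neg[of V v] by (force simp: le_fun_def dest: spec[of _ v], force simp: le_fun_def dest: spec[of _ "- v"])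
    then show ?thesis using f(1) by (simp add: linear_neg)
  qed
  then have "blinfun_apply ((1 / ?p e) *\<^sub>R g) e = 1 \<and> (\<forall>v\<in>V. blinfun_apply ((1 / ?p e) *\<^sub>R g) v = 0)"
    using d by (simp add: blinfun.scaleR_left g f(3))
  then show ?thesis by blast
qed

section \<open>Ultrafilters\<close>

definition ultrafilter :: "'i filter \<Rightarrow> bool" where
  "ultrafilter U \<longleftrightarrow> U \<noteq> bot \<and> (\<forall>P. eventually P U \<or> eventually (\<lambda>x. \<not> P x) U)"

lemma ultrafilter_not_bot: "ultrafilter U \<Longrightarrow> U \<noteq> bot"
  by (simp add: ultrafilter_def)

text \<open>
  A filter that is minimal among the proper ones is an ultrafilter, because its restriction to a set
  that it meets cannot be strictly finer.
\<close>

lemma ex_ultrafilter_le: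
  fixes F :: "'i filter"
  assumes F: "F \<noteq> bot"
  shows "\<exists>U. ultrafilter U \<and> U \<le> F"
proof -
  let ?A = "{G. G \<noteq> bot \<and> G \<le> F}"
  have "\<exists>m\<in>?A. \<forall>a\<in>?A. a \<le> m \<longrightarrow> a = m"
  proof (rule predicate_Zorn)
    show "partial_order_on ?A (relation_of (\<lambda>q r. r \<le> q) ?A)"
      by (rule partial_order_on_relation_ofI) auto
  next
    fix C assume C: "C \<in> Chains (relation_of (\<lambda>q r. r \<le> q) ?A)"
    show "\<exists>u\<in>?A. \<forall>a\<in>C. u \<le> a"
    proof (cases "C = {}")
      case True then show ?thesis using F by auto
    next
      case False
      have A: "G \<noteq> bot \<and> G \<le> F" if "G \<in> C" for G
        using C that unfolding Chains_def relation_of_def by blast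
      have ch: "G \<le> H \<or> H \<le> G" if "G \<in> C" "H \<in> C" for G H
        using C that unfolding Chains_def relation_of_def by blast
      have "eventually P (Inf C) \<longleftrightarrow> (\<exists>b\<in>C. eventually P b)" for P
        using False ch by (intro eventually_Inf_base) (auto simp: le_inf_iff)
      then have "Inf C \<noteq> bot" using A unfolding trivial_limit_def by blast
      moreover have "Inf C \<le> F" using False A by (meson Inf_lower2 ex_in_conv)
      ultimately show ?thesis by (intro bexI[of _ "Inf C"]) (auto intro: Inf_lower)
    qed
  qed
  then obtain U where U: "U \<noteq> bot" "U \<le> F"
    and min: "\<And>G. G \<noteq> bot \<Longrightarrow> G \<le> F \<Longrightarrow> G \<le> U \<Longrightarrow> G = U" by blast
  have "eventually P U \<or> eventually (\<lambda>x. \<not> P x) U" for P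
  proof (cases "inf U (principal {x. \<not> P x}) = bot")
    case True
    then show ?thesis by (simp add: trivial_limit_def eventually_inf_principal)
  next
    case False
    then have "inf U (principal {x. \<not> P x}) = U"
      using U by (intro min) (auto intro: order_trans[OF inf_le1])
    moreover have "eventually (\<lambda>x. \<not> P x) (inf U (principal {x. \<not> P x}))"
      by (simp add: eventually_inf_principal)
    ultimately show ?thesis by simp
  qed
  then show ?thesis using U by (auto simp: ultrafilter_def)
qed

lemma ultrafilter_tendsto_real:
  fixes g :: "'i \<Rightarrow> real"
  assumes U: "ultrafilter U" and B: "\<And>i. \<bar>g i\<bar> \<le> B"
  shows "\<exists>l. (g \<longlongrightarrow> l) U"
proof -
  have "filtermap g U \<noteq> bot" using U by (simp add: ultrafilter_def filtermap_bot_iff)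
  moreover have "eventually (\<lambda>x. x \<in> {-B..B}) (filtermap g U)"
    using B by (auto simp: eventually_filtermap abs_le_iff minus_le_iff intro!: always_eventually)
  ultimately obtain l where l: "inf (nhds l) (filtermap g U) \<noteq> bot"
    using compact_Icc[of "-B" B] unfolding compact_filter by blast
  have "(g \<longlongrightarrow> l) U"
    unfolding tendsto_def
  proof (intro allI impI)
    fix S assume S: "open S" "l \<in> S"
    show "eventually (\<lambda>x. g x \<in> S) U"
    proof (rule ccontr)
      assume "\<not> ?thesis"
      then have "eventually (\<lambda>y. y \<notin> S) (filtermap g U)"
        using U unfolding ultrafilter_def eventually_filtermap by blast
      moreover have "eventually (\<lambda>y. y \<in> S) (nhds l)" using S by (auto simp: eventually_nhds)
      ultimately have "eventually (\<lambda>_. False) (inf (nhds l) (filtermap g U))"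
        unfolding eventually_inf by blast
      then show False using l by (simp add: trivial_limit_def)
    qed
  qed
  then show ?thesis by blast
qed

lemma ultrafilter_limit_functional:
  fixes F :: "'i \<Rightarrow> 'a::real_normed_vector \<Rightarrow> real"
  assumes U: "ultrafilter U" and c: "c \<ge> 0"
    and lin: "\<And>i. linear (F i)" and B: "\<And>i x. \<bar>F i x\<bar> \<le> c * norm x"
  shows "\<exists>g :: 'a \<Rightarrow>\<^sub>L real. norm g \<le> c \<and> (\<forall>x. ((\<lambda>i. F i x) \<longlongrightarrow> blinfun_apply g x) U)"
proof -
  have nb: "U \<noteq> bot" using U by (simp add: ultrafilter_def)
  have "\<forall>x. \<exists>l. ((\<lambda>i. F i x) \<longlongrightarrow> l) U"
    using ultrafilter_tendsto_real[OF U B] by (rule allI)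
  then obtain l where l: "\<And>x. ((\<lambda>i. F i x) \<longlongrightarrow> l x) U"
    unfolding choice_iff by blast
  have "linear l"
  proof (rule linearI)
    show "l (x + y) = l x + l y" for x y
      using tendsto_add[OF l[of x] l[of y]] l[of "x + y"] lin
      by (intro tendsto_unique[OF nb]) (auto simp: linear_add)
    show "l (r *\<^sub>R x) = r *\<^sub>R l x" for r x
      using tendsto_mult_left[OF l[of x], of r] l[of "r *\<^sub>R x"] lin
      by (intro tendsto_unique[OF nb]) (auto simp: linear_scale)
  qed
  moreover have "l x \<le> c * norm x" for x
    using B[of _ x] by (intro tendsto_upperbound[OF l _ nb]) (auto simp: abs_le_iff)
  ultimately obtain g :: "'a \<Rightarrow>\<^sub>L real" where "norm g \<le> c" "\<And>x. blinfun_apply g x = l x"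
    using blinfun_of_dominated[of l c] c by blast
  then show ?thesis using l by auto
qed

text \<open>
  The ultrafilter limits of the values of functionals form an element of the bidual. Thus weak limits
  of bounded families exist without any appeal to weak compactness or separability.
\<close>

lemma reflexive_weak_limit:
  fixes y :: "'i \<Rightarrow> 'a::real_normed_vector"
  assumes refl: "reflexive_space TYPE('a)" and U: "ultrafilter U" and B: "\<And>i. norm (y i) \<le> B"
  shows "\<exists>z. \<forall>f :: 'a \<Rightarrow>\<^sub>L real. ((\<lambda>i. blinfun_apply f (y i)) \<longlongrightarrow> blinfun_apply f z) U"
proof -
  have B0: "B \<ge> 0" using B[of undefined] norm_ge_zero order_trans by blast
  have "\<bar>blinfun_apply f (y i)\<bar> \<le> B * norm f" for i and f :: "'a \<Rightarrow>\<^sub>L real"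
    using norm_blinfun[of f "y i"] mult_left_mono[OF B[of i] norm_ge_zero[of f]]
    by (simp add: mult.commute)
  moreover have "linear (\<lambda>f :: 'a \<Rightarrow>\<^sub>L real. blinfun_apply f (y i))" for i
    by (intro linearI) (auto simp: blinfun.add_left blinfun.scaleR_left)
  ultimately obtain \<phi> :: "('a \<Rightarrow>\<^sub>L real) \<Rightarrow>\<^sub>L real"
    where "\<And>f. ((\<lambda>i. blinfun_apply f (y i)) \<longlongrightarrow> blinfun_apply \<phi> f) U"
    using ultrafilter_limit_functional[OF U B0, of "\<lambda>i f. blinfun_apply f (y i)"] by blast
  moreover obtain z where "\<And>f. blinfun_apply \<phi> f = blinfun_apply f z"
    using refl unfolding reflexive_space_def by blast
  ultimately show ?thesis by auto
qed

lemma norm_blinfun_le_1: "norm (f :: 'a::real_normed_vector \<Rightarrow>\<^sub>L real) \<le> 1 \<Longrightarrow> \<bar>blinfun_apply f x\<bar> \<le> norm x"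
  using norm_blinfun[of f x] mult_right_mono[of "norm f" 1 "norm x"] by simp

text \<open>
  Weak lower semicontinuity of the norm.
\<close>

lemma weak_limit_norm_le:
  fixes y :: "'i \<Rightarrow> 'a::real_normed_vector"
  assumes nb: "U \<noteq> bot"
    and lim: "\<And>f :: 'a \<Rightarrow>\<^sub>L real. ((\<lambda>i. blinfun_apply f (y i)) \<longlongrightarrow> blinfun_apply f z) U"
    and le: "eventually (\<lambda>i. norm (y i) \<le> L) U"
  shows "norm z \<le> L"
proof -
  obtain f :: "'a \<Rightarrow>\<^sub>L real" where f: "norm f \<le> 1" "blinfun_apply f z = norm z"
    using norming_functional by blast
  have "eventually (\<lambda>i. blinfun_apply f (y i) \<le> L) U"
    using le by eventually_elim (use norm_blinfun_le_1[OF f(1)] in \<open>smt (verit)\<close>)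
  then show ?thesis using tendsto_upperbound[OF lim _ nb, of f L] f(2) by simp
qed

section \<open>Finite-codimensional subspaces\<close>

lemma UNIV_in_cof: "UNIV \<in> cof"
  unfolding cof_def by (auto intro!: exI[of _ "{}"])

lemma cofD: "V \<in> cof \<Longrightarrow> subspace V" "V \<in> cof \<Longrightarrow> closed V"
  by (auto simp: cof_def)

lemma subspace_kernel: "subspace {x. blinfun_apply (f :: 'a::real_normed_vector \<Rightarrow>\<^sub>L real) x = 0}"
  by (auto simp: subspace_def blinfun.add_right blinfun.scaleR_right blinfun.zero_right)

lemma closed_kernel: "closed {x. blinfun_apply (f :: 'a::real_normed_vector \<Rightarrow>\<^sub>L real) x = 0}"
  by (intro closed_Collect_eq continuous_intros)

text \<open>
  Passing to a kernel costs one dimension, spanned by any vector of \<open>V\<close> outside the kernel.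
\<close>

lemma Int_kernel_in_cof:
  fixes f :: "'a::real_normed_vector \<Rightarrow>\<^sub>L real"
  assumes V: "V \<in> cof"
  shows "V \<inter> {x. blinfun_apply f x = 0} \<in> cof"
proof (cases "V \<subseteq> {x. blinfun_apply f x = 0}")
  case True
  then show ?thesis using V by (simp add: Int_absorb2)
next
  case False
  let ?K = "{x. blinfun_apply f x = 0}"
  obtain F where F: "finite F" "span (V \<union> F) = UNIV" using V by (auto simp: cof_def)
  obtain e where e: "e \<in> V" "blinfun_apply f e \<noteq> 0" using False by auto
  have "v \<in> span ((V \<inter> ?K) \<union> insert e F)" if "v \<in> V" for v
  proof -
    let ?c = "blinfun_apply f v / blinfun_apply f e"
    have "v - ?c *\<^sub>R e \<in> V \<inter> ?K" using e that cofD(1)[OF V]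
      by (auto simp: subspace_diff subspace_scale blinfun.diff_right blinfun.scaleR_right)
    then have "(v - ?c *\<^sub>R e) + ?c *\<^sub>R e \<in> span ((V \<inter> ?K) \<union> insert e F)"
      by (intro span_add span_scale span_base) auto
    then show ?thesis by simp
  qed
  moreover have "F \<subseteq> span ((V \<inter> ?K) \<union> insert e F)" by (auto intro: span_base)
  ultimately have "span (V \<union> F) \<subseteq> span ((V \<inter> ?K) \<union> insert e F)"
    by (intro span_minimal) auto
  then have "span ((V \<inter> ?K) \<union> insert e F) = UNIV" using F by auto
  then show ?thesis using V F(1) subspace_kernel closed_kernel
    unfolding cof_def by (auto intro!: subspace_inter closed_Int exI[of _ "insert e F"])
qed

text \<open>
  Every closed finite-codimensional subspace is a finite intersection of kernels, obtained by
  removing one spanning vector of a complement at a time. The functional \<open>f\<close> is normalized by \<open>f e = 1\<close> so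
  that \<open>x - f x e\<close> projects onto the smaller space.
\<close>

lemma cof_induct [consumes 1, case_names UNIV kernel]:
  fixes V :: "'a::real_normed_vector set"
  assumes V: "V \<in> cof" and UNIV: "P UNIV"
    and step: "\<And>V e f. V \<in> cof \<Longrightarrow> P V \<Longrightarrow> e \<in> V \<Longrightarrow> blinfun_apply (f :: 'a \<Rightarrow>\<^sub>L real) e = 1 \<Longrightarrow>
        P (V \<inter> {x. blinfun_apply f x = 0})"
  shows "P V"
proof -
  obtain F where "finite F" "span (V \<union> F) = UNIV" using V by (auto simp: cof_def)
  then show ?thesis using cofD[OF V]
  proof (induction F arbitrary: V rule: finite_induct)
    case empty
    then show ?case using UNIV by (simp add: span_eq_iff[THEN iffD2])
  next
    case (insert e F)
    show ?case
    proof (cases "e \<in> V")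
      case True
      then have "V \<union> insert e F = V \<union> F" by auto
      then show ?thesis using insert by simp
    next
      case False
      then obtain f :: "'a \<Rightarrow>\<^sub>L real" where f: "blinfun_apply f e = 1" "\<And>v. v \<in> V \<Longrightarrow> blinfun_apply f v = 0"
        using functional_separating_closed_subspace insert.prems by blast
      let ?g = "\<lambda>x. x - blinfun_apply f x *\<^sub>R e"
      let ?V = "?g -` V"
      have sub: "subspace ?V"
      proof (rule subspaceI)
        show "0 \<in> ?V" using insert.prems by (simp add: subspace_0 blinfun.zero_right)
        show "x + y \<in> ?V" if "x \<in> ?V" "y \<in> ?V" for x y
        proof -
          have "?g (x + y) = ?g x + ?g y" by (simp add: blinfun.add_right algebra_simps)
          moreover have "?g x + ?g y \<in> V" using that insert.prems by (intro subspace_add) auto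
          ultimately show ?thesis by (simp only: vimage_eq)
        qed
        show "c *\<^sub>R x \<in> ?V" if "x \<in> ?V" for c x
        proof -
          have "?g (c *\<^sub>R x) = c *\<^sub>R ?g x" by (simp add: blinfun.scaleR_right algebra_simps)
          moreover have "c *\<^sub>R ?g x \<in> V" using that insert.prems by (intro subspace_scale) auto
          ultimately show ?thesis by (simp only: vimage_eq)
        qed
      qed
      have cl: "closed ?V"
        by (intro closed_vimage insert.prems continuous_intros)
      have e: "e \<in> ?V" using f insert.prems by (simp add: subspace_0)
      have "V \<union> insert e F \<subseteq> span (?V \<union> F)"
        using e f by (auto intro!: span_base)
      then have "span (V \<union> insert e F) \<subseteq> span (?V \<union> F)"
        by (rule span_minimal) (rule subspace_span)
      then have "span (?V \<union> F) = UNIV" using insert.prems(1) by auto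
      then have "P ?V" and "?V \<in> cof" using insert.IH sub cl insert.hyps(1) by (auto simp: cof_def)
      then have "P (?V \<inter> {x. blinfun_apply f x = 0})" using e f(1) by (intro step)
      moreover have "?V \<inter> {x. blinfun_apply f x = 0} = V" using f by auto
      ultimately show ?thesis by simp
    qed
  qed
qed

lemma Int_in_cof: "W \<in> cof \<Longrightarrow> V \<in> cof \<Longrightarrow> V \<inter> W \<in> cof"
proof (induction W rule: cof_induct)
  case UNIV
  then show ?case by simp
next
  case (kernel W e f)
  then show ?case using Int_kernel_in_cof[of "V \<inter> W" f] by (simp add: Int_assoc)
qed

lemma kernel_in_cof: "{x. blinfun_apply (f :: 'a::real_normed_vector \<Rightarrow>\<^sub>L real) x = 0} \<in> cof"
  using Int_kernel_in_cof[OF UNIV_in_cof] by simp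

text \<open>
  A subspace of finite codimension is cut out by finitely many functionals, and these tend to \<open>0\<close>
  along a weakly null net. The correction for each of them is one application of the projection
  \<open>x - f x e\<close>.
\<close>

lemma weakly_null_near_cof:
  fixes d :: "'i \<Rightarrow> 'a::real_normed_vector"
  assumes V: "V \<in> cof"
    and d: "\<And>f :: 'a \<Rightarrow>\<^sub>L real. ((\<lambda>i. blinfun_apply f (d i)) \<longlongrightarrow> 0) U"
  shows "\<exists>v. (\<forall>i. v i \<in> V) \<and> ((\<lambda>i. d i - v i) \<longlongrightarrow> 0) U"
  using V
proof (induction V rule: cof_induct)
  case UNIV
  then show ?case by (intro exI[of _ d]) simp
next
  case (kernel V e f)
  then obtain v where v: "\<And>i. v i \<in> V" "((\<lambda>i. d i - v i) \<longlongrightarrow> 0) U" by blast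
  let ?w = "\<lambda>i. v i - blinfun_apply f (v i) *\<^sub>R e"
  have "((\<lambda>i. blinfun_apply f (d i) - blinfun_apply f (d i - v i)) \<longlongrightarrow> 0 - blinfun_apply f 0) U"
    using v(2) d by (intro tendsto_intros)
  then have "((\<lambda>i. blinfun_apply f (v i)) \<longlongrightarrow> 0) U"
    by (simp add: blinfun.diff_right blinfun.zero_right)
  then have "((\<lambda>i. (d i - v i) + blinfun_apply f (v i) *\<^sub>R e) \<longlongrightarrow> 0 + 0 *\<^sub>R e) U"
    using v(2) by (intro tendsto_intros)
  then have "((\<lambda>i. d i - ?w i) \<longlongrightarrow> 0) U" by (simp add: algebra_simps)
  moreover have "?w i \<in> V \<inter> {x. blinfun_apply f x = 0}" for i
    using v(1) kernel cofD(1)[OF kernel.hyps(1)]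
    by (auto simp: subspace_diff subspace_scale blinfun.diff_right blinfun.scaleR_right)
  ultimately show ?case by (intro exI[of _ ?w]) blast
qed

section \<open>Iterated filters\<close>

text \<open>
  The filter of the iterated limits: a property holds eventually if, for almost all \<open>i\<^sub>1\<close>, for almost
  all \<open>i\<^sub>2\<close>, and so on, it holds for \<open>[i\<^sub>1, \<dots>, i\<^sub>n]\<close>. For a subspace game this means that the player
  who chooses the subspaces can enforce the property.
\<close>

primrec iterated_filter :: "'i filter \<Rightarrow> nat \<Rightarrow> 'i list filter" where
  "iterated_filter U 0 = principal {[]}"
| "iterated_filter U (Suc n) =
     Abs_filter (\<lambda>P. \<forall>\<^sub>F i in U. \<forall>\<^sub>F is in iterated_filter U n. P (i # is))"

declare iterated_filter.simps [simp del]

lemma eventually_iterated_filter_0 [simp]: "eventually P (iterated_filter U 0) \<longleftrightarrow> P []"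
  by (simp add: eventually_principal iterated_filter.simps)

lemma eventually_iterated_filter_Suc:
  "eventually P (iterated_filter U (Suc n)) \<longleftrightarrow> (\<forall>\<^sub>F i in U. \<forall>\<^sub>F is in iterated_filter U n. P (i # is))"
  unfolding iterated_filter.simps(2)
proof (rule eventually_Abs_filter, unfold_locales)
  fix P Q :: "'a list \<Rightarrow> bool"
  assume "\<forall>\<^sub>F i in U. \<forall>\<^sub>F is in iterated_filter U n. P (i # is)"
    and "\<forall>\<^sub>F i in U. \<forall>\<^sub>F is in iterated_filter U n. Q (i # is)"
  then show "\<forall>\<^sub>F i in U. \<forall>\<^sub>F is in iterated_filter U n. P (i # is) \<and> Q (i # is)"
    by eventually_elim (rule eventually_conj)
next
  fix P Q :: "'a list \<Rightarrow> bool"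
  assume "\<forall>x. P x \<longrightarrow> Q x" and "\<forall>\<^sub>F i in U. \<forall>\<^sub>F is in iterated_filter U n. P (i # is)"
  then show "\<forall>\<^sub>F i in U. \<forall>\<^sub>F is in iterated_filter U n. Q (i # is)"
    by (auto elim!: eventually_mono)
qed simp

lemma iterated_filter_not_bot: "U \<noteq> bot \<Longrightarrow> iterated_filter U n \<noteq> bot"
  by (induction n) (auto simp: trivial_limit_def eventually_iterated_filter_Suc)

lemma eventually_iterated_filter_length: "\<forall>\<^sub>F is in iterated_filter U n. length is = n"
  by (induction n) (auto simp: eventually_iterated_filter_Suc)

text \<open>
  A choice that is typical at every step, given the earlier choices, is typical altogether. This turns
  a strategy into an eventual property.
\<close>

lemma eventually_iterated_filterI:
  assumes "\<And>is. length is < n \<Longrightarrow> \<forall>\<^sub>F i in U. R is i"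
  shows "\<forall>\<^sub>F is in iterated_filter U n. \<forall>l<n. R (take l is) (is ! l)"
  using assms
proof (induction n arbitrary: R)
  case 0
  then show ?case by simp
next
  case (Suc n)
  have *: "\<forall>\<^sub>F is in iterated_filter U n. \<forall>l<n. R (i # take l is) (is ! l)" for i
    using Suc.prems by (intro Suc.IH) simp
  have "\<forall>\<^sub>F i in U. R [] i" using Suc.prems by simp
  then show ?case unfolding eventually_iterated_filter_Suc
  proof eventually_elim
    case (elim i)
    show ?case using *[of i]
    proof eventually_elim
      case (elim "is")
      then show ?case using \<open>R [] i\<close> by (auto simp: less_Suc_eq_0_disj)
    qed
  qed
qed

section \<open>The asymptotic game as an iterated filter\<close>

text \<open>
  Unit vectors that lie in smaller and smaller subspaces of finite codimension. The filter is trivial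
  exactly in finite-dimensional spaces.
\<close>

definition deep_sphere :: "'a::real_normed_vector filter" where
  "deep_sphere = (INF V\<in>cof. principal (V \<inter> sphere 0 1))"

definition deep_ball :: "'a::real_normed_vector filter" where
  "deep_ball = (INF V\<in>cof. principal (V \<inter> cball 0 1))"

lemma eventually_deep:
  "eventually P (INF V\<in>cof. principal (V \<inter> S)) \<longleftrightarrow> (\<exists>V\<in>cof. \<forall>x\<in>V. x \<in> S \<longrightarrow> P x)"
proof (subst eventually_INF_base)
  show "cof \<noteq> {}" using UNIV_in_cof by blast
next
  fix V W :: "'a set" assume "V \<in> cof" "W \<in> cof"
  then show "\<exists>x\<in>cof. principal (x \<inter> S) \<le> inf (principal (V \<inter> S)) (principal (W \<inter> S))"
    by (intro bexI[of _ "V \<inter> W"] Int_in_cof) auto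
qed (auto simp: eventually_principal)

lemma eventually_deep_sphere:
  "eventually P deep_sphere \<longleftrightarrow> (\<exists>V\<in>cof. \<forall>x\<in>V. norm x = 1 \<longrightarrow> P x)"
  unfolding deep_sphere_def eventually_deep by simp

lemma eventually_deep_ball:
  "eventually P deep_ball \<longleftrightarrow> (\<exists>V\<in>cof. \<forall>x\<in>V. norm x \<le> 1 \<longrightarrow> P x)"
  unfolding deep_ball_def eventually_deep by simp

lemma frequently_deep_sphere:
  "frequently P deep_sphere \<longleftrightarrow> (\<forall>V\<in>cof. \<exists>x\<in>V. norm x = 1 \<and> P x)"
  unfolding frequently_def eventually_deep_sphere by auto

text \<open>
  Since the negation of a game formula is the dual game, the asymptotic game is the \<open>frequently\<close>
  that belongs to the iterated filter.
\<close>

lemma cof_game_iff_frequently: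
  "cof_game n P xs \<longleftrightarrow> frequently (\<lambda>ys. P (xs @ ys)) (iterated_filter deep_sphere n)"
proof (induction n arbitrary: xs)
  case 0
  then show ?case by (simp add: frequently_def)
next
  case (Suc n)
  have "frequently (\<lambda>ys. P (xs @ ys)) (iterated_filter deep_sphere (Suc n)) \<longleftrightarrow>
      frequently (\<lambda>x. cof_game n P (xs @ [x])) deep_sphere"
    by (simp add: Suc.IH frequently_def eventually_iterated_filter_Suc)
  then show ?case by (simp add: frequently_deep_sphere)
qed

text \<open>
  A vector of the ball is a multiple of a unit vector in the same subspace, so a statement about unit
  vectors that is uniform in the coefficients covers the ball. In finite dimension the subspace
  player can choose \<open>{0}\<close>, where there is no unit vector; this is why \<open>P\<close> has to hold for zero vectors.
\<close>

lemma eventually_deep_ball_of_sphere: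
  fixes P :: "'a::real_normed_vector list \<Rightarrow> bool"
  assumes "\<forall>\<^sub>F us in iterated_filter deep_sphere n.
      \<forall>cs. length cs = n \<and> (\<forall>c\<in>set cs. \<bar>c\<bar> \<le> 1) \<longrightarrow> P (map2 (*\<^sub>R) cs us)"
    and "P (replicate n 0)"
  shows "eventually P (iterated_filter deep_ball n)"
proof (cases "eventually (\<lambda>_. False) (deep_sphere :: 'a filter)")
  case True
  then obtain V :: "'a set" where V: "V \<in> cof" "\<forall>x\<in>V. norm x \<noteq> 1"
    by (auto simp: eventually_deep_sphere)
  have "x = 0" if "x \<in> V" for x
  proof (rule ccontr)
    assume "x \<noteq> 0"
    then have "norm ((1 / norm x) *\<^sub>R x) = 1" by simp
    moreover have "(1 / norm x) *\<^sub>R x \<in> V" using that cofD(1)[OF V(1)] by (intro subspace_scale)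
    ultimately show False using V(2) by blast
  qed
  then have "\<forall>\<^sub>F x in deep_ball. x = (0 :: 'a)" using V(1) by (auto simp: eventually_deep_ball)
  then have "\<forall>\<^sub>F xs in iterated_filter deep_ball n. xs = replicate n (0 :: 'a)"
    by (induction n) (auto simp: eventually_iterated_filter_Suc elim: eventually_mono)
  then show ?thesis by eventually_elim (simp add: assms(2))
next
  case False
  then have ex: "\<exists>u\<in>V. norm u = (1 :: real)" if "V \<in> cof" for V :: "'a set"
    using that by (auto simp: eventually_deep_sphere)
  show ?thesis using assms(1)
  proof (induction n arbitrary: P)
    case 0
    then show ?case by simp
  next
    case (Suc n)
    obtain V :: "'a set" where V: "V \<in> cof" and *: "\<And>u. u \<in> V \<Longrightarrow> norm u = 1 \<Longrightarrow>
      \<forall>\<^sub>F us in iterated_filter deep_sphere n.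
        \<forall>cs. length cs = Suc n \<and> (\<forall>c\<in>set cs. \<bar>c\<bar> \<le> 1) \<longrightarrow> P (map2 (*\<^sub>R) cs (u # us))"
      using Suc.prems unfolding eventually_iterated_filter_Suc eventually_deep_sphere by blast
    have "\<forall>\<^sub>F xs in iterated_filter deep_ball n. P (x # xs)" if x: "x \<in> V" "norm x \<le> 1" for x
    proof -
      obtain u where u: "u \<in> V" "norm u = 1" "x = norm x *\<^sub>R u"
      proof (cases "x = 0")
        case True
        then show ?thesis using ex[OF V] that by auto
      next
        case False
        then show ?thesis using x cofD(1)[OF V]
          by (intro that[of "(1 / norm x) *\<^sub>R x"]) (auto simp: subspace_scale)
      qed
      show ?thesis
      proof (rule Suc.IH, rule eventually_mono[OF *[OF u(1,2)]], intro allI impI)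
        fix us :: "'a list" and cs :: "real list"
        assume "\<forall>cs. length cs = Suc n \<and> (\<forall>c\<in>set cs. \<bar>c\<bar> \<le> 1) \<longrightarrow> P (map2 (*\<^sub>R) cs (u # us))"
          and "length cs = n \<and> (\<forall>c\<in>set cs. \<bar>c\<bar> \<le> 1)"
        then have "P (map2 (*\<^sub>R) (norm x # cs) (u # us))" using x(2) by (auto dest!: spec[of _ "norm x # cs"])
        then show "P (x # map2 (*\<^sub>R) cs us)" using u(3) by simp
      qed
    qed
    then show ?case unfolding eventually_iterated_filter_Suc eventually_deep_ball using V by blast
  qed
qed

section \<open>Limit norms\<close>

lemma lookup_scaleR [simp]:
  "Poly_Mapping.lookup (c *\<^sub>R (v :: 'b \<Rightarrow>\<^sub>0 real)) i = c * Poly_Mapping.lookup v i"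
proof -
  have "finite {j. c *\<^sub>R Poly_Mapping.lookup v j \<noteq> 0}"
    by (rule finite_subset[OF _ finite_keys[of v]]) (auto simp: in_keys_iff)
  then show ?thesis by (simp add: scaleR_poly_mapping_def lookup_Abs_poly_mapping)
qed

lemma lookup_sum_unit_vec:
  "Poly_Mapping.lookup (\<Sum>i<k. a i *\<^sub>R unit_vec i) j = (if j < k then a j else 0)"
  by (simp add: lookup_sum unit_vec_def lookup_single when_def if_distrib[of "(*) _"] cong: if_cong)

lemma sum_unit_vec_eq:
  assumes "v \<in> Rn k"
  shows "(\<Sum>i<k. Poly_Mapping.lookup v i *\<^sub>R unit_vec i) = v"
  using assms by (intro poly_mapping_eqI) (auto simp: lookup_sum_unit_vec Rn_def in_keys_iff)

lemma lin_indep_seqI: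
  assumes "\<And>a :: nat \<Rightarrow> real. (\<Sum>i<k. a i *\<^sub>R x i) = 0 \<Longrightarrow> \<forall>i<k. a i = 0"
  shows "lin_indep_seq k x"
proof -
  have inj: "inj_on x {..<k}"
  proof (rule inj_onI, rule ccontr)
    fix i j assume ij: "i \<in> {..<k}" "j \<in> {..<k}" "x i = x j" "i \<noteq> j"
    let ?a = "\<lambda>l. (if l = i then 1 else 0) - (if l = j then 1 else 0) :: real"
    have "(\<Sum>l<k. ?a l *\<^sub>R x l) =
        (\<Sum>l<k. if l = i then x l else 0) - (\<Sum>l<k. if l = j then x l else 0)"
      unfolding sum_subtractf[symmetric] by (intro sum.cong) auto
    also have "\<dots> = 0" using ij by simp
    finally have "?a i = 0" using assms[of ?a] ij by blast
    then show False using ij by simp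
  qed
  have "\<not> dependent (x ` {..<k})"
  proof
    assume "dependent (x ` {..<k})"
    then obtain u where u: "\<exists>v\<in>x ` {..<k}. u v \<noteq> 0" "(\<Sum>v\<in>x ` {..<k}. u v *\<^sub>R v) = 0"
      by (auto simp: dependent_finite)
    then have "(\<Sum>i<k. u (x i) *\<^sub>R x i) = 0" by (simp add: sum.reindex[OF inj])
    then show False using u(1) assms[of "\<lambda>i. u (x i)"] by blast
  qed
  then show ?thesis using inj by (simp add: lin_indep_seq_def)
qed

lemma lin_indep_unit_vec: "lin_indep_seq k unit_vec"
proof (rule lin_indep_seqI, intro allI impI)
  fix a :: "nat \<Rightarrow> real" and i assume "(\<Sum>i<k. a i *\<^sub>R unit_vec i) = 0" "i < k"
  then show "a i = 0" using lookup_sum_unit_vec[of a k i] by simp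
qed

definition comb_norm :: "nat \<Rightarrow> 'a::real_normed_vector list \<Rightarrow> (nat \<Rightarrow> real) \<Rightarrow> real" where
  "comb_norm m xs a = norm (\<Sum>i<m. a i *\<^sub>R xs ! i)"

lemma comb_norm_cong: "(\<And>i. i < m \<Longrightarrow> a i = b i) \<Longrightarrow> comb_norm m xs a = comb_norm m xs b"
  unfolding comb_norm_def by (metis (no_types, lifting) lessThan_iff sum.cong)

lemma comb_norm_add: "comb_norm m xs (\<lambda>i. a i + b i) \<le> comb_norm m xs a + comb_norm m xs b"
  unfolding comb_norm_def by (simp add: scaleR_add_left sum.distrib norm_triangle_ineq)

lemma comb_norm_scale: "comb_norm m xs (\<lambda>i. c * a i) = \<bar>c\<bar> * comb_norm m xs a"
  unfolding comb_norm_def by (simp flip: scaleR_scaleR scaleR_sum_right)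

lemma comb_norm_le_sum:
  "(\<And>i. i < m \<Longrightarrow> norm (xs ! i) = 1) \<Longrightarrow> comb_norm m xs a \<le> (\<Sum>i<m. \<bar>a i\<bar>)"
  unfolding comb_norm_def by (rule order_trans[OF norm_sum]) (simp add: sum_mono)

lemma eventually_deep_norm:
  "\<forall>\<^sub>F xs in iterated_filter deep_sphere m. length xs = m \<and> (\<forall>i<m. norm (xs ! i) = 1)"
proof -
  have "\<forall>\<^sub>F x :: 'a in deep_sphere. norm x = 1"
    using UNIV_in_cof by (auto simp: eventually_deep_sphere)
  then have "\<forall>\<^sub>F xs :: 'a list in iterated_filter deep_sphere m. \<forall>i<m. norm (xs ! i) = 1"
    by (intro eventually_iterated_filterI[where R = "\<lambda>_ x. norm x = 1"])
  with eventually_iterated_filter_length show ?thesis by (rule eventually_conj)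
qed

text \<open>
  The next vector is chosen in the kernel of a functional that norms the partial sum.
\<close>

lemma eventually_deep_monotone:
  fixes a :: "nat \<Rightarrow> real"
  shows "\<forall>\<^sub>F xs :: 'a::real_normed_vector list in iterated_filter deep_sphere m.
    \<forall>j\<le>m. norm (\<Sum>i<j. a i *\<^sub>R xs ! i) \<le> comb_norm m xs a"
proof -
  let ?R = "\<lambda>xs x. norm (\<Sum>i<length xs. a i *\<^sub>R xs ! i) \<le> norm ((\<Sum>i<length xs. a i *\<^sub>R xs ! i) + a (length xs) *\<^sub>R (x :: 'a))"
  have "\<forall>\<^sub>F x in deep_sphere. ?R xs x" for xs
  proof -
    obtain f :: "'a \<Rightarrow>\<^sub>L real" where f: "norm f \<le> 1"
      "blinfun_apply f (\<Sum>i<length xs. a i *\<^sub>R xs ! i) = norm (\<Sum>i<length xs. a i *\<^sub>R xs ! i)"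
      using norming_functional by blast
    have "?R xs x" if "blinfun_apply f x = 0" for x
      using norm_blinfun_le_1[OF f(1), of "(\<Sum>i<length xs. a i *\<^sub>R xs ! i) + a (length xs) *\<^sub>R x"] that f(2)
      by (simp add: blinfun.add_right blinfun.scaleR_right)
    then show ?thesis unfolding eventually_deep_sphere
      by (intro bexI[OF _ kernel_in_cof[of f]]) simp
  qed
  then have "\<forall>\<^sub>F xs in iterated_filter deep_sphere m. \<forall>l<m. ?R (take l xs) (xs ! l)"
    by (intro eventually_iterated_filterI)
  with eventually_iterated_filter_length show ?thesis
  proof eventually_elim
    case (elim xs)
    let ?S = "\<lambda>j. \<Sum>i<j. a i *\<^sub>R xs ! i"
    have step: "norm (?S l) \<le> norm (?S (Suc l))" if "l < m" for l
    proof -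
      have "(\<Sum>i<l. a i *\<^sub>R take l xs ! i) = ?S l" by (intro sum.cong) auto
      then show ?thesis using elim that by (auto dest!: spec[of _ l])
    qed
    show ?case
    proof (intro allI impI)
      fix j assume "j \<le> m"
      then show "norm (?S j) \<le> comb_norm m xs a" unfolding comb_norm_def
        by (induction rule: inc_induct) (use step order_trans in blast)+
    qed
  qed
qed

lemma eventually_deep_coefficient:
  fixes a :: "nat \<Rightarrow> real"
  shows "\<forall>\<^sub>F xs :: 'a::real_normed_vector list in iterated_filter deep_sphere m.
    \<forall>j<m. \<bar>a j\<bar> \<le> 2 * comb_norm m xs a"
  using eventually_deep_monotone[where a = a and m = m] eventually_deep_norm
proof eventually_elim
  case (elim xs)
  show ?case
  proof (intro allI impI)
    fix j assume j: "j < m"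
    have "\<bar>a j\<bar> = norm ((\<Sum>i<Suc j. a i *\<^sub>R xs ! i) - (\<Sum>i<j. a i *\<^sub>R xs ! i))"
      using elim(2) j by simp
    also have "\<dots> \<le> norm (\<Sum>i<Suc j. a i *\<^sub>R xs ! i) + norm (\<Sum>i<j. a i *\<^sub>R xs ! i)"
      by (rule norm_triangle_ineq4)
    also have "\<dots> \<le> comb_norm m xs a + comb_norm m xs a"
      using elim(1) j by (intro add_mono) (simp_all del: sum.lessThan_Suc)
    finally show "\<bar>a j\<bar> \<le> 2 * comb_norm m xs a" by simp
  qed
qed

lemma grid_approximation:
  fixes a :: "nat \<Rightarrow> real" and M :: nat
  assumes a: "\<And>i. i < m \<Longrightarrow> \<bar>a i\<bar> \<le> 1" and M: "M > 0"
  shows "\<exists>z \<in> {..<m} \<rightarrow>\<^sub>E {- int M..int M}. \<forall>i<m. \<bar>a i - real_of_int (z i) / M\<bar> \<le> 1 / M"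
proof -
  let ?z = "\<lambda>i\<in>{..<m}. \<lfloor>M * a i\<rfloor>"
  have "- int M \<le> \<lfloor>M * a i\<rfloor> \<and> \<lfloor>M * a i\<rfloor> \<le> int M" if "i < m" for i
  proof -
    have "real M * a i \<le> real M * 1" "real M * (-1) \<le> real M * a i"
      using a[OF that] by (intro mult_left_mono; force simp: abs_le_iff)+
    then show ?thesis by (simp add: le_floor_iff floor_le_iff)
  qed
  moreover have "\<bar>a i - real_of_int \<lfloor>M * a i\<rfloor> / M\<bar> \<le> 1 / M" if "i < m" for i
  proof -
    have "\<bar>M * a i - real_of_int \<lfloor>M * a i\<rfloor>\<bar> \<le> 1" by linarith
    then have "\<bar>(M * a i - real_of_int \<lfloor>M * a i\<rfloor>) / M\<bar> \<le> 1 / M"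
      using M by (simp add: divide_right_mono)
    then show ?thesis using M by (simp add: diff_divide_distrib)
  qed
  ultimately show ?thesis by (intro bexI[of _ ?z]) auto
qed

lemma frequently_of_eventually_finer:
  assumes nb: "U \<noteq> bot" and le: "U \<le> F" and P: "eventually P U"
  shows "frequently P F"
  unfolding frequently_def
proof
  assume "\<forall>\<^sub>F x in F. \<not> P x"
  from filter_leD[OF le this] P have "\<forall>\<^sub>F x in U. False" by eventually_elim blast
  then show False using nb by (simp add: trivial_limit_def)
qed

text \<open>
  The limits of the norms of linear combinations define a norm whose basis is monotone because
  deep vectors do not shorten earlier combinations. The convergence is pointwise on coefficient
  sequences, and uniform on the unit cube, since all norms involved have the same Lipschitz constant there and a
  finite grid suffices. The lower bound by the coefficients turns the uniform additive estimate
  into the multiplicative estimate of an equivalence.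
\<close>

lemma limit_norm_in_asymptotic_structure:
  fixes U :: "'a::real_normed_vector list filter"
  assumes U: "ultrafilter U" and le: "U \<le> iterated_filter deep_sphere m"
  shows "\<exists>N\<in>asymptotic_structure TYPE('a) m. \<forall>s>1. \<forall>\<^sub>F xs in U. \<forall>a.
    1 / s * comb_norm m xs a \<le> N (\<Sum>i<m. a i *\<^sub>R unit_vec i) \<and>
    N (\<Sum>i<m. a i *\<^sub>R unit_vec i) \<le> s * comb_norm m xs a"
proof -
  have nb: "U \<noteq> bot" using U by (simp add: ultrafilter_def)
  note normal = filter_leD[OF le eventually_deep_norm]
  note monotone = filter_leD[OF le eventually_deep_monotone]
  note coefficient = filter_leD[OF le eventually_deep_coefficient]
  have "\<exists>l. ((\<lambda>xs. comb_norm m xs a) \<longlongrightarrow> l) U" for a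
  proof -
    let ?B = "\<Sum>i<m. \<bar>a i\<bar>"
    have "\<bar>min (comb_norm m xs a) ?B\<bar> \<le> ?B" for xs :: "'a list"
      by (auto simp: comb_norm_def sum_nonneg abs_le_iff min_def)
    then obtain l where "((\<lambda>xs. min (comb_norm m xs a) ?B) \<longlongrightarrow> l) U"
      using ultrafilter_tendsto_real[OF U, of "\<lambda>xs. min (comb_norm m xs a) ?B"] by blast
    moreover have "\<forall>\<^sub>F xs in U. min (comb_norm m xs a) ?B = comb_norm m xs a"
      using normal by eventually_elim (simp add: comb_norm_le_sum min_absorb1)
    ultimately have "((\<lambda>xs. comb_norm m xs a) \<longlongrightarrow> l) U" by (rule Lim_transform_eventually)
    then show ?thesis by (rule exI)
  qed
  then have "\<forall>a. \<exists>l. ((\<lambda>xs. comb_norm m xs a) \<longlongrightarrow> l) U" by (rule allI)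
  then obtain L where L: "\<And>a. ((\<lambda>xs. comb_norm m xs a) \<longlongrightarrow> L a) U"
    unfolding choice_iff by blast
  have L_cong: "L a = L b" if "\<And>i. i < m \<Longrightarrow> a i = b i" for a b
  proof -
    have "(\<lambda>xs :: 'a list. comb_norm m xs a) = (\<lambda>xs. comb_norm m xs b)"
      using that by (intro ext comb_norm_cong)
    then show ?thesis using tendsto_unique[OF nb L[of a]] L[of b] by simp
  qed
  have L_nonneg: "0 \<le> L a" for a
    by (rule tendsto_lowerbound[OF L _ nb]) (simp add: comb_norm_def)
  have L_add: "L (\<lambda>i. a i + b i) \<le> L a + L b" for a b
    by (rule tendsto_le[OF nb tendsto_add[OF L L] L]) (simp add: comb_norm_add)
  have L_scale: "L (\<lambda>i. c * a i) = \<bar>c\<bar> * L a" for c a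
    using tendsto_unique[OF nb L tendsto_mult_left[OF L[of a], of "\<bar>c\<bar>", folded comb_norm_scale]] by simp
  have L_le_sum: "L a \<le> (\<Sum>i<m. \<bar>a i\<bar>)" for a
    by (rule tendsto_upperbound[OF L eventually_mono[OF normal] nb]) (simp add: comb_norm_le_sum)
  have L_coefficient: "\<bar>a j\<bar> \<le> 2 * L a" if "j < m" for a j
    by (rule tendsto_lowerbound[OF tendsto_mult_left[OF L] eventually_mono[OF coefficient[of a]] nb])
      (use that in simp)
  have L_unit: "L (\<lambda>i. if i = j then 1 else 0) = 1" if "j < m" for j
  proof (rule tendsto_unique[OF nb L])
    have "\<forall>\<^sub>F xs in U. comb_norm m xs (\<lambda>i. if i = j then 1 else 0) = 1"
      using normal
    proof eventually_elim
      case (elim xs)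
      have "(\<Sum>i<m. (if i = j then 1 else 0) *\<^sub>R xs ! i) = (\<Sum>i<m. if i = j then xs ! i else 0)"
        by (intro sum.cong) auto
      then show ?case using elim that by (simp add: comb_norm_def)
    qed
    then show "((\<lambda>xs. comb_norm m xs (\<lambda>i. if i = j then 1 else 0)) \<longlongrightarrow> 1) U"
      by (rule tendsto_eventually)
  qed
  have L_mono: "L (\<lambda>i. if i < j then a i else 0) \<le> L a" if "j \<le> m" for a j
  proof (rule tendsto_le[OF nb L L])
    show "\<forall>\<^sub>F xs in U. comb_norm m xs (\<lambda>i. if i < j then a i else 0) \<le> comb_norm m xs a"
      using monotone[of a]
    proof eventually_elim
      case (elim xs)
      have "(\<Sum>i<m. (if i < j then a i else 0) *\<^sub>R xs ! i) = (\<Sum>i<j. a i *\<^sub>R xs ! i)"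
        using that by (intro sum.mono_neutral_cong_right) auto
      then show ?case using elim that by (simp add: comb_norm_def)
    qed
  qed
  define N where "N v = L (Poly_Mapping.lookup v)" for v
  have N_sum: "N (\<Sum>i<k. a i *\<^sub>R unit_vec i) = L (\<lambda>i. if i < k then a i else 0)" for a k
    unfolding N_def by (rule L_cong) (simp add: lookup_sum_unit_vec)
  have N_sum_m: "N (\<Sum>i<m. a i *\<^sub>R unit_vec i) = L a" for a
    unfolding N_sum by (rule L_cong) simp
  have unif: "\<forall>\<^sub>F xs in U. \<forall>a. (\<forall>i<m. \<bar>a i\<bar> \<le> 1) \<longrightarrow> \<bar>comb_norm m xs a - L a\<bar> \<le> \<eta>"
    if \<eta>: "\<eta> > 0" for \<eta>
  proof -
    obtain M :: nat where M: "M > 0" "m / M \<le> \<eta> / 3"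
    proof -
      obtain M :: nat where "3 * m / \<eta> < M" using reals_Archimedean2 by blast
      then have "real m / real (Suc M) \<le> \<eta> / 3" using \<eta> by (simp add: field_simps)
      then show thesis using that[of "Suc M"] by simp
    qed
    define grid where "grid z i = real_of_int (z i) / M" for z :: "nat \<Rightarrow> int" and i :: nat
    let ?Z = "{..<m} \<rightarrow>\<^sub>E {- int M..int M}"
    have "\<forall>\<^sub>F xs in U. \<forall>z\<in>?Z. \<bar>comb_norm m xs (grid z) - L (grid z)\<bar> < \<eta> / 3"
    proof (rule eventually_ball_finite)
      show "finite ?Z" by (intro finite_PiE) auto
      show "\<forall>z\<in>?Z. \<forall>\<^sub>F xs in U. \<bar>comb_norm m xs (grid z) - L (grid z)\<bar> < \<eta> / 3"
        using tendstoD[OF L, of "\<eta> / 3"] \<eta> by (auto simp: dist_real_def)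
    qed
    then show ?thesis using normal
    proof eventually_elim
      case (elim xs)
      show ?case
      proof (intro allI impI)
        fix a :: "nat \<Rightarrow> real" assume "\<forall>i<m. \<bar>a i\<bar> \<le> 1"
        then obtain z where z: "z \<in> ?Z" "\<And>i. i < m \<Longrightarrow> \<bar>a i - grid z i\<bar> \<le> 1 / M"
          using grid_approximation[of m a M] M(1) unfolding grid_def by blast
        have close: "\<bar>K a - K (grid z)\<bar> \<le> \<eta> / 3"
          if add: "\<And>a b. K (\<lambda>i. a i + b i) \<le> K a + K b" and le: "\<And>a. K a \<le> (\<Sum>i<m. \<bar>a i\<bar>)"
          for K :: "(nat \<Rightarrow> real) \<Rightarrow> real"
        proof -
          have "K a \<le> K (grid z) + K (\<lambda>i. a i - grid z i)"
            using add[of "grid z" "\<lambda>i. a i - grid z i"] by simp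
          moreover have "K (grid z) \<le> K a + K (\<lambda>i. grid z i - a i)"
            using add[of a "\<lambda>i. grid z i - a i"] by simp
          moreover have "(\<Sum>i<m. \<bar>a i - grid z i\<bar>) \<le> (\<Sum>i<m. 1 / M)"
            using z by (intro sum_mono) auto
          moreover have "(\<Sum>i<m. \<bar>grid z i - a i\<bar>) = (\<Sum>i<m. \<bar>a i - grid z i\<bar>)"
            by (simp add: abs_minus_commute)
          moreover have "(\<Sum>i<m. 1 / M) \<le> \<eta> / 3" using M by simp
          ultimately show ?thesis
            using le[of "\<lambda>i. a i - grid z i"] le[of "\<lambda>i. grid z i - a i"] by linarith
        qed
        have "\<bar>comb_norm m xs a - comb_norm m xs (grid z)\<bar> \<le> \<eta> / 3"
          using elim by (intro close comb_norm_add comb_norm_le_sum) auto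
        moreover have "\<bar>L a - L (grid z)\<bar> \<le> \<eta> / 3" by (intro close L_add L_le_sum)
        moreover have "\<bar>comb_norm m xs (grid z) - L (grid z)\<bar> < \<eta> / 3" using elim z by blast
        ultimately show "\<bar>comb_norm m xs a - L a\<bar> \<le> \<eta>" by linarith
      qed
    qed
  qed
  have equiv: "\<forall>\<^sub>F xs in U. \<forall>a. 1 / s * comb_norm m xs a \<le> L a \<and> L a \<le> s * comb_norm m xs a"
    if s: "s > 1" for s
  proof -
    \<comment> \<open>With this error the factors \<open>1 - 2 \<eta>\<close> and \<open>1 + 2 \<eta>\<close> are at least \<open>1 / s\<close> and at most \<open>s\<close>.\<close>
    define \<eta> where "\<eta> = (1 - 1 / s) / 2"
    have \<eta>: "\<eta> > 0" using s by (simp add: \<eta>_def)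
    show ?thesis using unif[OF \<eta>]
    proof eventually_elim
      case (elim xs)
      show ?case
      proof
        fix a :: "nat \<Rightarrow> real"
        let ?c = "comb_norm m xs a"
        have "\<bar>?c - L a\<bar> \<le> 2 * \<eta> * L a"
        proof (cases "\<exists>i<m. a i \<noteq> 0")
          case False
          then have "L a = L (\<lambda>i. 0 * a i)" "?c = comb_norm m xs (\<lambda>i. 0 * a i)"
            by (auto intro!: L_cong comb_norm_cong)
          moreover have "L (\<lambda>i. 0 * a i) = 0" "comb_norm m xs (\<lambda>i. 0 * a i) = 0"
            unfolding L_scale comb_norm_scale by simp_all
          ultimately show ?thesis by simp
        next
          case True
          define t where "t = Max ((\<lambda>i. \<bar>a i\<bar>) ` {..<m})"
          have t_ge: "\<bar>a i\<bar> \<le> t" if "i < m" for i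
            unfolding t_def using that by (intro Max_ge) auto
          have "t \<in> (\<lambda>i. \<bar>a i\<bar>) ` {..<m}" unfolding t_def using True by (intro Max_in) auto
          then obtain j where j: "j < m" "\<bar>a j\<bar> = t" by auto
          obtain p where "p < m" "a p \<noteq> 0" using True by blast
          then have t: "t > 0" using t_ge[of p] by linarith
          let ?b = "\<lambda>i. (1 / t) * a i"
          have "\<bar>?b i\<bar> \<le> 1" if "i < m" for i using t t_ge[OF that] by (simp add: field_simps abs_mult)
          then have "\<bar>comb_norm m xs ?b - L ?b\<bar> \<le> \<eta>" by (intro elim[rule_format])
          moreover have "\<bar>?b j\<bar> = 1" using t j by (simp add: abs_mult)
          then have "1 \<le> 2 * L ?b" using L_coefficient[OF j(1), of ?b] by linarith
          then have "\<eta> * 1 \<le> \<eta> * (2 * L ?b)" using \<eta> by (intro mult_left_mono) auto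
          ultimately have *: "\<bar>comb_norm m xs ?b - L ?b\<bar> \<le> 2 * \<eta> * L ?b" by simp
          have "comb_norm m xs ?b = ?c / t" "L ?b = L a / t"
            unfolding L_scale comb_norm_scale using t by simp_all
          then have "\<bar>?c - L a\<bar> / t \<le> 2 * \<eta> * L a / t" using * t
            by (simp add: diff_divide_distrib[symmetric] abs_divide)
          then show ?thesis using t by (simp add: divide_le_cancel)
        qed
        moreover have "2 * \<eta> * L a = L a - 1 / s * L a" by (simp add: \<eta>_def left_diff_distrib)
        moreover have "(2 - 1 / s) * L a = 2 * L a - 1 / s * L a" by (simp add: algebra_simps)
        ultimately have c: "?c \<le> (2 - 1 / s) * L a" "1 / s * L a \<le> ?c" by linarith+
        have "2 - 1 / s \<le> s" using s sum_squares_ge_zero[of "s - 1" 0] by (simp add: field_simps power2_eq_square)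
        then have "(2 - 1 / s) * L a \<le> s * L a" using L_nonneg by (intro mult_right_mono)
        then have "?c \<le> s * L a" using c(1) by linarith
        then show "1 / s * ?c \<le> L a \<and> L a \<le> s * ?c" using c(2) s by (simp add: field_simps)
      qed
    qed
  qed
  have "N \<in> normalized_monotone_norms m"
  proof -
    have "norm_on (Rn m) N"
      unfolding norm_on_def
    proof (intro conjI ballI allI)
      fix u v c assume uv: "u \<in> Rn m" "v \<in> Rn m"
      show "0 \<le> N v" by (simp add: N_def L_nonneg)
      show "N (c *\<^sub>R v) = \<bar>c\<bar> * N v"
        using L_scale[of c "Poly_Mapping.lookup v"] by (simp add: N_def cong: L_cong)
      show "N (u + v) \<le> N u + N v"
        using L_add[of "Poly_Mapping.lookup u" "Poly_Mapping.lookup v"] by (simp add: N_def lookup_add cong: L_cong)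
      show "N v = 0 \<longleftrightarrow> v = 0"
      proof
        assume "N v = 0"
        then have "Poly_Mapping.lookup v i = 0" if "i < m" for i
          using L_coefficient[OF that, of "Poly_Mapping.lookup v"] by (simp add: N_def)
        then have "v = (\<Sum>i<m. 0)" using sum_unit_vec_eq[OF uv(2)] by simp
        then show "v = 0" by simp
      next
        assume "v = 0"
        then show "N v = 0" using L_scale[of 0 "Poly_Mapping.lookup v"] by (simp add: N_def cong: L_cong)
      qed
    qed
    moreover have "N (unit_vec j) = 1" if "j < m" for j
    proof -
      have "N (unit_vec j) = L (\<lambda>i. if i = j then 1 else 0)"
        unfolding N_def by (rule L_cong) (simp add: unit_vec_def lookup_single when_def)
      then show ?thesis using L_unit[OF that] by simp
    qed
    moreover have "N (\<Sum>i<j. a i *\<^sub>R unit_vec i) \<le> N (\<Sum>i<m. a i *\<^sub>R unit_vec i)" if "j \<le> m" for a j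
      using L_mono[OF that, of a] by (subst N_sum_m, subst N_sum)
    ultimately show ?thesis unfolding normalized_monotone_norms_def by blast
  qed
  moreover have "cof_game m (\<lambda>xs :: 'a list. equivalent_seqs (1 + \<epsilon>) m norm (\<lambda>i. xs ! i) N unit_vec) []"
    if \<epsilon>: "\<epsilon> > 0" for \<epsilon>
  proof -
    define s where "s = sqrt (1 + \<epsilon>)"
    have s: "s > 1" "1 + \<epsilon> = s * s" using \<epsilon> by (auto simp: s_def)
    have "\<forall>\<^sub>F xs in U. equivalent_seqs (1 + \<epsilon>) m norm (\<lambda>i. xs ! i) N unit_vec"
      using equiv[OF s(1)]
    proof eventually_elim
      case (elim xs)
      have "lin_indep_seq m (\<lambda>i. xs ! i)"
      proof (rule lin_indep_seqI)
        fix a :: "nat \<Rightarrow> real" assume "(\<Sum>i<m. a i *\<^sub>R xs ! i) = 0"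
        then have "L a \<le> 0" using elim[rule_format, of a] by (simp add: comb_norm_def)
        then have "\<bar>a i\<bar> \<le> 0" if "i < m" for i using L_coefficient[OF that, of a] by simp
        then show "\<forall>i<m. a i = 0" by simp
      qed
      then show ?case unfolding equivalent_seqs_def N_sum_m
        using elim s lin_indep_unit_vec unfolding comb_norm_def
        by (intro conjI exI[of _ s]) auto
    qed
    then have "frequently (\<lambda>xs :: 'a list. equivalent_seqs (1 + \<epsilon>) m norm (\<lambda>i. xs ! i) N unit_vec) (iterated_filter deep_sphere m)"
      by (rule frequently_of_eventually_finer[OF nb le])
    then show ?thesis by (simp add: cof_game_iff_frequently)
  qed
  ultimately have "N \<in> asymptotic_structure TYPE('a) m" by (simp add: asymptotic_structure_def)
  then show ?thesis 
    using equiv by (intro bexI[of _ N] allI impI, unfold N_sum_m)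
qed

text \<open>
  If the subspace player could not enforce the estimate, then some ultrafilter would live on branches
  that violate it. But the limit norm along this ultrafilter belongs to the asymptotic structure.
  The constant \<open>C\<close> bounds this norm itself, and not just up to a factor, because the basis vectors have norm \<open>1\<close>
  in both spaces.
\<close>

lemma asymptotically_c0_upper_estimate:
  assumes C: "C_asymptotically_c0 C TYPE('a::real_normed_vector)" "C \<ge> 1"
  shows "\<forall>\<^sub>F xs :: 'a list in iterated_filter deep_sphere m.
    \<forall>a. (\<forall>i<m. \<bar>a i\<bar> \<le> 1) \<longrightarrow> comb_norm m xs a \<le> C + 1"
proof (cases "m = 0")
  case True
  then show ?thesis using C(2) by (simp add: comb_norm_def)
next
  case False
  define Q where "Q xs \<longleftrightarrow> (\<forall>a. (\<forall>i<m. \<bar>a i\<bar> \<le> 1) \<longrightarrow> comb_norm m xs a \<le> C + 1)" for xs :: "'a list"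
  let ?F = "iterated_filter deep_sphere m :: 'a list filter"
  have "eventually Q ?F"
  proof (rule ccontr)
    assume "\<not> ?thesis"
    then have "inf ?F (principal {xs. \<not> Q xs}) \<noteq> bot"
      unfolding trivial_limit_def eventually_inf_principal by simp
    then obtain U where U: "ultrafilter U" "U \<le> ?F" "U \<le> principal {xs. \<not> Q xs}"
      using ex_ultrafilter_le by (metis le_inf_iff)
    obtain N where N: "N \<in> asymptotic_structure TYPE('a) m"
      and lim: "\<And>s. s > 1 \<Longrightarrow> \<forall>\<^sub>F xs in U. \<forall>a.
        1 / s * comb_norm m xs a \<le> N (\<Sum>i<m. a i *\<^sub>R unit_vec i) \<and>
        N (\<Sum>i<m. a i *\<^sub>R unit_vec i) \<le> s * comb_norm m xs a"
      using limit_norm_in_asymptotic_structure[OF U(1,2)] by blast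
    have "equivalent_seqs C m N unit_vec (linf_norm m) unit_vec"
      using C(1) N False unfolding C_asymptotically_c0_def by simp
    then obtain A B where AB: "A > 0" "B > 0" "C = A * B"
      and eq: "\<And>a. 1 / A * N (\<Sum>i<m. a i *\<^sub>R unit_vec i) \<le> linf_norm m (\<Sum>i<m. a i *\<^sub>R unit_vec i)"
        "\<And>a. linf_norm m (\<Sum>i<m. a i *\<^sub>R unit_vec i) \<le> B * N (\<Sum>i<m. a i *\<^sub>R unit_vec i)"
      unfolding equivalent_seqs_def by blast
    let ?e = "\<lambda>i :: nat. if i = 0 then 1 else 0 :: real"
    have "(\<Sum>i<m. ?e i *\<^sub>R unit_vec i) = unit_vec 0"
      using False by (intro poly_mapping_eqI, subst lookup_sum_unit_vec) (auto simp: unit_vec_def lookup_one lookup_single when_def)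
    moreover have "N (unit_vec 0) = 1"
      using N False unfolding asymptotic_structure_def normalized_monotone_norms_def by blast
    moreover have "1 \<le> linf_norm m (unit_vec 0)"
      unfolding linf_norm_def using False
      by (intro Max_ge) (auto simp: unit_vec_def lookup_single when_def image_iff intro!: bexI[of _ 0])
    ultimately have "1 \<le> B" using eq(2)[of ?e] by simp
    then have AC: "A \<le> C" using AB mult_left_mono[of 1 B A] by simp
    have NC: "N (\<Sum>i<m. a i *\<^sub>R unit_vec i) \<le> C" if "\<forall>i<m. \<bar>a i\<bar> \<le> 1" for a
    proof -
      have "linf_norm m (\<Sum>i<m. a i *\<^sub>R unit_vec i) \<le> 1"
        unfolding linf_norm_def using False that by (intro Max.boundedI) (auto simp: lookup_sum_unit_vec)
      then have "1 / A * N (\<Sum>i<m. a i *\<^sub>R unit_vec i) \<le> 1" using eq(1)[of a] by linarith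
      then have "N (\<Sum>i<m. a i *\<^sub>R unit_vec i) \<le> A" using AB(1) by (simp add: field_simps)
      then show ?thesis using AC by linarith
    qed
    \<comment> \<open>The factor \<open>1 + 1 / C\<close> turns the bound \<open>C\<close> into \<open>C + 1\<close>.\<close>
    have "1 + 1 / C > 1" using C(2) by simp
    from lim[OF this] have "eventually Q U"
    proof eventually_elim
      case (elim xs)
      show ?case unfolding Q_def
      proof (intro allI impI)
        fix a :: "nat \<Rightarrow> real" assume "\<forall>i<m. \<bar>a i\<bar> \<le> 1"
        then have "1 / (1 + 1 / C) * comb_norm m xs a \<le> C" using elim NC by (meson order_trans)
        then have "C * comb_norm m xs a \<le> C * (C + 1)" using C(2) by (simp add: field_simps)
        then show "comb_norm m xs a \<le> C + 1" using C(2) by simp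
      qed
    qed
    moreover have "\<forall>\<^sub>F xs in U. \<not> Q xs" using filter_leD[OF U(3)] by (simp add: eventually_principal)
    ultimately have "\<forall>\<^sub>F xs in U. False" by eventually_elim blast
    then show False using U(1) by (simp add: ultrafilter_def trivial_limit_def)
  qed
  then show ?thesis unfolding Q_def .
qed

lemma asymptotically_c0_ball_estimate:
  assumes C: "C_asymptotically_c0 C TYPE('a::real_normed_vector)" "C \<ge> 1"
  shows "\<forall>\<^sub>F xs :: 'a list in iterated_filter deep_ball m. norm (sum_list xs) \<le> C + 1"
proof (rule eventually_deep_ball_of_sphere)
  have "sum_list (replicate m (0 :: 'a)) = 0" by (induction m) auto
  then show "norm (sum_list (replicate m (0 :: 'a))) \<le> C + 1" using C(2) by simp
  show "\<forall>\<^sub>F us :: 'a list in iterated_filter deep_sphere m.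
      \<forall>cs. length cs = m \<and> (\<forall>c\<in>set cs. \<bar>c\<bar> \<le> 1) \<longrightarrow> norm (sum_list (map2 (*\<^sub>R) cs us)) \<le> C + 1"
    using asymptotically_c0_upper_estimate[OF C, of m] eventually_iterated_filter_length
  proof eventually_elim
    case (elim us)
    show ?case
    proof (intro allI impI)
      fix cs :: "real list" assume cs: "length cs = m \<and> (\<forall>c\<in>set cs. \<bar>c\<bar> \<le> 1)"
      then have "sum_list (map2 (*\<^sub>R) cs us) = (\<Sum>i<m. cs ! i *\<^sub>R us ! i)"
        using elim(2) by (simp add: sum_list_sum_nth atLeast0LessThan)
      moreover have "\<forall>i<m. \<bar>cs ! i\<bar> \<le> 1" using cs by auto
      ultimately show "norm (sum_list (map2 (*\<^sub>R) cs us)) \<le> C + 1"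
        using elim(1) by (simp add: comb_norm_def)
    qed
  qed
qed

section \<open>Trees of weak limits in reflexive asymptotic-\<open>c\<^sub>0\<close> spaces\<close>

text \<open>
  Each increment of the tree is weakly null, so it is close to a vector of the subspace that the
  winning strategy prescribes. The slack \<open>1\<close> in \<open>L + 1\<close> absorbs the error of this approximation before
  the vector is scaled into the unit ball.
\<close>

lemma weakly_convergent_tree_estimate:
  fixes T :: "'i list \<Rightarrow> 'a::real_normed_vector" and L \<delta> :: real
  assumes "eventually P (iterated_filter deep_ball n)" and \<delta>: "\<delta> > 0" and L: "L \<ge> 0"
    and "\<And>is f. length is < n \<Longrightarrow>
      ((\<lambda>i. blinfun_apply (f :: 'a \<Rightarrow>\<^sub>L real) (T (is @ [i]))) \<longlongrightarrow> blinfun_apply f (T is)) U"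
    and "\<And>is i. length is < n \<Longrightarrow> norm (T (is @ [i]) - T is) \<le> L"
  shows "\<forall>\<^sub>F is in iterated_filter U n.
    \<exists>ws. P ws \<and> norm (T is - T [] - (L + 1) *\<^sub>R sum_list ws) \<le> n * \<delta>"
  using assms(1,4,5)
proof (induction n arbitrary: P T)
  case 0
  then show ?case by (auto intro: exI[of _ "[]"])
next
  case (Suc n)
  obtain V where V: "V \<in> cof"
    and next_move: "\<And>x. x \<in> V \<Longrightarrow> norm x \<le> 1 \<Longrightarrow> \<forall>\<^sub>F xs in iterated_filter deep_ball n. P (x # xs)"
    using Suc.prems(1) unfolding eventually_iterated_filter_Suc eventually_deep_ball by blast
  let ?d = "\<lambda>i. T [i] - T []"
  have "((\<lambda>i. blinfun_apply f (?d i)) \<longlongrightarrow> 0) U" for f :: "'a \<Rightarrow>\<^sub>L real"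
    using tendsto_diff[OF Suc.prems(2)[of "[]" f] tendsto_const[of "blinfun_apply f (T [])"]]
    by (simp add: blinfun.diff_right)
  then obtain v where v: "\<And>i. v i \<in> V" "((\<lambda>i. ?d i - v i) \<longlongrightarrow> 0) U"
    using weakly_null_near_cof[OF V, of ?d U] by blast
  have "\<forall>\<^sub>F i in U. norm (?d i - v i) < min \<delta> 1"
    using tendstoD[OF v(2), of "min \<delta> 1"] \<delta> by (simp add: dist_norm)
  then show ?case unfolding eventually_iterated_filter_Suc
  proof eventually_elim
    case (elim i)
    let ?x = "(1 / (L + 1)) *\<^sub>R v i"
    have "norm (v i) \<le> norm (?d i) + norm (?d i - v i)"
      using norm_triangle_ineq4[of "?d i" "?d i - v i"] by simp
    also have "\<dots> \<le> L + 1" using Suc.prems(3)[of "[]" i] elim by simp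
    finally have x: "?x \<in> V" "norm ?x \<le> 1"
      using V v(1) L by (auto simp: subspace_scale[OF cofD(1)])
    have v_eq: "v i = (L + 1) *\<^sub>R ?x" using L by simp
    have "\<forall>\<^sub>F is in iterated_filter U n.
      \<exists>ws. P (?x # ws) \<and> norm (T (i # is) - T (i # []) - (L + 1) *\<^sub>R sum_list ws) \<le> n * \<delta>"
      using Suc.prems(2)[of "i # _"] Suc.prems(3)[of "i # _"]
      by (intro Suc.IH next_move[OF x]) auto
    then show ?case
    proof eventually_elim
      case (elim "is")
      then obtain ws where ws: "P (?x # ws)"
        "norm (T (i # is) - T [i] - (L + 1) *\<^sub>R sum_list ws) \<le> n * \<delta>" by blast
      have "T (i # is) - T [] - (L + 1) *\<^sub>R sum_list (?x # ws) =
          (T (i # is) - T [i] - (L + 1) *\<^sub>R sum_list ws) + (?d i - v i)"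
        unfolding sum_list.Cons scaleR_add_right v_eq[symmetric] by (simp add: algebra_simps)
      then have "norm (T (i # is) - T [] - (L + 1) *\<^sub>R sum_list (?x # ws)) \<le>
          norm (T (i # is) - T [i] - (L + 1) *\<^sub>R sum_list ws) + norm (?d i - v i)"
        by (simp only: norm_triangle_ineq)
      also have "\<dots> \<le> n * \<delta> + \<delta>" using ws(2) \<open>norm (?d i - v i) < min \<delta> 1\<close> by simp
      finally show ?case using ws(1) by (intro exI[of _ "?x # ws"]) (simp add: algebra_simps)
    qed
  qed
qed

definition hamming_lipschitz :: "nat \<Rightarrow> real \<Rightarrow> ('i list \<Rightarrow> 'a::real_normed_vector) \<Rightarrow> bool" where
  "hamming_lipschitz m L g \<longleftrightarrow>
     (\<forall>is l j. length is = m \<longrightarrow> l < m \<longrightarrow> norm (g is - g (is[l := j])) \<le> L)"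

definition weak_Lim :: "'i filter \<Rightarrow> ('i \<Rightarrow> 'a::real_normed_vector) \<Rightarrow> 'a" where
  "weak_Lim U y = (SOME z. \<forall>f :: 'a \<Rightarrow>\<^sub>L real. ((\<lambda>i. blinfun_apply f (y i)) \<longlongrightarrow> blinfun_apply f z) U)"

lemma weak_Lim:
  fixes y :: "'i \<Rightarrow> 'a::real_normed_vector"
  assumes "reflexive_space TYPE('a)" "ultrafilter U" "\<And>i. norm (y i) \<le> B"
  shows "((\<lambda>i. blinfun_apply (f :: 'a \<Rightarrow>\<^sub>L real) (y i)) \<longlongrightarrow> blinfun_apply f (weak_Lim U y)) U"
  using someI_ex[OF reflexive_weak_limit[where y = y and B = B, OF assms]] unfolding weak_Lim_def by blast

primrec iterated_weak_limit :: "'i filter \<Rightarrow> ('i list \<Rightarrow> 'a::real_normed_vector) \<Rightarrow> nat \<Rightarrow> 'i list \<Rightarrow> 'a" where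
  "iterated_weak_limit U g 0 is = g is"
| "iterated_weak_limit U g (Suc r) is = weak_Lim U (\<lambda>i. iterated_weak_limit U g r (is @ [i]))"

text \<open>
  The Lipschitz bound survives weak limits by lower semicontinuity, and it supplies the boundedness
  that the existence of the next weak limit requires. So both claims are proved together.
\<close>

lemma iterated_weak_limit:
  fixes g :: "'i list \<Rightarrow> 'a::real_normed_vector"
  assumes refl: "reflexive_space TYPE('a)" and U: "ultrafilter U" and g: "hamming_lipschitz m L g"
  shows iterated_weak_limit_lipschitz:
      "length is + r = m \<Longrightarrow> l < length is \<Longrightarrow>
        norm (iterated_weak_limit U g r is - iterated_weak_limit U g r (is[l := j])) \<le> L"
    and iterated_weak_limit_tendsto:
      "length is + Suc r = m \<Longrightarrow>
        ((\<lambda>i. blinfun_apply (f :: 'a \<Rightarrow>\<^sub>L real) (iterated_weak_limit U g r (is @ [i])))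
          \<longlongrightarrow> blinfun_apply f (iterated_weak_limit U g (Suc r) is)) U"
proof -
  let ?T = "iterated_weak_limit U g"
  have conv: "((\<lambda>i. blinfun_apply f (?T r (is @ [i]))) \<longlongrightarrow> blinfun_apply f (?T (Suc r) is)) U"
    if lip: "\<And>is l j. length is + r = m \<Longrightarrow> l < length is \<Longrightarrow> norm (?T r is - ?T r (is[l := j])) \<le> L"
      and len: "length is + Suc r = m" for r "is" and f :: "'a \<Rightarrow>\<^sub>L real"
  proof -
    have "norm (?T r (is @ [i])) \<le> norm (?T r (is @ [undefined])) + L" for i
      using lip[of "is @ [i]" "length is" undefined] len
        norm_triangle_sub[of "?T r (is @ [i])" "?T r (is @ [undefined])"] by simp
    then show ?thesis unfolding iterated_weak_limit.simps by (rule weak_Lim[OF refl U])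
  qed
  have lip: "norm (?T r is - ?T r (is[l := j])) \<le> L" if "length is + r = m" "l < length is" for r "is" l j
    using that
  proof (induction r arbitrary: "is" l j)
    case 0
    then show ?case using g by (simp add: hamming_lipschitz_def)
  next
    case (Suc r)
    note conv = conv[of r, OF Suc.IH]
    show ?case
    proof (rule weak_limit_norm_le[OF ultrafilter_not_bot[OF U]])
      fix f :: "'a \<Rightarrow>\<^sub>L real"
      show "((\<lambda>i. blinfun_apply f (?T r (is @ [i]) - ?T r (is[l := j] @ [i])))
          \<longlongrightarrow> blinfun_apply f (?T (Suc r) is - ?T (Suc r) (is[l := j]))) U"
        unfolding blinfun.diff_right using Suc.prems by (intro tendsto_diff conv) auto
      show "\<forall>\<^sub>F i in U. norm (?T r (is @ [i]) - ?T r (is[l := j] @ [i])) \<le> L"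
        using Suc.IH[of "is @ [_]" l j] Suc.prems by (simp add: list_update_append)
    qed
  qed
  then show "length is + r = m \<Longrightarrow> l < length is \<Longrightarrow> norm (?T r is - ?T r (is[l := j])) \<le> L" .
  show "length is + Suc r = m \<Longrightarrow>
      ((\<lambda>i. blinfun_apply f (?T r (is @ [i]))) \<longlongrightarrow> blinfun_apply f (?T (Suc r) is)) U"
    by (rule conv[OF lip])
qed

lemma hamming_concentration_reflexive_c0:
  fixes g :: "'i list \<Rightarrow> 'a::real_normed_vector"
  assumes refl: "reflexive_space TYPE('a)" and U: "ultrafilter U"
    and g: "hamming_lipschitz m L g" and L: "L \<ge> 0"
    and C: "\<forall>\<^sub>F xs :: 'a list in iterated_filter deep_ball m. norm (sum_list xs) \<le> C"
  shows "\<exists>z. \<forall>\<^sub>F is in iterated_filter U m. norm (g is - z) \<le> C * (L + 1) + 1"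
proof -
  define T where "T is = iterated_weak_limit U g (m - length is) is" for "is"
  have conv: "((\<lambda>i. blinfun_apply f (T (is @ [i]))) \<longlongrightarrow> blinfun_apply f (T is)) U"
    if "length is < m" for "is" and f :: "'a \<Rightarrow>\<^sub>L real"
  proof -
    have "m - length is = Suc (m - Suc (length is))" using that by simp
    then show ?thesis
      using iterated_weak_limit_tendsto[OF refl U g, of "is" "m - Suc (length is)" f] that
      by (simp add: T_def)
  qed
  have step: "norm (T (is @ [i]) - T is) \<le> L" if "length is < m" for "is" i
  proof (rule weak_limit_norm_le[OF ultrafilter_not_bot[OF U]])
    fix f :: "'a \<Rightarrow>\<^sub>L real"
    show "((\<lambda>j. blinfun_apply f (T (is @ [i]) - T (is @ [j]))) \<longlongrightarrow> blinfun_apply f (T (is @ [i]) - T is)) U"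
      unfolding blinfun.diff_right by (intro tendsto_intros conv that)
    show "\<forall>\<^sub>F j in U. norm (T (is @ [i]) - T (is @ [j])) \<le> L"
      using iterated_weak_limit_lipschitz[OF refl U g, of "is @ [i]" "m - Suc (length is)" "length is"] that
      by (simp add: T_def)
  qed
  define \<delta> :: real where "\<delta> = 1 / (real m + 1)"
  have \<delta>: "\<delta> > 0" "m * \<delta> \<le> 1" by (auto simp: \<delta>_def field_simps)
  have "\<forall>\<^sub>F is in iterated_filter U m.
    \<exists>ws. norm (sum_list ws) \<le> C \<and> norm (T is - T [] - (L + 1) *\<^sub>R sum_list ws) \<le> m * \<delta>"
    by (rule weakly_convergent_tree_estimate[OF C \<delta>(1) L conv step])
  with eventually_iterated_filter_length have "\<forall>\<^sub>F is in iterated_filter U m. norm (g is - T []) \<le> C * (L + 1) + 1"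
  proof eventually_elim
    case (elim "is")
    then obtain ws where ws: "norm (sum_list ws) \<le> C" "norm (g is - T [] - (L + 1) *\<^sub>R sum_list ws) \<le> 1"
      using \<delta>(2) by (auto simp: T_def intro: order_trans)
    have "norm (g is - T []) \<le> norm (g is - T [] - (L + 1) *\<^sub>R sum_list ws) + norm ((L + 1) *\<^sub>R sum_list ws)"
      using norm_triangle_ineq[of "g is - T [] - (L + 1) *\<^sub>R sum_list ws" "(L + 1) *\<^sub>R sum_list ws"] by simp
    moreover have "norm ((L + 1) *\<^sub>R sum_list ws) \<le> C * (L + 1)"
      using mult_left_mono[OF ws(1), of "L + 1"] L by (simp add: mult.commute)
    ultimately show ?case using ws(2) by simp
  qed
  then show ?thesis by blast
qed

section \<open>Concentration is inherited through coarse embeddings\<close>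

text \<open>
  The index type of the variables is a parameter, because the property is used for several index
  sets: neighbourhoods in the weak* topology, moves in a game, and natural numbers.
\<close>

definition hamming_concentration :: "'i itself \<Rightarrow> 'a::real_normed_vector itself \<Rightarrow> real \<Rightarrow> real \<Rightarrow> bool" where
  "hamming_concentration _ _ L D \<longleftrightarrow>
     (\<forall>U m (g :: 'i list \<Rightarrow> 'a). ultrafilter U \<longrightarrow> hamming_lipschitz m L g \<longrightarrow>
        (\<forall>\<^sub>F is in iterated_filter U m. \<forall>\<^sub>F js in iterated_filter U m. norm (g is - g js) \<le> D))"

lemma hamming_concentrationD:
  fixes g :: "'i list \<Rightarrow> 'a::real_normed_vector"
  assumes "hamming_concentration TYPE('i) TYPE('a) L D" "ultrafilter U" "hamming_lipschitz m L g"
  shows "\<forall>\<^sub>F is in iterated_filter U m. \<forall>\<^sub>F js in iterated_filter U m. norm (g is - g js) \<le> D"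
  using assms unfolding hamming_concentration_def by blast

lemma coarse_embedding_expansion:
  assumes "coarse_embedding f" "L > 0"
  shows "\<exists>w\<ge>0. \<forall>x y. dist x y \<le> L \<longrightarrow> dist (f x) (f y) \<le> w"
proof -
  have fin: "expansion_modulus f L < \<infinity>" using assms by (simp add: coarse_embedding_def)
  then obtain w where w: "w \<ge> 0" "expansion_modulus f L = ennreal w"
    by (metis ennreal_cases infinity_ennreal_def order_less_irrefl)
  have "dist (f x) (f y) \<le> w" if "dist x y \<le> L" for x y
  proof -
    have "ennreal (dist (f x) (f y)) \<le> expansion_modulus f L"
      unfolding expansion_modulus_def using that by (intro Sup_upper) blast
    then show ?thesis using w by simp
  qed
  then show ?thesis using w by blast
qed

lemma coarse_embedding_compression:
  assumes "coarse_embedding f"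
  shows "\<exists>D. \<forall>x y. dist (f x) (f y) \<le> R \<longrightarrow> dist x y \<le> D"
proof -
  have "\<forall>\<^sub>F t in at_top. compression_modulus f t > ennreal R"
    using assms by (intro order_tendstoD(1)) (auto simp: coarse_embedding_def)
  then obtain D where D: "compression_modulus f D > ennreal R"
    by (auto simp: eventually_at_top_linorder)
  have "dist x y \<le> D" if R: "dist (f x) (f y) \<le> R" for x y
  proof (rule ccontr)
    assume "\<not> dist x y \<le> D"
    then have "compression_modulus f D \<le> ennreal (dist (f x) (f y))"
      unfolding compression_modulus_def by (intro Inf_lower) fastforce
    also have "\<dots> \<le> ennreal R" using R by (rule ennreal_leI)
    finally show False using D by simp
  qed
  then show ?thesis by blast
qed

text \<open>
  The radius \<open>R\<close> is the one of \<open>hamming_concentration_reflexive_c0\<close> for the function composed with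
  the embedding, and \<open>D\<close> is the distance beyond which the embedding separates points by more than \<open>2 R\<close>.
\<close>

lemma hamming_concentration_coarse:
  assumes refl: "reflexive_space TYPE('b::real_normed_vector)"
    and c0: "asymptotically_c0 TYPE('b)"
    and emb: "coarsely_embeds TYPE('a::real_normed_vector) TYPE('b)"
  shows "\<exists>D. hamming_concentration TYPE('i) TYPE('a) L D"
proof -
  obtain \<phi> :: "'a \<Rightarrow> 'b" where \<phi>: "coarse_embedding \<phi>" using emb by (auto simp: coarsely_embeds_def)
  obtain C where C: "C \<ge> 1" "C_asymptotically_c0 C TYPE('b)" using c0 by (auto simp: asymptotically_c0_def)
  obtain w where w: "w \<ge> 0" "\<And>x y. dist x y \<le> max L 1 \<Longrightarrow> dist (\<phi> x) (\<phi> y) \<le> w"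
    using coarse_embedding_expansion[OF \<phi>, of "max L 1"] by (metis less_max_iff_disj zero_less_one)
  define R where "R = (C + 1) * (w + 1) + 1"
  obtain D where D: "\<And>x y. dist (\<phi> x) (\<phi> y) \<le> 2 * R \<Longrightarrow> dist x y \<le> D"
    using coarse_embedding_compression[OF \<phi>] by blast
  have "\<forall>\<^sub>F is in iterated_filter U m. \<forall>\<^sub>F js in iterated_filter U m. norm (g is - g js) \<le> D"
    if U: "ultrafilter U" and g: "hamming_lipschitz m L g" for U m and g :: "'i list \<Rightarrow> 'a"
  proof -
    have "hamming_lipschitz m w (\<lambda>is. \<phi> (g is))"
      using g w(2) unfolding hamming_lipschitz_def dist_norm by (metis max.coboundedI1)
    then obtain z where z: "\<forall>\<^sub>F is in iterated_filter U m. norm (\<phi> (g is) - z) \<le> R"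
      using hamming_concentration_reflexive_c0[OF refl U _ w(1) asymptotically_c0_ball_estimate[OF C(2,1)]]
      unfolding R_def by blast
    from z show ?thesis
    proof eventually_elim
      case is_close: (elim "is")
      from z show ?case
      proof eventually_elim
        case (elim js)
        have "dist (\<phi> (g is)) (\<phi> (g js)) \<le> 2 * R"
          using is_close elim dist_triangle2[of "\<phi> (g is)" "\<phi> (g js)" z] by (simp add: dist_norm)
        then show ?case using D by (simp add: dist_norm)
      qed
    qed
  qed
  then show ?thesis unfolding hamming_concentration_def by blast
qed

lemma array_sum_update:
  assumes "length is = m" "p < m"
  shows "(\<Sum>l<m. (x l (is ! l) :: 'a::real_normed_vector)) - (\<Sum>l<m. x l (is[p := j] ! l)) = x p (is ! p) - x p j"
proof -
  have "(\<Sum>l<m. x l (is ! l)) - (\<Sum>l<m. x l (is[p := j] ! l)) =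
      (\<Sum>l<m. if l = p then x p (is ! p) - x p j else 0)"
    unfolding sum_subtractf[symmetric] using assms by (intro sum.cong) auto
  then show ?thesis using assms by simp
qed

lemma hamming_lipschitz_array_sum:
  fixes x :: "nat \<Rightarrow> 'b \<Rightarrow> 'a::real_normed_vector"
  assumes "\<And>l i. l < m \<Longrightarrow> norm (x l i) \<le> B"
  shows "hamming_lipschitz m (2 * B) (\<lambda>is. \<Sum>l<m. x l (is ! l))"
  unfolding hamming_lipschitz_def
proof (intro allI impI)
  fix "is" :: "'b list" and p j assume "length is = m" "p < m"
  then show "norm ((\<Sum>l<m. x l (is ! l)) - (\<Sum>l<m. x l (is[p := j] ! l))) \<le> 2 * B"
    unfolding array_sum_update[OF \<open>length is = m\<close> \<open>p < m\<close>]
    using norm_triangle_ineq4[of "x p (is ! p)" "x p j"] assms[of p "is ! p"] assms[of p j] by simp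
qed

section \<open>Concentration implies reflexivity\<close>

text \<open>
  This is Goldstine's theorem with the exact radius. A separation argument in \<open>\<real>\<^sup>Z\<close> is replaced by
  minimizing the squared distance \<open>q\<close> over the ball: at an almost minimal \<open>x\<close>, the functional
  \<open>h = \<Sum>\<^sub>f (f x - \<phi> f) f\<close> is almost minimal on the ball, so \<open>h x\<close> is almost \<open>- norm \<phi> * norm h\<close>,
  which is at most \<open>\<phi> h = h x - q x\<close>. Hence \<open>q x\<close> is almost \<open>0\<close>.
\<close>

lemma weak_star_approximation:
  fixes \<phi> :: "('a::real_normed_vector \<Rightarrow>\<^sub>L real) \<Rightarrow>\<^sub>L real"
  assumes Z: "finite Z" and \<epsilon>: "\<epsilon> > 0"
  shows "\<exists>x. norm x \<le> norm \<phi> \<and> (\<forall>f\<in>Z. \<bar>blinfun_apply f x - blinfun_apply \<phi> f\<bar> < \<epsilon>)"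
proof -
  let ?r = "norm \<phi>"
  define q where "q x = (\<Sum>f\<in>Z. (blinfun_apply f x - blinfun_apply \<phi> f)\<^sup>2)" for x
  have "\<exists>x. norm x \<le> ?r \<and> q x < \<epsilon>\<^sup>2"
  proof (rule ccontr)
    assume none: "\<not> ?thesis"
    define I where "I = (INF x\<in>cball 0 ?r. q x)"
    have q_nonneg: "0 \<le> q x" for x by (simp add: q_def sum_nonneg)
    have bdd: "bdd_below (q ` cball 0 ?r)" using q_nonneg by (intro bdd_belowI[of _ 0]) auto
    have ne: "cball 0 ?r \<noteq> ({} :: 'a set)" by (auto simp: cball_eq_empty)
    have I_le: "I \<le> q x" if "norm x \<le> ?r" for x
      unfolding I_def using that bdd by (intro cINF_lower) auto
    define M where "M = (\<Sum>f\<in>Z. (norm f * (2 * ?r))\<^sup>2)"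
    have M: "M \<ge> 0" by (simp add: M_def sum_nonneg)
    have small: "\<epsilon>\<^sup>2 \<le> s * (1 + M)" if s: "0 < s" "s < 1" for s
    proof -
      have "I < I + s\<^sup>2" using s by simp
      then obtain x where x: "norm x \<le> ?r" "q x < I + s\<^sup>2"
        using cINF_less_iff[OF ne bdd, of "I + s\<^sup>2"] unfolding I_def by auto
      \<comment> \<open>Up to the factor \<open>2\<close>, \<open>h\<close> is the derivative of \<open>q\<close> at \<open>x\<close>.\<close>
      define h where "h = (\<Sum>f\<in>Z. (blinfun_apply f x - blinfun_apply \<phi> f) *\<^sub>R f)"
      have h: "blinfun_apply h y = (\<Sum>f\<in>Z. (blinfun_apply f x - blinfun_apply \<phi> f) * blinfun_apply f y)" for y
        by (simp add: h_def blinfun.sum_left blinfun.scaleR_left)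
      define \<kappa> where "\<kappa> = s * (1 + M) - blinfun_apply h x"
      have "- blinfun_apply h y \<le> \<kappa>" if y: "norm y \<le> ?r" for y
      proof -
        have "x + s *\<^sub>R (y - x) = (1 - s) *\<^sub>R x + s *\<^sub>R y" by (simp add: algebra_simps)
        moreover have "norm ((1 - s) *\<^sub>R x + s *\<^sub>R y) \<le> (1 - s) * ?r + s * ?r"
          using s x(1) y by (intro norm_triangle_le add_mono) (auto intro: mult_left_mono)
        ultimately have "norm (x + s *\<^sub>R (y - x)) \<le> ?r" by (simp add: algebra_simps)
        then have "I \<le> q (x + s *\<^sub>R (y - x))" by (rule I_le)
        also have "\<dots> = q x + 2 * s * blinfun_apply h (y - x) + s\<^sup>2 * (\<Sum>f\<in>Z. (blinfun_apply f (y - x))\<^sup>2)"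
          unfolding q_def h sum_distrib_left sum.distrib[symmetric]
        proof (intro sum.cong refl)
          fix f assume "f \<in> Z"
          have "blinfun_apply f (x + s *\<^sub>R (y - x)) = blinfun_apply f x + s * blinfun_apply f (y - x)"
            by (simp only: blinfun.add_right blinfun.scaleR_right real_scaleR_def)
          then show "(blinfun_apply f (x + s *\<^sub>R (y - x)) - blinfun_apply \<phi> f)\<^sup>2 =
              (blinfun_apply f x - blinfun_apply \<phi> f)\<^sup>2
              + 2 * s * ((blinfun_apply f x - blinfun_apply \<phi> f) * blinfun_apply f (y - x))
              + s\<^sup>2 * (blinfun_apply f (y - x))\<^sup>2"
            by (simp only: power2_eq_square) (simp only: algebra_simps)
        qed
        also have "(\<Sum>f\<in>Z. (blinfun_apply f (y - x))\<^sup>2) \<le> M"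
          unfolding M_def
        proof (intro sum_mono)
          fix f assume "f \<in> Z"
          have "\<bar>blinfun_apply f (y - x)\<bar> \<le> norm f * norm (y - x)" using norm_blinfun[of f "y - x"] by simp
          also have "\<dots> \<le> norm f * (2 * ?r)"
            using x(1) y norm_triangle_ineq4[of y x] by (intro mult_left_mono) auto
          finally have "\<bar>blinfun_apply f (y - x)\<bar>\<^sup>2 \<le> (norm f * (2 * ?r))\<^sup>2" by (intro power_mono) auto
          then show "(blinfun_apply f (y - x))\<^sup>2 \<le> (norm f * (2 * ?r))\<^sup>2" by simp
        qed
        finally have "I \<le> q x + 2 * s * blinfun_apply h (y - x) + s\<^sup>2 * M"
          using s by (simp add: mult_left_mono)
        then have "0 \<le> s * (s * (1 + M) + 2 * blinfun_apply h (y - x))"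
          using x(2) by (simp add: power2_eq_square algebra_simps)
        then have "0 \<le> s * (1 + M) + 2 * blinfun_apply h (y - x)" using s by (simp add: zero_le_mult_iff)
        moreover have "0 \<le> s * (1 + M)" using s M by simp
        moreover have "- a \<le> p - b" if "0 \<le> p + 2 * (a - b)" "0 \<le> p" for p a b :: real
          using that by argo
        ultimately show ?thesis unfolding \<kappa>_def blinfun.diff_right by blast
      qed
      from this this[of "- _"] have h_le: "\<bar>blinfun_apply h y\<bar> \<le> \<kappa>" if "norm y \<le> ?r" for y
        using that by (simp add: abs_le_iff minus_le_iff blinfun.minus_right)
      have "?r * norm h \<le> \<kappa>"
      proof (cases "?r = 0")
        case True
        then show ?thesis using h_le[of 0] by simp
      next
        case False
        then have r: "?r > 0" by simp
        have "norm h \<le> \<kappa> / ?r"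
        proof (rule norm_blinfun_bound)
          show "0 \<le> \<kappa> / ?r" using h_le[of 0] by simp
          show "norm (blinfun_apply h z) \<le> \<kappa> / ?r * norm z" for z
          proof (cases "z = 0")
            case True then show ?thesis by (simp add: blinfun.zero_right)
          next
            case False
            then have "\<bar>blinfun_apply h ((?r / norm z) *\<^sub>R z)\<bar> \<le> \<kappa>" by (intro h_le) simp
            then show ?thesis using False r by (simp add: blinfun.scaleR_right abs_mult field_simps)
          qed
        qed
        then show ?thesis using r by (simp add: field_simps)
      qed
      moreover have "- blinfun_apply \<phi> h \<le> ?r * norm h" using norm_blinfun[of \<phi> h] by simp
      moreover have "blinfun_apply \<phi> h = blinfun_apply h x - q x"
        unfolding h unfolding h_def q_def blinfun.sum_right blinfun.scaleR_right sum_subtractf[symmetric]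
        by (intro sum.cong) (auto simp: power2_eq_square algebra_simps)
      ultimately have "q x \<le> s * (1 + M)" unfolding \<kappa>_def by linarith
      moreover have "\<epsilon>\<^sup>2 \<le> q x" using none x(1) by (meson not_less)
      ultimately show ?thesis by linarith
    qed
    \<comment> \<open>Any \<open>s\<close> in \<open>(0, 1)\<close> with \<open>s (1 + M) < \<epsilon>\<^sup>2\<close> contradicts \<open>small\<close>.\<close>
    define s where "s = min (1 / 2) (\<epsilon>\<^sup>2 / (2 * (1 + M)))"
    have s: "0 < s" "s < 1" using \<epsilon> M by (auto simp: s_def min_less_iff_disj)
    have half: "e / (2 * c) * c = e / 2" if "c > 0" for e c :: real using that by simp
    have "\<epsilon>\<^sup>2 \<le> s * (1 + M)" by (rule small[OF s])
    also have "\<dots> \<le> \<epsilon>\<^sup>2 / (2 * (1 + M)) * (1 + M)"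
      unfolding s_def using M by (intro mult_right_mono) auto
    also have "\<dots> = \<epsilon>\<^sup>2 / 2" using M by (intro half) simp
    finally have "\<epsilon>\<^sup>2 \<le> \<epsilon>\<^sup>2 / 2" .
    then show False using \<epsilon> by simp
  qed
  then obtain x where x: "norm x \<le> ?r" "q x < \<epsilon>\<^sup>2" by blast
  have "\<bar>blinfun_apply f x - blinfun_apply \<phi> f\<bar> < \<epsilon>" if "f \<in> Z" for f
  proof -
    have "(blinfun_apply f x - blinfun_apply \<phi> f)\<^sup>2 \<le> q x"
      unfolding q_def by (rule member_le_sum[OF that]) (use Z in auto)
    then have "\<bar>blinfun_apply f x - blinfun_apply \<phi> f\<bar>\<^sup>2 < \<epsilon>\<^sup>2" using x(2) by (simp only: power2_abs)
    then show ?thesis by (rule power2_less_imp_less) (use \<epsilon> in simp)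
  qed
  then show ?thesis using x(1) by blast
qed

text \<open>
  The image of a complete space under the canonical embedding is closed in the bidual.
\<close>

lemma non_evaluation_gap:
  fixes \<phi> :: "('a::banach \<Rightarrow>\<^sub>L real) \<Rightarrow>\<^sub>L real"
  assumes \<phi>: "\<And>x. \<exists>f. blinfun_apply \<phi> f \<noteq> blinfun_apply f x"
  shows "\<exists>d>0. \<forall>x. \<exists>f. norm f \<le> 1 \<and> d \<le> \<bar>blinfun_apply \<phi> f - blinfun_apply f x\<bar>"
proof (rule ccontr)
  assume neg: "\<not> ?thesis"
  have "\<exists>x. \<forall>f. norm f \<le> 1 \<longrightarrow> \<bar>blinfun_apply \<phi> f - blinfun_apply f x\<bar> < 1 / real (Suc n)" for n
  proof -
    have "1 / real (Suc n) > 0" by simp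
    then show ?thesis using neg by (meson not_le)
  qed
  then obtain x where x: "\<And>n f. norm f \<le> 1 \<Longrightarrow> \<bar>blinfun_apply \<phi> f - blinfun_apply f (x n)\<bar> < 1 / real (Suc n)"
    by metis
  have dist: "norm (x m - x n) \<le> 1 / real (Suc m) + 1 / real (Suc n)" for m n
  proof -
    obtain f :: "'a \<Rightarrow>\<^sub>L real" where f: "norm f \<le> 1" "blinfun_apply f (x m - x n) = norm (x m - x n)"
      using norming_functional by blast
    then show ?thesis using x[OF f(1), of m] x[OF f(1), of n] by (simp add: blinfun.diff_right)
  qed
  have "Cauchy x"
  proof (rule metric_CauchyI)
    fix e :: real assume "e > 0"
    then obtain N where N: "1 / real (Suc N) < e / 2" using nat_approx_posE[of "e / 2"] by auto
    have "dist (x m) (x n) < e" if "m \<ge> N" "n \<ge> N" for m n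
    proof -
      have "1 / real (Suc m) \<le> 1 / real (Suc N)" "1 / real (Suc n) \<le> 1 / real (Suc N)"
        using that by (auto intro!: divide_left_mono)
      then show ?thesis using dist[of m n] N by (simp add: dist_norm)
    qed
    then show "\<exists>M. \<forall>m\<ge>M. \<forall>n\<ge>M. dist (x m) (x n) < e" by blast
  qed
  then obtain z where z: "x \<longlonglongrightarrow> z" using Cauchy_convergent convergent_def by blast
  have eq: "blinfun_apply \<phi> f = blinfun_apply f z" if f: "norm f \<le> 1" for f
  proof -
    have "(\<lambda>n. \<bar>blinfun_apply \<phi> f - blinfun_apply f (x n)\<bar>) \<longlonglongrightarrow> \<bar>blinfun_apply \<phi> f - blinfun_apply f z\<bar>"
      using z by (intro tendsto_intros)
    moreover have "(\<lambda>n. 1 / real (Suc n)) \<longlonglongrightarrow> 0" by (rule LIMSEQ_Suc[OF lim_1_over_n])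
    ultimately have "\<bar>blinfun_apply \<phi> f - blinfun_apply f z\<bar> \<le> 0"
      using x[OF f] by (intro LIMSEQ_le[of _ _ "\<lambda>n. 1 / real (Suc n)"]) (auto intro!: exI[of _ 0] less_imp_le)
    then show ?thesis by simp
  qed
  have "blinfun_apply \<phi> f = blinfun_apply f z" for f
  proof (cases "f = 0")
    case True then show ?thesis by simp
  next
    case False
    then have "blinfun_apply \<phi> ((1 / norm f) *\<^sub>R f) = blinfun_apply ((1 / norm f) *\<^sub>R f) z"
      by (intro eq) simp
    then show ?thesis using False by (simp add: blinfun.scaleR_right blinfun.scaleR_left)
  qed
  then show False using \<phi> by blast
qed

text \<open>
  The variables are pairs of a finite set of functionals and an error, that is, basic weak*
  neighbourhoods of \<open>\<phi>\<close>, and \<open>x\<close> picks a vector in each of them.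
\<close>

lemma reflexive_of_hamming_concentration:
  assumes conc: "\<And>L. \<exists>D. hamming_concentration TYPE(('a::banach \<Rightarrow>\<^sub>L real) set \<times> real) TYPE('a) L D"
  shows "reflexive_space TYPE('a)"
proof (rule ccontr)
  assume "\<not> ?thesis"
  then obtain \<phi> :: "('a \<Rightarrow>\<^sub>L real) \<Rightarrow>\<^sub>L real" where \<phi>: "\<And>x. \<exists>f. blinfun_apply \<phi> f \<noteq> blinfun_apply f x"
    unfolding reflexive_space_def by blast
  obtain d where d: "d > 0" and gap: "\<And>x. \<exists>f. norm f \<le> 1 \<and> d \<le> \<bar>blinfun_apply \<phi> f - blinfun_apply f x\<bar>"
    using non_evaluation_gap[of \<phi>] \<phi> by blast
  let ?r = "norm \<phi>"
  let ?G = "\<lambda>Z \<epsilon> x. norm x \<le> ?r \<and> (\<forall>f\<in>Z. \<bar>blinfun_apply f x - blinfun_apply \<phi> f\<bar> < \<epsilon>)"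
  define x where "x = (\<lambda>(Z, \<epsilon>). if finite Z \<and> \<epsilon> > 0 then SOME x. ?G Z \<epsilon> x else 0)"
  have x: "?G Z \<epsilon> (x (Z, \<epsilon>))" if "finite Z" "\<epsilon> > 0" for Z \<epsilon>
    using someI_ex[OF weak_star_approximation[OF that, of \<phi>]] that by (simp add: x_def)
  have x_norm: "norm (x i) \<le> ?r" for i
  proof (cases i)
    case (Pair Z \<epsilon>)
    then show ?thesis using x[of Z \<epsilon>] by (cases "finite Z \<and> \<epsilon> > 0") (auto simp: x_def)
  qed
  let ?F = "finite_subsets_at_top UNIV \<times>\<^sub>F at_right 0 :: (('a \<Rightarrow>\<^sub>L real) set \<times> real) filter"
  have "?F \<noteq> bot" by (simp add: prod_filter_eq_bot)
  then obtain U where U: "ultrafilter U" "U \<le> ?F" using ex_ultrafilter_le by blast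
  have lim: "\<forall>\<^sub>F i in U. \<bar>blinfun_apply f (x i) - blinfun_apply \<phi> f\<bar> < \<eta>" if "\<eta> > 0" for f \<eta>
  proof (rule filter_leD[OF U(2)])
    have "\<forall>\<^sub>F Z in finite_subsets_at_top UNIV. finite Z \<and> f \<in> Z"
      by (auto simp: eventually_finite_subsets_at_top intro!: exI[of _ "{f}"])
    moreover have "\<forall>\<^sub>F \<epsilon> in at_right 0. 0 < \<epsilon> \<and> \<epsilon> < \<eta>"
      using that by (auto simp: eventually_at_right intro: exI[of _ \<eta>])
    ultimately show "\<forall>\<^sub>F i in ?F. \<bar>blinfun_apply f (x i) - blinfun_apply \<phi> f\<bar> < \<eta>"
    proof (subst eventually_prod_filter, intro exI conjI allI impI)
      fix Z \<epsilon> assume "finite Z \<and> f \<in> Z" "0 < \<epsilon> \<and> \<epsilon> < \<eta>"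
      then have "\<bar>blinfun_apply f (x (Z, \<epsilon>)) - blinfun_apply \<phi> f\<bar> < \<epsilon>" using x by blast
      also have "\<dots> < \<eta>" using \<open>0 < \<epsilon> \<and> \<epsilon> < \<eta>\<close> by blast
      finally show "\<bar>blinfun_apply f (x (Z, \<epsilon>)) - blinfun_apply \<phi> f\<bar> < \<eta>" .
    qed
  qed
  obtain D where D: "hamming_concentration TYPE(('a \<Rightarrow>\<^sub>L real) set \<times> real) TYPE('a) (2 * ?r) D"
    using conc by blast
  obtain m :: nat where m: "2 * (D + 1) / d < m" using reals_Archimedean2 by blast
  let ?g = "\<lambda>is. \<Sum>l<m. x (is ! l)"
  have "hamming_lipschitz m (2 * ?r) ?g"
    using hamming_lipschitz_array_sum[of m "\<lambda>_. x" ?r] x_norm by simp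
  note ev = hamming_concentrationD[OF D U(1) this]
  obtain "is" where "is": "\<forall>\<^sub>F js in iterated_filter U m. norm (?g is - ?g js) \<le> D"
    using eventually_happens'[OF iterated_filter_not_bot[OF ultrafilter_not_bot[OF U(1)]] ev] by blast
  obtain f where f: "norm f \<le> 1" "d \<le> \<bar>blinfun_apply \<phi> f - blinfun_apply f ((1 / m) *\<^sub>R ?g is)\<bar>"
    using gap by blast
  have "\<forall>\<^sub>F js in iterated_filter U m. \<forall>l<m. \<bar>blinfun_apply f (x (js ! l)) - blinfun_apply \<phi> f\<bar> < d / 2"
    using d by (intro eventually_iterated_filterI[where R = "\<lambda>_ j. \<bar>blinfun_apply f (x j) - blinfun_apply \<phi> f\<bar> < d / 2"] lim) simp
  with "is" have "\<forall>\<^sub>F js in iterated_filter U m. False"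
  proof eventually_elim
    case (elim js)
    show ?case
    proof (cases "D < 0")
      case True
      then show ?thesis using elim(1) norm_ge_zero[of "?g is - ?g js"] by linarith
    next
      case False
      then have "0 < 2 * (D + 1) / d" using d by simp
      then have m0: "m > 0" using m by linarith
      have "\<bar>blinfun_apply f (?g js) - m * blinfun_apply \<phi> f\<bar> = \<bar>\<Sum>l<m. blinfun_apply f (x (js ! l)) - blinfun_apply \<phi> f\<bar>"
        by (simp add: blinfun.sum_right sum_subtractf)
      also have "\<dots> \<le> (\<Sum>l<m. d / 2)"
        using elim(2) by (intro order_trans[OF sum_abs] sum_mono) (auto intro: less_imp_le)
      finally have "\<bar>blinfun_apply f (?g js) - m * blinfun_apply \<phi> f\<bar> \<le> m * (d / 2)" by simp
      moreover have "m * d \<le> m * \<bar>blinfun_apply \<phi> f - blinfun_apply f ((1 / m) *\<^sub>R ?g is)\<bar>"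
        using f(2) by (intro mult_left_mono) auto
      then have "m * d \<le> \<bar>m * (blinfun_apply \<phi> f - blinfun_apply f ((1 / m) *\<^sub>R ?g is))\<bar>"
        by (simp add: abs_mult)
      then have "m * d \<le> \<bar>m * blinfun_apply \<phi> f - blinfun_apply f (?g is)\<bar>"
        using m0 by (simp add: blinfun.scaleR_right right_diff_distrib)
      moreover have "\<bar>blinfun_apply f (?g is - ?g js)\<bar> \<le> D"
        using norm_blinfun_le_1[OF f(1)] elim(1) order_trans by blast
      ultimately have "m * d \<le> m * (d / 2) + D" unfolding blinfun.diff_right by linarith
      moreover have "2 * (D + 1) < m * d" using m d by (simp add: field_simps)
      ultimately show ?thesis by simp
    qed
  qed
  then show False using iterated_filter_not_bot[OF ultrafilter_not_bot[OF U(1)]]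
    by (simp add: trivial_limit_def)
qed

section \<open>Arrays of deep vectors\<close>

text \<open>
  Concentration bounds the difference of two sums. The terms of the second one may be taken in the
  kernel of a functional that norms the first.
\<close>

lemma array_upper_estimate:
  fixes x :: "nat \<Rightarrow> 'i \<Rightarrow> 'a::real_normed_vector"
  assumes conc: "hamming_concentration TYPE('i) TYPE('a) 2 D" and U: "ultrafilter U"
    and norm: "\<And>l i. l < m \<Longrightarrow> norm (x l i) \<le> 1"
    and deep: "\<And>l V. l < m \<Longrightarrow> V \<in> cof \<Longrightarrow> \<forall>\<^sub>F i in U. x l i \<in> V"
  shows "\<forall>\<^sub>F is in iterated_filter U m. norm (\<Sum>l<m. x l (is ! l)) \<le> D"
proof -
  let ?g = "\<lambda>is. \<Sum>l<m. x l (is ! l)"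
  note nb = iterated_filter_not_bot[OF ultrafilter_not_bot[OF U], of m]
  have "hamming_lipschitz m 2 ?g"
    using hamming_lipschitz_array_sum[of m x 1] norm by simp
  from hamming_concentrationD[OF conc U this] show ?thesis
  proof eventually_elim
    case (elim "is")
    obtain f :: "'a \<Rightarrow>\<^sub>L real" where f: "norm f \<le> 1" "blinfun_apply f (?g is) = norm (?g is)"
      using norming_functional by blast
    have "\<forall>\<^sub>F js in iterated_filter U m. \<forall>l<m.
        length (take l js) < m \<longrightarrow> blinfun_apply f (x (length (take l js)) (js ! l)) = 0"
      using deep[OF _ kernel_in_cof[of f]]
      by (intro eventually_iterated_filterI[where R = "\<lambda>js j. length js < m \<longrightarrow> blinfun_apply f (x (length js) j) = 0"]) simp
    with elim eventually_iterated_filter_length[of m U]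
    have "\<forall>\<^sub>F js in iterated_filter U m. norm (?g is) \<le> D"
    proof eventually_elim
      case (elim js)
      have "blinfun_apply f (?g js) = 0"
        unfolding blinfun.sum_right using elim by (intro sum.neutral) (auto simp: min_def)
      then have "norm (?g is) = blinfun_apply f (?g is - ?g js)" using f(2) by (simp add: blinfun.diff_right)
      also have "\<dots> \<le> norm (?g is - ?g js)" using norm_blinfun_le_1[OF f(1)] abs_le_D1 by blast
      finally show ?case using elim(1) by linarith
    qed
    then show ?case using eventually_happens'[OF nb] by blast
  qed
qed

section \<open>Games that carry norming functionals\<close>

text \<open>
  A strengthening of the asymptotic game: the vector player also keeps a functional, and the subspace
  player may require the new functional to be close to the current one on finitely many vectors.
\<close>

primrec winning :: "('a::real_normed_vector list \<Rightarrow> ('a \<Rightarrow>\<^sub>L real) \<Rightarrow> bool) \<Rightarrow> nat \<Rightarrow> 'a list \<Rightarrow> ('a \<Rightarrow>\<^sub>L real) \<Rightarrow> bool" where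
  "winning R 0 xs f \<longleftrightarrow> R xs f"
| "winning R (Suc n) xs f \<longleftrightarrow>
     (\<forall>V Z \<delta>. V \<in> cof \<and> finite Z \<and> \<delta> > 0 \<longrightarrow>
        (\<exists>x g. x \<in> V \<and> norm x = 1 \<and> norm g \<le> 1 \<and>
          (\<forall>z\<in>Z. \<bar>blinfun_apply g z - blinfun_apply f z\<bar> < \<delta>) \<and> winning R n (xs @ [x]) g))"

definition cof_tails :: "'a::real_normed_vector set filter" where
  "cof_tails = (INF V\<in>cof. principal {W \<in> cof. W \<subseteq> V})"

lemma eventually_cof_tails:
  "eventually P cof_tails \<longleftrightarrow> (\<exists>V\<in>cof. \<forall>W\<in>cof. W \<subseteq> V \<longrightarrow> P W)"
  unfolding cof_tails_def
proof (subst eventually_INF_base)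
  show "cof \<noteq> {}" using UNIV_in_cof by blast
next
  fix V W :: "'a set" assume "V \<in> cof" "W \<in> cof"
  then show "\<exists>x\<in>cof. principal {W' \<in> cof. W' \<subseteq> x} \<le>
      inf (principal {W' \<in> cof. W' \<subseteq> V}) (principal {W' \<in> cof. W' \<subseteq> W})"
    by (intro bexI[of _ "V \<inter> W"] Int_in_cof) auto
qed (auto simp: eventually_principal)

lemma cof_tails_not_bot: "cof_tails \<noteq> bot"
  by (auto simp: trivial_limit_def eventually_cof_tails)

text \<open>
  The functional of a position is a weak* limit of the functionals that belong to the answers to
  smaller and smaller subspaces. Closeness on a finite set then holds for the answers to sufficiently
  small subspaces.
\<close>

lemma winning_of_cof_game:
  fixes R :: "'a::real_normed_vector list \<Rightarrow> ('a \<Rightarrow>\<^sub>L real) \<Rightarrow> bool"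
  assumes "cof_game n (\<lambda>xs. \<exists>f. norm f \<le> 1 \<and> R xs f) xs"
  shows "\<exists>f. norm f \<le> 1 \<and> winning R n xs f"
  using assms
proof (induction n arbitrary: xs)
  case 0
  then show ?case by simp
next
  case (Suc n)
  have "\<forall>V. \<exists>x f. V \<in> cof \<longrightarrow> x \<in> V \<and> norm x = 1 \<and> norm f \<le> 1 \<and> winning R n (xs @ [x]) f"
  proof
    fix V :: "'a set"
    show "\<exists>x f. V \<in> cof \<longrightarrow> x \<in> V \<and> norm x = 1 \<and> norm f \<le> 1 \<and> winning R n (xs @ [x]) f"
    proof (cases "V \<in> cof")
      case True
      then obtain x where "x \<in> V" "norm x = 1" "cof_game n (\<lambda>xs. \<exists>f. norm f \<le> 1 \<and> R xs f) (xs @ [x])"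
        using Suc.prems unfolding cof_game.simps by blast
      then show ?thesis using Suc.IH by blast
    qed blast
  qed
  then obtain x f where xf: "\<And>V. V \<in> cof \<Longrightarrow> x V \<in> V \<and> norm (x V) = 1 \<and> norm (f V) \<le> 1 \<and> winning R n (xs @ [x V]) (f V)"
    unfolding choice_iff by blast
  obtain U :: "'a set filter" where U: "ultrafilter U" "U \<le> cof_tails"
    using ex_ultrafilter_le[OF cof_tails_not_bot] by blast
  define F where "F V = (if V \<in> cof then f V else 0)" for V
  have F: "norm (F V) \<le> 1" for V using xf[of V] by (simp add: F_def)
  have "\<exists>g :: 'a \<Rightarrow>\<^sub>L real. norm g \<le> 1 \<and> (\<forall>z. ((\<lambda>V. blinfun_apply (F V) z) \<longlongrightarrow> blinfun_apply g z) U)"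
  proof (rule ultrafilter_limit_functional[OF U(1)])
    show "linear (blinfun_apply (F V))" for V
      by (intro linearI) (auto simp: blinfun.add_right blinfun.scaleR_right)
    show "\<bar>blinfun_apply (F V) z\<bar> \<le> 1 * norm z" for V z using norm_blinfun_le_1[OF F] by simp
  qed simp
  then obtain g :: "'a \<Rightarrow>\<^sub>L real" where g: "norm g \<le> 1"
    "\<And>z. ((\<lambda>V. blinfun_apply (F V) z) \<longlongrightarrow> blinfun_apply g z) U" by blast
  have "winning R (Suc n) xs g"
    unfolding winning.simps
  proof (intro allI impI, elim conjE)
    fix V Z :: "'a set" and \<delta> :: real assume "V \<in> cof" "finite Z" "0 < \<delta>"
    have "\<forall>\<^sub>F W in U. W \<in> cof \<and> W \<subseteq> V"
      using \<open>V \<in> cof\<close> by (intro filter_leD[OF U(2)]) (auto simp: eventually_cof_tails)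
    moreover have "\<forall>\<^sub>F W in U. \<forall>z\<in>Z. \<bar>blinfun_apply (F W) z - blinfun_apply g z\<bar> < \<delta>"
      using tendstoD[OF g(2) \<open>0 < \<delta>\<close>] \<open>finite Z\<close> by (intro eventually_ball_finite) (auto simp: dist_real_def)
    ultimately have "\<forall>\<^sub>F W in U. (W \<in> cof \<and> W \<subseteq> V) \<and> (\<forall>z\<in>Z. \<bar>blinfun_apply (F W) z - blinfun_apply g z\<bar> < \<delta>)"
      by (rule eventually_conj)
    then obtain W where "W \<in> cof" "W \<subseteq> V" "\<forall>z\<in>Z. \<bar>blinfun_apply (f W) z - blinfun_apply g z\<bar> < \<delta>"
      using eventually_happens'[OF ultrafilter_not_bot[OF U(1)]] unfolding F_def by fastforce
    then show "\<exists>x g'. x \<in> V \<and> norm x = 1 \<and> norm g' \<le> 1 \<and>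
        (\<forall>z\<in>Z. \<bar>blinfun_apply g' z - blinfun_apply g z\<bar> < \<delta>) \<and> winning R n (xs @ [x]) g'"
      using xf[of W] by blast
  qed
  then show ?case using g(1) by blast
qed

definition move_filter :: "('a::real_normed_vector set \<times> 'a set \<times> real) filter" where
  "move_filter = cof_tails \<times>\<^sub>F (finite_subsets_at_top UNIV \<times>\<^sub>F at_right 0)"

lemma move_filter_not_bot: "move_filter \<noteq> bot"
  by (simp add: move_filter_def prod_filter_eq_bot cof_tails_not_bot)

lemma eventually_move_filter:
  fixes V :: "'a::real_normed_vector set"
  assumes "V \<in> cof" "finite Z" "\<delta> > 0"
  shows "\<forall>\<^sub>F (W, Z', \<delta>') in move_filter. W \<in> cof \<and> W \<subseteq> V \<and> finite Z' \<and> Z \<subseteq> Z' \<and> 0 < \<delta>' \<and> \<delta>' < \<delta>"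
proof -
  have 1: "\<forall>\<^sub>F W in cof_tails. W \<in> cof \<and> W \<subseteq> V"
    using assms(1) by (auto simp: eventually_cof_tails)
  have 2: "\<forall>\<^sub>F Z' in finite_subsets_at_top UNIV. finite Z' \<and> Z \<subseteq> Z'"
    using assms(2) by (auto simp: eventually_finite_subsets_at_top intro!: exI[of _ Z])
  have 3: "\<forall>\<^sub>F \<delta>' in at_right 0. 0 < \<delta>' \<and> \<delta>' < \<delta>"
    using assms(3) by (auto simp: eventually_at_right intro: exI[of _ \<delta>])
  have "\<forall>\<^sub>F (Z', \<delta>') in finite_subsets_at_top UNIV \<times>\<^sub>F at_right 0. (finite Z' \<and> Z \<subseteq> Z') \<and> 0 < \<delta>' \<and> \<delta>' < \<delta>"
    unfolding eventually_prod_filter using 2 3 by fast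
  then show ?thesis unfolding move_filter_def eventually_prod_filter[of _ cof_tails]
    using 1 by fastforce
qed

lemma common_kernel_in_cof:
  "finite G \<Longrightarrow> {x. \<forall>g\<in>G. blinfun_apply (g :: 'a::real_normed_vector \<Rightarrow>\<^sub>L real) x = 0} \<in> cof"
proof (induction G rule: finite_induct)
  case empty
  then show ?case by (simp add: UNIV_in_cof)
next
  case (insert g G)
  have "{x. \<forall>h\<in>insert g G. blinfun_apply h x = 0} =
      {x. \<forall>h\<in>G. blinfun_apply h x = 0} \<inter> {x. blinfun_apply g x = 0}" by auto
  then show ?case using Int_kernel_in_cof[OF insert.IH] by simp
qed

text \<open>
  Answers in finitely many games are chosen one after the other, along an ultrafilter of moves. The move
  in game \<open>l\<close> depends on the answers in the games before it: the new vector is killed by the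
  functionals chosen so far, and the new functional is close, on the vectors chosen so far, to the
  old functional \<open>h l\<close>, which vanishes there. The sums over the sets in \<open>\<J>\<close> are sums of arrays,
  since in each game the answers are a fixed function of the move.
\<close>

lemma simultaneous_moves_nat:
  fixes h :: "nat \<Rightarrow> 'a::real_normed_vector \<Rightarrow>\<^sub>L real"
  assumes conc: "hamming_concentration TYPE('a set \<times> 'a set \<times> real) TYPE('a) 2 D"
    and win: "\<And>l. l < m \<Longrightarrow> winning R (Suc (r l)) (p l) (h l)"
    and fin: "finite Z" "finite H" "finite \<J>" and \<eta>: "\<eta> > 0" and hH: "\<And>l. l < m \<Longrightarrow> h l \<in> H"
  shows "\<exists>y h'. (\<forall>l<m. norm (h' l) \<le> 1 \<and> winning R (r l) (p l @ [y l]) (h' l) \<and>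
        (\<forall>g\<in>H. blinfun_apply g (y l) = 0) \<and>
        (\<forall>z\<in>Z. \<bar>blinfun_apply (h' l) z - blinfun_apply (h l) z\<bar> \<le> \<eta>) \<and>
        (\<forall>l'<m. l' \<noteq> l \<longrightarrow> \<bar>blinfun_apply (h' l') (y l)\<bar> \<le> \<eta>)) \<and>
      (\<forall>J\<in>\<J>. norm (\<Sum>l\<in>J \<inter> {..<m}. y l) \<le> D)"
proof -
  define good where "good l V Z \<delta> x g \<longleftrightarrow> x \<in> V \<and> norm x = 1 \<and> norm g \<le> 1 \<and>
      (\<forall>z\<in>Z. \<bar>blinfun_apply g z - blinfun_apply (h l) z\<bar> < \<delta>) \<and> winning R (r l) (p l @ [x]) g"
    for l V Z \<delta> x g
  have "\<forall>l V Z \<delta>. \<exists>x g. l < m \<and> V \<in> cof \<and> finite Z \<and> \<delta> > 0 \<longrightarrow> good l V Z \<delta> x g"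
    using win unfolding winning.simps good_def by blast
  then obtain X0 F where XF: "\<And>l V Z \<delta>. l < m \<Longrightarrow> V \<in> cof \<Longrightarrow> finite Z \<Longrightarrow> \<delta> > 0 \<Longrightarrow>
      good l V Z \<delta> (X0 l V Z \<delta>) (F l V Z \<delta>)"
    unfolding choice_iff by blast
  define X where "X l = (\<lambda>(V, Z, \<delta>). if l < m \<and> V \<in> cof \<and> finite Z \<and> \<delta> > 0 then X0 l V Z \<delta> else 0)" for l
  define Fn where "Fn l = (\<lambda>(V, Z, \<delta>). F l V Z \<delta>)" for l
  have X_norm: "norm (X l i) \<le> 1" for l i
    using XF[of l "fst i" "fst (snd i)" "snd (snd i)"] unfolding X_def good_def by (auto split: prod.splits)
  obtain U where U: "ultrafilter U" "U \<le> (move_filter :: ('a set \<times> 'a set \<times> real) filter)"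
    using ex_ultrafilter_le[OF move_filter_not_bot] by blast
  have typical: "\<forall>\<^sub>F i in U. norm (Fn l i) \<le> 1 \<and> winning R (r l) (p l @ [X l i]) (Fn l i) \<and>
      X l i \<in> V \<and> (\<forall>z\<in>Z. \<bar>blinfun_apply (Fn l i) z - blinfun_apply (h l) z\<bar> \<le> \<delta>)"
    if "l < m" "V \<in> cof" "finite Z" "\<delta> > 0" for l V Z \<delta>
  proof (rule eventually_mono[OF filter_leD[OF U(2) eventually_move_filter[OF that(2-4)]]], clarify)
    fix W Z' \<delta>' assume *: "W \<in> cof" "W \<subseteq> V" "finite Z'" "Z \<subseteq> Z'" "0 < \<delta>'" "\<delta>' < \<delta>"
    then have "good l W Z' \<delta>' (X l (W, Z', \<delta>')) (Fn l (W, Z', \<delta>'))"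
      using XF[of l W Z' \<delta>'] that(1) by (simp add: X_def Fn_def)
    then show "norm (Fn l (W, Z', \<delta>')) \<le> 1 \<and> winning R (r l) (p l @ [X l (W, Z', \<delta>')]) (Fn l (W, Z', \<delta>')) \<and>
      X l (W, Z', \<delta>') \<in> V \<and> (\<forall>z\<in>Z. \<bar>blinfun_apply (Fn l (W, Z', \<delta>')) z - blinfun_apply (h l) z\<bar> \<le> \<delta>)"
      using * unfolding good_def by force
  qed
  define nice where "nice l is i \<longleftrightarrow> norm (Fn l i) \<le> 1 \<and> winning R (r l) (p l @ [X l i]) (Fn l i) \<and>
      (\<forall>g\<in>H. blinfun_apply g (X l i) = 0) \<and>
      (\<forall>l'<l. blinfun_apply (Fn l' (is ! l')) (X l i) = 0) \<and>
      (\<forall>z\<in>Z. \<bar>blinfun_apply (Fn l i) z - blinfun_apply (h l) z\<bar> \<le> \<eta>) \<and>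
      (\<forall>l'<l. \<bar>blinfun_apply (Fn l i) (X l' (is ! l')) - blinfun_apply (h l) (X l' (is ! l'))\<bar> \<le> \<eta>)"
    for l "is" i
  have "\<forall>\<^sub>F is in iterated_filter U m. \<forall>l<m. length (take l is) < m \<longrightarrow> nice (length (take l is)) (take l is) (is ! l)"
  proof (rule eventually_iterated_filterI[where R = "\<lambda>is i. length is < m \<longrightarrow> nice (length is) is i"])
    fix "is" :: "('a set \<times> 'a set \<times> real) list" assume len: "length is < m"
    let ?l = "length is"
    \<comment> \<open>The constraints of the next move: the functionals and the vectors chosen so far.\<close>
    let ?V = "{x. \<forall>g\<in>H \<union> (\<lambda>l'. Fn l' (is ! l')) ` {..<?l}. blinfun_apply g x = 0}"
    let ?Z = "Z \<union> (\<lambda>l'. X l' (is ! l')) ` {..<?l}"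
    have "?V \<in> cof" by (rule common_kernel_in_cof) (use fin in simp)
    from typical[OF len this _ \<eta>, of ?Z] fin
    have "\<forall>\<^sub>F i in U. norm (Fn ?l i) \<le> 1 \<and> winning R (r ?l) (p ?l @ [X ?l i]) (Fn ?l i) \<and>
      X ?l i \<in> ?V \<and> (\<forall>z\<in>?Z. \<bar>blinfun_apply (Fn ?l i) z - blinfun_apply (h ?l) z\<bar> \<le> \<eta>)" by blast
    then show "\<forall>\<^sub>F i in U. ?l < m \<longrightarrow> nice ?l is i"
      by eventually_elim (auto simp: nice_def)
  qed
  moreover have "\<forall>\<^sub>F is in iterated_filter U m. \<forall>J\<in>\<J>. norm (\<Sum>l<m. if l \<in> J then X l (is ! l) else 0) \<le> D"
  proof (rule eventually_ball_finite[OF fin(3)], rule ballI)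
    fix J
    show "\<forall>\<^sub>F is in iterated_filter U m. norm (\<Sum>l<m. if l \<in> J then X l (is ! l) else 0) \<le> D"
    proof (rule array_upper_estimate[OF conc U(1), where x = "\<lambda>l i. if l \<in> J then X l i else 0"])
      show "norm (if l \<in> J then X l i else 0) \<le> 1" for l i using X_norm by simp
      show "\<forall>\<^sub>F i in U. (if l \<in> J then X l i else 0) \<in> V" if lV: "l < m" "V \<in> cof" for l V
        using typical[OF lV finite.emptyI zero_less_one]
        by eventually_elim (use cofD(1)[OF lV(2)] in \<open>auto simp: subspace_0\<close>)
    qed
  qed
  ultimately have "\<forall>\<^sub>F is in iterated_filter U m. length is = m \<and>
      (\<forall>l<m. length (take l is) < m \<longrightarrow> nice (length (take l is)) (take l is) (is ! l)) \<and>
      (\<forall>J\<in>\<J>. norm (\<Sum>l<m. if l \<in> J then X l (is ! l) else 0) \<le> D)"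
    by (intro eventually_conj eventually_iterated_filter_length)
  then obtain "is" where "is": "length is = m"
    "\<And>l. l < m \<Longrightarrow> length (take l is) < m \<longrightarrow> nice (length (take l is)) (take l is) (is ! l)"
    "\<And>J. J \<in> \<J> \<Longrightarrow> norm (\<Sum>l<m. if l \<in> J then X l (is ! l) else 0) \<le> D"
    using eventually_happens'[OF iterated_filter_not_bot[OF ultrafilter_not_bot[OF U(1)]]] by blast
  define y where "y l = X l (is ! l)" for l
  define h' where "h' l = Fn l (is ! l)" for l
  have nice: "norm (h' l) \<le> 1" "winning R (r l) (p l @ [y l]) (h' l)"
      "\<And>g. g \<in> H \<Longrightarrow> blinfun_apply g (y l) = 0"
      "\<And>l'. l' < l \<Longrightarrow> blinfun_apply (h' l') (y l) = 0"
      "\<And>z. z \<in> Z \<Longrightarrow> \<bar>blinfun_apply (h' l) z - blinfun_apply (h l) z\<bar> \<le> \<eta>"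
      "\<And>l'. l' < l \<Longrightarrow> \<bar>blinfun_apply (h' l) (y l') - blinfun_apply (h l) (y l')\<bar> \<le> \<eta>"
    if "l < m" for l
    using "is"(2)[OF that] "is"(1) that unfolding nice_def y_def h'_def by (auto simp: min_def)
  have "\<bar>blinfun_apply (h' l') (y l)\<bar> \<le> \<eta>" if l: "l < m" "l' < m" "l' \<noteq> l" for l l'
  proof (cases "l' < l")
    case True
    then show ?thesis using nice(4)[OF l(1)] \<eta> by simp
  next
    case False
    then have "l < l'" using l by simp
    then show ?thesis using nice(6)[OF l(2)] nice(3)[OF l(1) hH[OF l(2)]] by fastforce
  qed
  moreover have "norm (\<Sum>l\<in>J \<inter> {..<m}. y l) \<le> D" if "J \<in> \<J>" for J
  proof -
    have "(\<Sum>l\<in>J \<inter> {..<m}. y l) = (\<Sum>l<m. if l \<in> J then y l else 0)"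
      by (subst Int_commute) (simp add: sum.inter_restrict)
    then show ?thesis using "is"(3)[OF that] unfolding y_def by (simp only:)
  qed
  ultimately show ?thesis using nice by (intro exI[of _ y] exI[of _ h']) blast
qed

lemma simultaneous_moves:
  fixes h :: "'u \<Rightarrow> 'a::real_normed_vector \<Rightarrow>\<^sub>L real"
  assumes conc: "hamming_concentration TYPE('a set \<times> 'a set \<times> real) TYPE('a) 2 D"
    and A: "finite A"
    and win: "\<And>u. u \<in> A \<Longrightarrow> winning R (Suc (r u)) (p u) (h u)"
    and fin: "finite Z" "finite H" "finite \<J>" and \<J>: "\<And>J. J \<in> \<J> \<Longrightarrow> J \<subseteq> A"
    and \<eta>: "\<eta> > 0" and hH: "\<And>u. u \<in> A \<Longrightarrow> h u \<in> H"
  shows "\<exists>y h'. (\<forall>u\<in>A. norm (h' u) \<le> 1 \<and> winning R (r u) (p u @ [y u]) (h' u) \<and>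
        (\<forall>g\<in>H. blinfun_apply g (y u) = 0) \<and>
        (\<forall>z\<in>Z. \<bar>blinfun_apply (h' u) z - blinfun_apply (h u) z\<bar> \<le> \<eta>) \<and>
        (\<forall>u'\<in>A. u' \<noteq> u \<longrightarrow> \<bar>blinfun_apply (h' u') (y u)\<bar> \<le> \<eta>)) \<and>
      (\<forall>J\<in>\<J>. norm (\<Sum>u\<in>J. y u) \<le> D)"
proof -
  obtain e where e: "bij_betw e {0..<card A} A" using ex_bij_betw_nat_finite[OF A] by blast
  let ?m = "card A"
  let ?c = "inv_into {0..<?m} e"
  have eA: "e l \<in> A" if "l < ?m" for l using e that by (auto simp: bij_betw_def)
  have c: "?c u < ?m" "e (?c u) = u" if "u \<in> A" for u
    using e that bij_betw_inv_into_right[OF e that] inv_into_into[of u e "{0..<?m}"]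
    by (auto simp: bij_betw_def)
  have "\<exists>y h'. (\<forall>l<?m. norm (h' l) \<le> 1 \<and> winning R (r (e l)) (p (e l) @ [y l]) (h' l) \<and>
        (\<forall>g\<in>H. blinfun_apply g (y l) = 0) \<and>
        (\<forall>z\<in>Z. \<bar>blinfun_apply (h' l) z - blinfun_apply (h (e l)) z\<bar> \<le> \<eta>) \<and>
        (\<forall>l'<?m. l' \<noteq> l \<longrightarrow> \<bar>blinfun_apply (h' l') (y l)\<bar> \<le> \<eta>)) \<and>
      (\<forall>J\<in>(`) ?c ` \<J>. norm (\<Sum>l\<in>J \<inter> {..<?m}. y l) \<le> D)"
    by (rule simultaneous_moves_nat[OF conc win[OF eA] fin(1,2) finite_imageI[OF fin(3)] \<eta> hH[OF eA]])
  then obtain y h' where all: "\<forall>l<?m. norm (h' l) \<le> 1 \<and> winning R (r (e l)) (p (e l) @ [y l]) (h' l) \<and>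
        (\<forall>g\<in>H. blinfun_apply g (y l) = 0) \<and>
        (\<forall>z\<in>Z. \<bar>blinfun_apply (h' l) z - blinfun_apply (h (e l)) z\<bar> \<le> \<eta>) \<and>
        (\<forall>l'<?m. l' \<noteq> l \<longrightarrow> \<bar>blinfun_apply (h' l') (y l)\<bar> \<le> \<eta>)"
    and sums: "\<forall>J\<in>(`) ?c ` \<J>. norm (\<Sum>l\<in>J \<inter> {..<?m}. y l) \<le> D"
    by (elim exE conjE) (rule that)
  note yh = all[THEN spec, THEN mp]
  have "norm (\<Sum>u\<in>J. y (?c u)) \<le> D" if J: "J \<in> \<J>" for J
  proof -
    have "inj_on ?c J" using \<J>[OF J] c by (intro inj_onI) (metis subsetD)
    then have "(\<Sum>u\<in>J. y (?c u)) = (\<Sum>l\<in>?c ` J. y l)" by (simp add: sum.reindex)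
    moreover have "?c ` J \<inter> {..<?m} = ?c ` J" using \<J>[OF J] c by auto
    ultimately show ?thesis using bspec[OF sums imageI[OF J]] by simp
  qed
  moreover have "\<bar>blinfun_apply (h' (?c u')) (y (?c u))\<bar> \<le> \<eta>" if "u \<in> A" "u' \<in> A" "u' \<noteq> u" for u u'
  proof -
    have "?c u' \<noteq> ?c u" using c that by metis
    then show ?thesis using yh[OF c(1)[OF that(1)]] c(1)[OF that(2)] by blast
  qed
  moreover have "norm (h' (?c u)) \<le> 1 \<and> winning R (r u) (p u @ [y (?c u)]) (h' (?c u)) \<and>
        (\<forall>g\<in>H. blinfun_apply g (y (?c u)) = 0) \<and>
        (\<forall>z\<in>Z. \<bar>blinfun_apply (h' (?c u)) z - blinfun_apply (h u) z\<bar> \<le> \<eta>)" if "u \<in> A" for u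
    using yh[OF c(1)[OF that]] c(2)[OF that] by simp
  ultimately show ?thesis by (intro exI[of _ "\<lambda>u. y (?c u)"] exI[of _ "\<lambda>u. h' (?c u)"]) blast
qed

section \<open>A biorthogonal tree of winning positions\<close>

type_synonym 'a position = "'a list \<times> ('a \<Rightarrow>\<^sub>L real)"

text \<open>
  The nodes of the tree are finite sets of natural numbers. The ancestors of a node are its initial
  segments, and a node is created at the time that is its maximum. The position at a node consists of the vectors along
  its branch and the current functional, so the vector of the node itself is the last of the list.
\<close>

definition valid_positions ::
  "('a::real_normed_vector list \<Rightarrow> ('a \<Rightarrow>\<^sub>L real) \<Rightarrow> bool) \<Rightarrow> nat \<Rightarrow> nat \<Rightarrow> (nat set \<Rightarrow> 'a position) \<Rightarrow> bool" where
  "valid_positions R k n s \<longleftrightarrow> (\<forall>S. S \<subseteq> {..<n} \<and> card S \<le> k \<longrightarrow>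
     length (fst (s S)) = card S \<and> norm (snd (s S)) \<le> 1 \<and>
     winning R (k - card S) (fst (s S)) (snd (s S)))"

definition tree_level :: "nat \<Rightarrow> nat \<Rightarrow> nat set set" where
  "tree_level n i = {u. u \<subseteq> {..<n} \<and> card u = i}"

text \<open>
  The assignment \<open>s'\<close> extends \<open>s\<close> by one child \<open>insert n u\<close> for every node \<open>u\<close> of height less than
  \<open>k\<close>. New vectors are annihilated by old functionals; new functionals almost agree with those of
  their parents on old vectors and almost vanish on the other new vectors.
\<close>

definition stage ::
  "nat \<Rightarrow> real \<Rightarrow> real \<Rightarrow> nat \<Rightarrow> (nat set \<Rightarrow> 'a::real_normed_vector position) \<Rightarrow> (nat set \<Rightarrow> 'a position) \<Rightarrow> bool" where
  "stage k D \<eta> n s s' \<longleftrightarrow>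
     (\<forall>S. S \<subseteq> {..<n} \<longrightarrow> s' S = s S) \<and>
     (\<forall>u. u \<subseteq> {..<n} \<and> card u < k \<longrightarrow>
        fst (s' (insert n u)) = fst (s u) @ [last (fst (s' (insert n u)))] \<and>
        (\<forall>S. S \<subseteq> {..<n} \<longrightarrow> blinfun_apply (snd (s S)) (last (fst (s' (insert n u)))) = 0) \<and>
        (\<forall>S. S \<subseteq> {..<n} \<longrightarrow> \<bar>blinfun_apply (snd (s' (insert n u))) (last (fst (s S)))
            - blinfun_apply (snd (s u)) (last (fst (s S)))\<bar> \<le> \<eta>) \<and>
        (\<forall>u'. u' \<subseteq> {..<n} \<and> card u' < k \<and> u' \<noteq> u \<longrightarrow>
          \<bar>blinfun_apply (snd (s' (insert n u'))) (last (fst (s' (insert n u))))\<bar> \<le> \<eta>)) \<and>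
     (\<forall>i<k. norm (\<Sum>u\<in>tree_level n i. last (fst (s' (insert n u)))) \<le> D)"

lemma finite_tree_level: "finite (tree_level n i)"
  unfolding tree_level_def by (rule finite_subset[of _ "Pow {..<n}"]) auto

lemma card_tree_level_le: "card (tree_level n i) \<le> 2 ^ n"
proof -
  have "card (tree_level n i) \<le> card (Pow {..<n})"
    unfolding tree_level_def by (intro card_mono) auto
  then show ?thesis by (simp add: card_Pow)
qed

lemma ex_next_stage:
  fixes s :: "nat set \<Rightarrow> 'a::real_normed_vector position"
  assumes conc: "hamming_concentration TYPE('a set \<times> 'a set \<times> real) TYPE('a) 2 D"
    and valid: "valid_positions R k n s" and \<eta>: "\<eta> > 0"
  shows "\<exists>s'. valid_positions R k (Suc n) s' \<and> stage k D \<eta> n s s'"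
proof -
  let ?A = "{u. u \<subseteq> {..<n} \<and> card u < k}"
  let ?Z = "(\<lambda>S. last (fst (s S))) ` Pow {..<n}" and ?H = "(\<lambda>S. snd (s S)) ` Pow {..<n}"
  let ?J = "tree_level n ` {..<k}"
  let ?r = "\<lambda>u :: nat set. k - Suc (card u)"
  have "finite ?A" by (rule finite_subset[of _ "Pow {..<n}"]) auto
  moreover have "winning R (Suc (?r u)) (fst (s u)) (snd (s u))" if "u \<in> ?A" for u
  proof -
    have "Suc (?r u) = k - card u" using that by auto
    then show ?thesis using valid that unfolding valid_positions_def by auto
  qed
  ultimately have "\<exists>y h'. (\<forall>u\<in>?A. norm (h' u) \<le> 1 \<and> winning R (?r u) (fst (s u) @ [y u]) (h' u) \<and>
        (\<forall>g\<in>?H. blinfun_apply g (y u) = 0) \<and>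
        (\<forall>z\<in>?Z. \<bar>blinfun_apply (h' u) z - blinfun_apply (snd (s u)) z\<bar> \<le> \<eta>) \<and>
        (\<forall>u'\<in>?A. u' \<noteq> u \<longrightarrow> \<bar>blinfun_apply (h' u') (y u)\<bar> \<le> \<eta>)) \<and>
      (\<forall>J\<in>?J. norm (\<Sum>u\<in>J. y u) \<le> D)"
    using \<eta> by (intro simultaneous_moves[OF conc]) (auto simp: tree_level_def)
  then obtain y h' where all: "\<forall>u\<in>?A. norm (h' u) \<le> 1 \<and> winning R (?r u) (fst (s u) @ [y u]) (h' u) \<and>
        (\<forall>g\<in>?H. blinfun_apply g (y u) = 0) \<and>
        (\<forall>z\<in>?Z. \<bar>blinfun_apply (h' u) z - blinfun_apply (snd (s u)) z\<bar> \<le> \<eta>) \<and>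
        (\<forall>u'\<in>?A. u' \<noteq> u \<longrightarrow> \<bar>blinfun_apply (h' u') (y u)\<bar> \<le> \<eta>)"
    and sums: "\<forall>J\<in>?J. norm (\<Sum>u\<in>J. y u) \<le> D"
    by (elim exE conjE) (rule that)
  have move: "norm (h' u) \<le> 1" "winning R (?r u) (fst (s u) @ [y u]) (h' u)"
      "\<And>S. S \<subseteq> {..<n} \<Longrightarrow> blinfun_apply (snd (s S)) (y u) = 0"
      "\<And>S. S \<subseteq> {..<n} \<Longrightarrow> \<bar>blinfun_apply (h' u) (last (fst (s S))) - blinfun_apply (snd (s u)) (last (fst (s S)))\<bar> \<le> \<eta>"
      "\<And>u'. u' \<subseteq> {..<n} \<Longrightarrow> card u' < k \<Longrightarrow> u' \<noteq> u \<Longrightarrow> \<bar>blinfun_apply (h' u') (y u)\<bar> \<le> \<eta>"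
    if "u \<subseteq> {..<n}" "card u < k" for u
  proof -
    have "u \<in> ?A" using that by simp
    note * = bspec[OF all this]
    show "norm (h' u) \<le> 1" using * by (elim conjE)
    show "winning R (?r u) (fst (s u) @ [y u]) (h' u)" using * by (elim conjE)
    show "blinfun_apply (snd (s S)) (y u) = 0" if "S \<subseteq> {..<n}" for S
      using * that by auto
    show "\<bar>blinfun_apply (h' u) (last (fst (s S))) - blinfun_apply (snd (s u)) (last (fst (s S)))\<bar> \<le> \<eta>"
      if "S \<subseteq> {..<n}" for S
      using * that by auto
    show "\<bar>blinfun_apply (h' u') (y u)\<bar> \<le> \<eta>" if "u' \<subseteq> {..<n}" "card u' < k" "u' \<noteq> u" for u'
      using * that by auto
  qed
  define s' where "s' S = (if n \<in> S \<and> S - {n} \<in> ?A then (fst (s (S - {n})) @ [y (S - {n})], h' (S - {n})) else s S)" for S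
  have new: "s' (insert n u) = (fst (s u) @ [y u], h' u)" if "u \<subseteq> {..<n}" "card u < k" for u
  proof -
    have "insert n u - {n} = u" using that by auto
    then show ?thesis using that by (simp add: s'_def)
  qed
  have old: "s' S = s S" if "S \<subseteq> {..<n}" for S
    using that by (auto simp: s'_def)
  have "valid_positions R k (Suc n) s'"
    unfolding valid_positions_def
  proof (intro allI impI)
    fix S assume S: "S \<subseteq> {..<Suc n} \<and> card S \<le> k"
    show "length (fst (s' S)) = card S \<and> norm (snd (s' S)) \<le> 1 \<and> winning R (k - card S) (fst (s' S)) (snd (s' S))"
    proof (cases "n \<in> S")
      case True
      define u where "u = S - {n}"
      have u: "S = insert n u" "n \<notin> u" "u \<subseteq> {..<n}" using True S by (auto simp: u_def)
      have "finite u" using u(3) finite_subset by blast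
      then have card: "card S = Suc (card u)" using u by simp
      then have uk: "card u < k" using S by simp
      have "length (fst (s u)) = card u" using valid u(3) uk unfolding valid_positions_def by auto
      then show ?thesis unfolding u(1) new[OF u(3) uk] using move(1,2)[OF u(3) uk] card u(1) by simp
    next
      case False
      then have "S \<subseteq> {..<n}" using S by (auto simp: less_Suc_eq)
      then show ?thesis using S valid old unfolding valid_positions_def by simp
    qed
  qed
  moreover have "norm (\<Sum>u\<in>tree_level n i. last (fst (s' (insert n u)))) \<le> D" if "i < k" for i
  proof -
    have "(\<Sum>u\<in>tree_level n i. last (fst (s' (insert n u)))) = (\<Sum>u\<in>tree_level n i. y u)"
      using that by (intro sum.cong) (auto simp: tree_level_def new)
    then show ?thesis using sums that by auto
  qed
  then have "stage k D \<eta> n s s'"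
    unfolding stage_def using move(3-5) by (simp add: new old)
  ultimately show ?thesis by blast
qed

text \<open>
  The stages stabilize, since each of them only adds nodes that contain its own number.
\<close>

lemma ex_biorthogonal_tree:
  fixes f0 :: "'a::real_normed_vector \<Rightarrow>\<^sub>L real"
  assumes conc: "hamming_concentration TYPE('a set \<times> 'a set \<times> real) TYPE('a) 2 D"
    and f0: "norm f0 \<le> 1" "winning R k [] f0" and \<eta>: "\<And>n. \<eta> n > 0"
  shows "\<exists>t. \<forall>n. valid_positions R k n t \<and> stage k D (\<eta> n) n t t"
proof -
  have "\<exists>st. \<forall>n. valid_positions R k n (st n) \<and> stage k D (\<eta> n) n (st n) (st (Suc n))"
  proof (rule dependent_nat_choice)
    show "\<exists>s. valid_positions R k 0 s"
      using f0 by (intro exI[of _ "\<lambda>_. ([], f0)"]) (auto simp: valid_positions_def)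
    show "\<exists>s'. valid_positions R k (Suc n) s' \<and> stage k D (\<eta> n) n s s'" if "valid_positions R k n s" for s n
      using ex_next_stage[OF conc that \<eta>] .
  qed
  then obtain st where st: "\<And>n. valid_positions R k n (st n)" "\<And>n. stage k D (\<eta> n) n (st n) (st (Suc n))"
    by blast
  have agree: "st b S = st a S" if "a \<le> b" "S \<subseteq> {..<a}" for a b S
    using that(1)
  proof (induction rule: dec_induct)
    case (step b)
    then have "S \<subseteq> {..<b}" using that(2) by auto
    then show ?case using st(2)[of b] step.IH unfolding stage_def by simp
  qed simp
  define t where "t S = st (Suc (Max (insert 0 S))) S" for S
  have t: "t S = st n S" if "S \<subseteq> {..<n}" for S n
  proof -
    let ?N = "Suc (Max (insert 0 S))"
    have "finite S" using that finite_subset by blast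
    then have "S \<subseteq> {..<?N}" by (auto simp: less_Suc_eq_le)
    then show ?thesis unfolding t_def using that agree by (cases "n \<le> ?N") (metis nat_le_linear)+
  qed
  have t_new: "t (insert n u) = st (Suc n) (insert n u)" if "u \<subseteq> {..<n}" for u n
    using that by (intro t) (auto simp: less_Suc_eq)
  have "valid_positions R k n t" for n
    using st(1)[of n] unfolding valid_positions_def by (simp add: t[of _ n])
  moreover have "stage k D (\<eta> n) n t t" for n
  proof -
    have "(\<Sum>u\<in>tree_level n i. last (fst (t (insert n u)))) = (\<Sum>u\<in>tree_level n i. last (fst (st (Suc n) (insert n u))))" for i
      by (intro sum.cong) (auto simp: tree_level_def t_new)
    then show ?thesis using st(2)[of n] unfolding stage_def by (simp add: t[of _ n] t_new)
  qed
  ultimately show ?thesis by blast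
qed

section \<open>Concentration implies the asymptotic-\<open>c\<^sub>0\<close> property\<close>

text \<open>
  Let \<open>y S\<close> and \<open>F S\<close> be the vector and the functional of the node \<open>S\<close>, and let \<open>S j\<close> be the set of
  the first \<open>j\<close> entries of a typical increasing sequence \<open>ns\<close>. The functional \<open>F (S k)\<close> is at least
  \<open>K\<close> on the branch sum, almost annihilates the other nodes of the levels \<open>Y i (ns ! i)\<close>, and
  annihilates all nodes that are created later. So it separates the values of \<open>g\<close> at \<open>ns\<close> and at a
  later sequence \<open>ms\<close> by almost \<open>K\<close>.
\<close>

lemma winning_bounded_by_concentration:
  fixes f0 :: "'a::real_normed_vector \<Rightarrow>\<^sub>L real" and a :: "nat \<Rightarrow> real"
  assumes conc1: "hamming_concentration TYPE('a set \<times> 'a set \<times> real) TYPE('a) 2 D"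
    and conc2: "hamming_concentration TYPE(nat) TYPE('a) (2 * D) E"
    and k: "k \<ge> 1" and a: "\<And>i. i < k \<Longrightarrow> \<bar>a i\<bar> \<le> 1"
    and f0: "norm f0 \<le> 1" "winning (\<lambda>xs f. K \<le> blinfun_apply f (\<Sum>i<k. a i *\<^sub>R xs ! i)) k [] f0"
  shows "K \<le> E + 1"
proof -
  let ?R = "\<lambda>xs f. K \<le> blinfun_apply f (\<Sum>i<k. a i *\<^sub>R xs ! i)"
  \<comment> \<open>Each of the \<open>k\<close> levels has at most \<open>2 ^ n\<close> nodes created at time \<open>n\<close>, and each of them contributes at most \<open>k \<eta> n\<close>.
      So the total error is at most \<open>1\<close>.\<close>
  define \<eta> :: "nat \<Rightarrow> real" where "\<eta> n = 1 / (real k * real k * 2 ^ n)" for n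
  have \<eta>: "\<eta> n > 0" for n using k by (simp add: \<eta>_def)
  have \<eta>_mono: "\<eta> n \<le> \<eta> m" if "m \<le> n" for m n
    unfolding \<eta>_def using k that by (intro divide_left_mono mult_left_mono power_increasing) auto
  obtain t :: "nat set \<Rightarrow> 'a position" where
    valid: "\<And>n. valid_positions ?R k n t" and stage: "\<And>n. stage k D (\<eta> n) n t t"
    using ex_biorthogonal_tree[where \<eta> = \<eta>, OF conc1 f0 \<eta>] by blast
  define y where "y S = last (fst (t S))" for S
  define F where "F S = snd (t S)" for S
  have branch: "fst (t (insert n u)) = fst (t u) @ [y (insert n u)]" if "u \<subseteq> {..<n}" "card u < k" for n u
    using stage[of n] that unfolding stage_def y_def by blast
  have later: "blinfun_apply (F S) (y (insert n u)) = 0" if "S \<subseteq> {..<n}" "u \<subseteq> {..<n}" "card u < k" for S n u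
    using stage[of n] that unfolding stage_def y_def F_def by blast
  have close: "\<bar>blinfun_apply (F (insert n u)) (y S) - blinfun_apply (F u) (y S)\<bar> \<le> \<eta> n"
    if "S \<subseteq> {..<n}" "u \<subseteq> {..<n}" "card u < k" for S n u
    using stage[of n] that unfolding stage_def y_def F_def by blast
  have sibling: "\<bar>blinfun_apply (F (insert n u')) (y (insert n u))\<bar> \<le> \<eta> n"
    if "u \<subseteq> {..<n}" "card u < k" "u' \<subseteq> {..<n}" "card u' < k" "u' \<noteq> u" for n u u'
    using stage[of n] that unfolding stage_def y_def F_def by blast
  have level: "norm (\<Sum>u\<in>tree_level n i. y (insert n u)) \<le> D" if "i < k" for n i
    using stage[of n] that unfolding stage_def y_def by blast
  define Y where "Y i n = (\<Sum>u\<in>tree_level n i. y (insert n u))" for i n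
  let ?g = "\<lambda>ns. \<Sum>i<k. a i *\<^sub>R Y i (ns ! i)"
  obtain U :: "nat filter" where U: "ultrafilter U" "U \<le> sequentially"
    using ex_ultrafilter_le[OF sequentially_bot] by blast
  note nb = iterated_filter_not_bot[OF ultrafilter_not_bot[OF U(1)], of k]
  have "hamming_lipschitz k (2 * D) ?g"
  proof (rule hamming_lipschitz_array_sum[where x = "\<lambda>i n. a i *\<^sub>R Y i n"])
    fix i n assume i: "i < k"
    have "\<bar>a i\<bar> * norm (Y i n) \<le> 1 * norm (Y i n)" using a[OF i] by (intro mult_right_mono) auto
    then show "norm (a i *\<^sub>R Y i n) \<le> D" using level[OF i, of n] by (simp add: Y_def)
  qed
  note ev = hamming_concentrationD[OF conc2 U(1) this]
  have later_indices: "\<forall>\<^sub>F n in U. \<forall>m\<in>set ms. m < n" for ms :: "nat list"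
    by (rule filter_leD[OF U(2)], rule eventually_ball_finite) (auto intro: eventually_gt_at_top)
  have increasing: "\<forall>\<^sub>F ns in iterated_filter U k. \<forall>i<k. \<forall>m\<in>set (take i ns). m < ns ! i"
    by (rule eventually_iterated_filterI[where R = "\<lambda>ns n. \<forall>m\<in>set ns. m < n"]) (rule later_indices)
  have "\<exists>ns. length ns = k \<and> (\<forall>i<k. \<forall>m\<in>set (take i ns). m < ns ! i) \<and>
      (\<forall>\<^sub>F ms in iterated_filter U k. norm (?g ns - ?g ms) \<le> E)"
    using eventually_happens'[OF nb eventually_conj[OF eventually_iterated_filter_length eventually_conj[OF increasing ev]]] .
  then obtain ns where ns: "length ns = k" "\<And>i m. i < k \<Longrightarrow> m \<in> set (take i ns) \<Longrightarrow> m < ns ! i"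
    and ev2: "\<forall>\<^sub>F ms in iterated_filter U k. norm (?g ns - ?g ms) \<le> E" by blast
  have beyond: "\<forall>\<^sub>F ms in iterated_filter U k. \<forall>i<k. \<forall>m\<in>set ns. m < ms ! i"
    by (rule eventually_iterated_filterI[where R = "\<lambda>_ n. \<forall>m\<in>set ns. m < n"]) (rule later_indices)
  obtain ms where ms: "norm (?g ns - ?g ms) \<le> E" "\<And>i m. i < k \<Longrightarrow> m \<in> set ns \<Longrightarrow> m < ms ! i"
    using eventually_happens'[OF nb eventually_conj[OF ev2 beyond]] by blast
  define S where "S j = set (take j ns)" for j
  have S_Suc: "S (Suc j) = insert (ns ! j) (S j)" if "j < k" for j
    unfolding S_def using that ns(1) by (simp add: take_Suc_conv_app_nth)
  have S_below: "S j \<subseteq> {..<ns ! j}" if "j < k" for j using ns(2)[OF that] by (auto simp: S_def)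
  have S_card: "card (S j) = j" if "j \<le> k" for j
    using that
  proof (induction j)
    case (Suc j)
    then have "ns ! j \<notin> S j" "finite (S j)" using S_below[of j] by (auto simp: S_def)
    then show ?case using Suc by (simp add: S_Suc)
  qed (simp add: S_def)
  have ns_mono: "ns ! i < ns ! j" if "i < j" "j < k" for i j
  proof -
    have "ns ! i \<in> S j" using that ns(1) by (auto simp: S_def in_set_conv_nth intro!: exI[of _ i])
    then show ?thesis using S_below[OF that(2)] by auto
  qed
  let ?F = "F (S k)"
  have valid_k: "length (fst (t (S j))) = j" "norm (F (S j)) \<le> 1" if "j \<le> k" for j
  proof -
    have "S j \<subseteq> {..<Suc (Max (insert 0 (S j)))}" by (auto simp: S_def less_Suc_eq_le)
    then show "length (fst (t (S j))) = j" "norm (F (S j)) \<le> 1"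
      using valid[of "Suc (Max (insert 0 (S j)))"] S_card[OF that] that
      unfolding valid_positions_def F_def by auto
  qed
  have pos_S: "fst (t (S j)) = map (\<lambda>i. y (S (Suc i))) [0..<j]" if "j \<le> k" for j
    using that
  proof (induction j)
    case 0
    then show ?case using valid_k(1)[of 0] by simp
  next
    case (Suc j)
    then show ?case using branch[OF S_below, of j] S_card[of j] by (simp add: S_Suc)
  qed
  have "?R (fst (t (S k))) (F (S k))"
  proof -
    have "S k \<subseteq> {..<Suc (Max (insert 0 (S k)))}" by (auto simp: S_def less_Suc_eq_le)
    then have "winning ?R (k - card (S k)) (fst (t (S k))) (snd (t (S k)))"
      using valid[of "Suc (Max (insert 0 (S k)))"] S_card[of k] unfolding valid_positions_def by auto
    then show ?thesis using S_card[of k] by (simp add: F_def)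
  qed
  then have K: "K \<le> (\<Sum>i<k. a i * blinfun_apply ?F (y (S (Suc i))))"
    using pos_S[of k] by (simp add: blinfun.sum_right blinfun.scaleR_right)
  \<comment> \<open>The functional of the node \<open>S (Suc i)\<close> is small on the siblings of this node, and each further step along the
      branch changes the values on existing nodes only a little.\<close>
  have off: "\<bar>blinfun_apply (F (S j)) (y (insert (ns ! i) u))\<bar> \<le> real (j - i) * \<eta> (ns ! i)"
    if i: "i < k" and u: "u \<in> tree_level (ns ! i) i" "u \<noteq> S i" and j: "Suc i \<le> j" "j \<le> k" for i u j
    using j
  proof (induction j rule: dec_induct)
    case base
    then show ?case unfolding S_Suc[OF i]
      using sibling[of u "ns ! i" "S i"] u S_below[OF i] S_card[of i] i by (auto simp: tree_level_def)
  next
    case (step j)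
    have "insert (ns ! i) u \<subseteq> {..<ns ! j}"
      using ns_mono[of i j] step u(1) by (fastforce simp: tree_level_def)
    then have "\<bar>blinfun_apply (F (S (Suc j))) (y (insert (ns ! i) u)) - blinfun_apply (F (S j)) (y (insert (ns ! i) u))\<bar> \<le> \<eta> (ns ! j)"
      using step S_below[of j] S_card[of j] close[of "insert (ns ! i) u" "ns ! j" "S j"] by (simp add: S_Suc)
    moreover have "\<eta> (ns ! j) \<le> \<eta> (ns ! i)" using ns_mono[of i j] step by (intro \<eta>_mono) simp
    moreover have "real (Suc j - i) * \<eta> (ns ! i) = real (j - i) * \<eta> (ns ! i) + \<eta> (ns ! i)"
      using step by (simp add: Suc_diff_le algebra_simps)
    ultimately show ?case using step by linarith
  qed
  have main: "\<bar>a i * blinfun_apply ?F (Y i (ns ! i)) - a i * blinfun_apply ?F (y (S (Suc i)))\<bar> \<le> 1 / k" if i: "i < k" for i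
  proof -
    let ?T = "tree_level (ns ! i) i"
    have Si: "S i \<in> ?T" using S_below[OF i] S_card[of i] i by (simp add: tree_level_def)
    have "blinfun_apply ?F (Y i (ns ! i)) - blinfun_apply ?F (y (S (Suc i))) =
        (\<Sum>u\<in>?T - {S i}. blinfun_apply ?F (y (insert (ns ! i) u)))"
      unfolding Y_def blinfun.sum_right S_Suc[OF i] using Si finite_tree_level by (simp add: sum_diff1)
    also have "\<bar>\<dots>\<bar> \<le> (\<Sum>u\<in>?T - {S i}. real k * \<eta> (ns ! i))"
    proof (intro order_trans[OF sum_abs] sum_mono)
      fix u assume u: "u \<in> ?T - {S i}"
      have "\<bar>blinfun_apply ?F (y (insert (ns ! i) u))\<bar> \<le> real (k - i) * \<eta> (ns ! i)"
        using u i by (intro off) auto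
      also have "\<dots> \<le> real k * \<eta> (ns ! i)" using \<eta>[of "ns ! i"] by (intro mult_right_mono) auto
      finally show "\<bar>blinfun_apply ?F (y (insert (ns ! i) u))\<bar> \<le> real k * \<eta> (ns ! i)" .
    qed
    also have "\<dots> = real (card (?T - {S i})) * (real k * \<eta> (ns ! i))" by simp
    also have "\<dots> \<le> 2 ^ (ns ! i) * (real k * \<eta> (ns ! i))"
    proof (rule mult_right_mono)
      have "card (?T - {S i}) \<le> 2 ^ (ns ! i)"
        using card_tree_level_le[of "ns ! i" i] card_mono[OF finite_tree_level, of "?T - {S i}"] by (meson Diff_subset order_trans)
      then show "real (card (?T - {S i})) \<le> 2 ^ (ns ! i)" by (simp flip: of_nat_le_iff)
      show "0 \<le> real k * \<eta> (ns ! i)" using \<eta>[of "ns ! i"] by simp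
    qed
    also have "\<dots> = 1 / k" using k by (simp add: \<eta>_def)
    finally have "\<bar>blinfun_apply ?F (Y i (ns ! i)) - blinfun_apply ?F (y (S (Suc i)))\<bar> \<le> 1 / k" .
    moreover have "\<bar>a i * blinfun_apply ?F (Y i (ns ! i)) - a i * blinfun_apply ?F (y (S (Suc i)))\<bar> \<le>
        1 * \<bar>blinfun_apply ?F (Y i (ns ! i)) - blinfun_apply ?F (y (S (Suc i)))\<bar>"
      unfolding right_diff_distrib[symmetric] abs_mult using a[OF i] by (intro mult_right_mono) auto
    ultimately show ?thesis unfolding mult_1_left by (rule order_trans[rotated])
  qed
  have "blinfun_apply ?F (?g ms) = 0"
  proof -
    have "blinfun_apply ?F (Y i (ms ! i)) = 0" if "i < k" for i
      unfolding Y_def blinfun.sum_right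
    proof (rule sum.neutral, rule ballI)
      fix u assume "u \<in> tree_level (ms ! i) i"
      moreover have "S k \<subseteq> {..<ms ! i}" using ms(2)[OF that] ns(1) by (auto simp: S_def)
      ultimately show "blinfun_apply ?F (y (insert (ms ! i) u)) = 0"
        using that by (intro later) (auto simp: tree_level_def)
    qed
    then show ?thesis by (simp add: blinfun.sum_right blinfun.scaleR_right)
  qed
  then have "blinfun_apply ?F (?g ns) = blinfun_apply ?F (?g ns - ?g ms)" by (simp add: blinfun.diff_right)
  also have "\<dots> \<le> E" using norm_blinfun_le_1[OF valid_k(2)[of k], of "?g ns - ?g ms"] ms(1) by simp
  finally have "(\<Sum>i<k. a i * blinfun_apply ?F (Y i (ns ! i))) \<le> E"
    by (simp add: blinfun.sum_right blinfun.scaleR_right)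
  moreover have "(\<Sum>i<k. a i * blinfun_apply ?F (y (S (Suc i)))) \<le>
      (\<Sum>i<k. a i * blinfun_apply ?F (Y i (ns ! i)) + 1 / k)"
    using main by (intro sum_mono) (force simp: abs_le_iff)
  moreover have "(\<Sum>i<k. a i * blinfun_apply ?F (Y i (ns ! i)) + 1 / k) = (\<Sum>i<k. a i * blinfun_apply ?F (Y i (ns ! i))) + 1"
    using k by (simp add: sum.distrib)
  ultimately show ?thesis using K by linarith
qed

lemma monotone_norm_coefficient:
  assumes N: "N \<in> normalized_monotone_norms k" and j: "j < k"
  shows "\<bar>a j\<bar> \<le> 2 * N (\<Sum>i<k. a i *\<^sub>R unit_vec i)"
proof -
  have N1: "norm_on (Rn k) N" "N (unit_vec j) = 1"
    and mono: "\<And>m. m \<le> k \<Longrightarrow> N (\<Sum>i<m. a i *\<^sub>R unit_vec i) \<le> N (\<Sum>i<k. a i *\<^sub>R unit_vec i)"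
    using N j unfolding normalized_monotone_norms_def by auto
  let ?P = "\<lambda>m. \<Sum>i<m. a i *\<^sub>R unit_vec i"
  have in_Rn: "?P m \<in> Rn k" if "m \<le> k" for m
    using that by (auto simp: Rn_def in_keys_iff lookup_sum_unit_vec split: if_splits)
  have u: "unit_vec j \<in> Rn k" using j by (simp add: Rn_def unit_vec_def)
  have neg: "(- 1) *\<^sub>R ?P j \<in> Rn k"
    using j by (auto simp: Rn_def in_keys_iff lookup_sum_unit_vec split: if_splits)
  have triangle: "N (v + w) \<le> N v + N w" if "v \<in> Rn k" "w \<in> Rn k" for v w
    using N1(1) that unfolding norm_on_def by blast
  have "\<bar>a j\<bar> = N (a j *\<^sub>R unit_vec j)" using N1 u unfolding norm_on_def by simp
  also have "a j *\<^sub>R unit_vec j = ?P (Suc j) + (- 1) *\<^sub>R ?P j" by simp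
  also have "N \<dots> \<le> N (?P (Suc j)) + N ((- 1) *\<^sub>R ?P j)"
    using j by (intro triangle in_Rn neg) simp
  also have "N ((- 1) *\<^sub>R ?P j) = \<bar>- 1\<bar> * N (?P j)"
    using N1(1) in_Rn[of j] j unfolding norm_on_def by (meson less_imp_le)
  finally show ?thesis using mono[of j] mono[of "Suc j"] j by simp
qed

text \<open>
  Branches that are \<open>2\<close>-equivalent to the basis of the given norm suffice, so the norm can be
  replaced by that of \<open>X\<close> at the cost of a factor \<open>2\<close>.
\<close>

lemma asymptotic_structure_bounded_by_concentration:
  fixes a :: "nat \<Rightarrow> real"
  assumes conc1: "hamming_concentration TYPE('a::real_normed_vector set \<times> 'a set \<times> real) TYPE('a) 2 D"
    and conc2: "hamming_concentration TYPE(nat) TYPE('a) (2 * D) E"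
    and k: "k \<ge> 1" and N: "N \<in> asymptotic_structure TYPE('a) k" and a: "\<And>i. i < k \<Longrightarrow> \<bar>a i\<bar> \<le> 1"
  shows "N (\<Sum>i<k. a i *\<^sub>R unit_vec i) \<le> 2 * (E + 1)"
proof -
  let ?v = "\<Sum>i<k. a i *\<^sub>R unit_vec i"
  let ?eq = "\<lambda>xs :: 'a list. equivalent_seqs 2 k norm (\<lambda>i. xs ! i) N unit_vec"
  let ?R = "\<lambda>xs f. N ?v / 2 \<le> blinfun_apply f (\<Sum>i<k. a i *\<^sub>R xs ! i)"
  have N1: "N (unit_vec 0) = 1" using N k by (auto simp: asymptotic_structure_def normalized_monotone_norms_def)
  have "cof_game k ?eq []"
    using N unfolding asymptotic_structure_def by (auto dest!: spec[of _ "1 :: real"])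
  then have "frequently ?eq (iterated_filter deep_sphere k)" by (simp add: cof_game_iff_frequently)
  moreover have "\<forall>\<^sub>F xs :: 'a list in iterated_filter deep_sphere k.
      ?eq xs \<longrightarrow> (\<exists>f :: 'a \<Rightarrow>\<^sub>L real. norm f \<le> 1 \<and> ?R xs f)"
    using eventually_deep_norm[of k]
  proof eventually_elim
    case (elim xs)
    show ?case
    proof
      assume "?eq xs"
      then obtain A B where AB: "A > 0" "B > 0" "2 = A * B"
        and eq: "\<And>b. 1 / A * norm (\<Sum>i<k. b i *\<^sub>R xs ! i) \<le> N (\<Sum>i<k. b i *\<^sub>R unit_vec i)"
          "\<And>b. N (\<Sum>i<k. b i *\<^sub>R unit_vec i) \<le> B * norm (\<Sum>i<k. b i *\<^sub>R xs ! i)"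
        unfolding equivalent_seqs_def by blast
      let ?e = "\<lambda>i :: nat. if i = 0 then 1 else 0 :: real"
      have unit: "(\<Sum>i<k. ?e i *\<^sub>R z i) = z 0" for z :: "nat \<Rightarrow> 'v::real_vector"
      proof -
        have "(\<Sum>i<k. ?e i *\<^sub>R z i) = (\<Sum>i<k. if i = 0 then z i else 0)" by (intro sum.cong) auto
        then show ?thesis using k by simp
      qed
      have "norm (xs ! 0) = 1" using elim k by simp
      then have "1 / A \<le> 1" using eq(1)[of ?e] N1 by (simp add: unit)
      then have "B \<le> 2" using AB mult_right_mono[of 1 A B] by (simp add: field_simps)
      then have "N ?v \<le> 2 * norm (\<Sum>i<k. a i *\<^sub>R xs ! i)"
        using eq(2)[of a] mult_right_mono[of B 2 "norm (\<Sum>i<k. a i *\<^sub>R xs ! i)"] by simp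
      then show "\<exists>f :: 'a \<Rightarrow>\<^sub>L real. norm f \<le> 1 \<and> ?R xs f"
        using norming_functional[of "\<Sum>i<k. a i *\<^sub>R xs ! i"] by auto
    qed
  qed
  ultimately have "frequently (\<lambda>xs :: 'a list. \<exists>f :: 'a \<Rightarrow>\<^sub>L real. norm f \<le> 1 \<and> ?R xs f) (iterated_filter deep_sphere k)"
    by (rule frequently_rev_mp)
  then have "cof_game k (\<lambda>xs :: 'a list. \<exists>f :: 'a \<Rightarrow>\<^sub>L real. norm f \<le> 1 \<and> ?R xs f) []"
    by (simp add: cof_game_iff_frequently)
  then obtain f0 :: "'a \<Rightarrow>\<^sub>L real" where f0: "norm f0 \<le> 1" "winning ?R k [] f0"
    using winning_of_cof_game[of k ?R "[]"] by blast
  have "N ?v / 2 \<le> E + 1" by (rule winning_bounded_by_concentration[OF conc1 conc2 k a f0])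
  then show ?thesis by simp
qed

text \<open>
  The upper estimate comes from concentration. The lower one holds for every normalized
  monotone basis, as a coefficient is a difference of two consecutive partial sums.
\<close>

lemma asymptotically_c0_of_hamming_concentration:
  assumes conc1: "hamming_concentration TYPE('a::real_normed_vector set \<times> 'a set \<times> real) TYPE('a) 2 D"
    and conc2: "hamming_concentration TYPE(nat) TYPE('a) (2 * D) E"
  shows "asymptotically_c0 TYPE('a)"
proof -
  \<comment> \<open>The absolute value ensures \<open>A \<ge> 1\<close>.\<close>
  define A where "A = 2 * (\<bar>E\<bar> + 1)"
  have A: "A \<ge> 1" by (simp add: A_def)
  have "equivalent_seqs (A * 2) k N unit_vec (linf_norm k) unit_vec"
    if k: "k \<ge> 1" and N: "N \<in> asymptotic_structure TYPE('a) k" for k N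
  proof -
    have bounds: "1 / A * N (\<Sum>i<k. a i *\<^sub>R unit_vec i) \<le> linf_norm k (\<Sum>i<k. a i *\<^sub>R unit_vec i) \<and>
        linf_norm k (\<Sum>i<k. a i *\<^sub>R unit_vec i) \<le> 2 * N (\<Sum>i<k. a i *\<^sub>R unit_vec i)"
      for a :: "nat \<Rightarrow> real"
    proof -
      let ?v = "\<Sum>i<k. a i *\<^sub>R unit_vec i"
      have mono: "N \<in> normalized_monotone_norms k" using N by (simp add: asymptotic_structure_def)
      define M where "M = linf_norm k ?v"
      have M_eq: "M = Max ((\<lambda>i. \<bar>a i\<bar>) ` {..<k})"
        unfolding M_def linf_norm_def by (intro arg_cong[of _ _ Max] image_cong) (auto simp: lookup_sum_unit_vec)
      have a_le: "\<bar>a i\<bar> \<le> M" if "i < k" for i unfolding M_eq using that by (intro Max_ge) auto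
      have "0 \<in> {..<k}" using k by simp
      then have "M \<in> (\<lambda>i. \<bar>a i\<bar>) ` {..<k}" unfolding M_eq by (intro Max_in) auto
      then obtain j where j: "j < k" "M = \<bar>a j\<bar>" by auto
      have upper: "linf_norm k ?v \<le> 2 * N ?v"
        using monotone_norm_coefficient[OF mono j(1), of a] j(2) by (simp add: M_def)
      have "N ?v \<le> A * M"
      proof (cases "M = 0")
        case True
        then have "a i = 0" if "i < k" for i using a_le[OF that] by simp
        then have "?v = 0" by simp
        moreover have "N 0 = 0" using mono unfolding normalized_monotone_norms_def norm_on_def by (auto simp: Rn_def)
        ultimately show ?thesis using True by simp
      next
        case False
        then have M: "M > 0" using j by simp
        let ?b = "\<lambda>i. a i / M"
        have "\<bar>?b i\<bar> \<le> 1" if "i < k" for i using a_le[OF that] M by simp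
        then have "N (\<Sum>i<k. ?b i *\<^sub>R unit_vec i) \<le> 2 * (E + 1)"
          by (rule asymptotic_structure_bounded_by_concentration[OF conc1 conc2 k N])
        also have "\<dots> \<le> A" by (simp add: A_def)
        finally have b: "N (\<Sum>i<k. ?b i *\<^sub>R unit_vec i) \<le> A" .
        have "?v = M *\<^sub>R (\<Sum>i<k. ?b i *\<^sub>R unit_vec i)" using M by (simp add: scaleR_sum_right)
        moreover have "(\<Sum>i<k. ?b i *\<^sub>R unit_vec i) \<in> Rn k"
          by (auto simp: Rn_def in_keys_iff lookup_sum_unit_vec split: if_splits)
        ultimately have "N ?v = \<bar>M\<bar> * N (\<Sum>i<k. ?b i *\<^sub>R unit_vec i)"
          using mono unfolding normalized_monotone_norms_def norm_on_def by simp
        then show ?thesis using b M by (simp add: mult.commute)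
      qed
      then have "1 / A * N ?v \<le> linf_norm k ?v" using A by (simp add: M_def field_simps)
      then show ?thesis using upper by (rule conjI)
    qed
    then show ?thesis unfolding equivalent_seqs_def using A lin_indep_unit_vec
      by (intro conjI exI[of _ A] exI[of _ "2 :: real"]) auto
  qed
  then have "C_asymptotically_c0 (A * 2) TYPE('a)" by (simp add: C_asymptotically_c0_def)
  then show ?thesis unfolding asymptotically_c0_def using A by (intro exI[of _ "A * 2"]) simp
qed

theorem theoremA:
  assumes "reflexive_space TYPE('y::banach)"
    and "asymptotically_c0 TYPE('y)"
    and "coarsely_embeds TYPE('x::banach) TYPE('y)"
  shows "reflexive_space TYPE('x) \<and> asymptotically_c0 TYPE('x)"
proof
  note concentration = hamming_concentration_coarse[OF assms]
  show "reflexive_space TYPE('x)"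
    by (rule reflexive_of_hamming_concentration[OF concentration])
  obtain D where D: "hamming_concentration TYPE('x set \<times> 'x set \<times> real) TYPE('x) 2 D"
    using concentration by blast
  obtain E where E: "hamming_concentration TYPE(nat) TYPE('x) (2 * D) E"
    using concentration by blast
  show "asymptotically_c0 TYPE('x)"
    by (rule asymptotically_c0_of_hamming_concentration[OF D E])
qed

end
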